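(* Let $(\mathfrak{g},\langle\cdot,\cdot\rangle)$ be one of the following metric Lie algebras with basis $\{e_1,e_2,e_3,e_4\}$ and inner product $\langle\cdot,\cdot\rangle=\langle\cdot,\cdot\rangle_t$, $t>0$, defined by $\langle e_i,e_j\rangle_t=t\,\delta_{ij}$ (brackets of basis elements not listed and not determined by antisymmetry are zero): (a) $\mathfrak{d}_{4,\frac12}$: $[e_1,e_2]=e_3$, $[e_4,e_1]=\frac12e_1$, $[e_4,e_2]=\frac12e_2$, $[e_4,e_3]=e_3$; (b) $\mathfrak{d}_{4,2}$: $[e_1,e_2]=e_3$, $[e_4,e_1]=e_1$, $[e_4,e_2]=-\frac12e_2$, $[e_4,e_3]=\frac12e_3$; (c) $\mathfrak{d}'_{4,\frac{\delta}{2}}$ with $\delta>0$: $[e_1,e_2]=e_3$, $[e_4,e_1]=\frac12e_1-\frac1\delta e_2$, $[e_4,e_2]=\frac1\delta e_1+\frac12e_2$, $[e_4,e_3]=e_3$. Let $(G,g)$ be the associated simply connected Lie group with the corresponding left invariant metric. Then $(G,g)$ is irreducible as a Riemannian manifold.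
   Context: A metric Lie algebra is a finite-dimensional real Lie algebra with a (positive definite) inner product. Given a metric Lie algebra $(\mathfrak{g},\langle\cdot,\cdot\rangle)$, $G$ denotes the simply connected Lie group with Lie algebra $\mathfrak{g}$ (left invariant vector fields), and $g$ is the left invariant Riemannian metric on $G$ whose value at the identity is $\langle\cdot,\cdot\rangle$. A connected Riemannian manifold $(M,g)$ is called irreducible if the restricted holonomy group $\mathrm{Hol}^0_p(M,g)$ (parallel translations along contractible loops at $p$) acts irreducibly on $T_pM$. *)

theory Defs
  imports "HOL-Analysis.Analysis" "HOL-Algebra.Group"
begin

section \<open>Smooth manifolds\<close>

text \<open>
  A manifold is a whole type \<open>'m\<close> (Hausdorff and second countable in the theorem) together with a
  smooth atlas modelled on a Euclidean space \<open>'e\<close>. A chart is a pair of a domain \<open>U\<close> and a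
  coordinate map; the values of the coordinate map outside \<open>U\<close> are irrelevant.
\<close>

primrec Ck_on :: "nat \<Rightarrow> 'a::real_normed_vector set \<Rightarrow> ('a \<Rightarrow> 'b::real_normed_vector) \<Rightarrow> bool" where
  "Ck_on 0 S f \<longleftrightarrow> continuous_on S f"
| "Ck_on (Suc k) S f \<longleftrightarrow> (\<forall>x\<in>S. f differentiable (at x)) \<and>
     (\<forall>v. Ck_on k S (\<lambda>x. frechet_derivative f (at x) v))"

text \<open>Only used for open \<open>S\<close> in finite-dimensional spaces.\<close>

definition smooth_on :: "'a::real_normed_vector set \<Rightarrow> ('a \<Rightarrow> 'b::real_normed_vector) \<Rightarrow> bool" where
  "smooth_on S f \<longleftrightarrow> (\<forall>k. Ck_on k S f)"

type_synonym ('m, 'e) chart = "'m set \<times> ('m \<Rightarrow> 'e)"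

definition smooth_atlas :: "('m::topological_space, 'e::euclidean_space) chart set \<Rightarrow> bool" where
  "smooth_atlas A \<longleftrightarrow>
     (\<Union>(U, \<phi>)\<in>A. U) = UNIV \<and>
     (\<forall>(U, \<phi>)\<in>A. open U \<and> open (\<phi> ` U) \<and> homeomorphism U (\<phi> ` U) \<phi> (inv_into U \<phi>)) \<and>
     (\<forall>(U, \<phi>)\<in>A. \<forall>(V, \<psi>)\<in>A. smooth_on (\<phi> ` (U \<inter> V)) (\<psi> \<circ> inv_into U \<phi>))"

definition smooth_map ::
  "('m::topological_space, 'e::euclidean_space) chart set \<Rightarrow>
   ('n::topological_space, 'f::euclidean_space) chart set \<Rightarrow> ('m \<Rightarrow> 'n) \<Rightarrow> bool" where
  "smooth_map A B F \<longleftrightarrow> continuous_on UNIV F \<and>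
     (\<forall>(U, \<phi>)\<in>A. \<forall>(V, \<psi>)\<in>B. smooth_on (\<phi> ` (U \<inter> F -` V)) (\<psi> \<circ> F \<circ> inv_into U \<phi>))"

definition prod_atlas ::
  "('m, 'e) chart set \<Rightarrow> ('n, 'f) chart set \<Rightarrow> ('m \<times> 'n, 'e \<times> 'f) chart set" where
  "prod_atlas A B = {(U \<times> V, map_prod \<phi> \<psi>) | U \<phi> V \<psi>. (U, \<phi>) \<in> A \<and> (V, \<psi>) \<in> B}"

definition smooth_at ::
  "('m::topological_space, 'e::euclidean_space) chart set \<Rightarrow> 'm \<Rightarrow> ('m \<Rightarrow> real) \<Rightarrow> bool" where
  "smooth_at A p f \<longleftrightarrow> (\<exists>W. open W \<and> p \<in> W \<and>
     (\<forall>(U, \<phi>)\<in>A. smooth_on (\<phi> ` (U \<inter> W)) (f \<circ> inv_into U \<phi>)))"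

definition smooth_curve_on ::
  "('m::topological_space, 'e::euclidean_space) chart set \<Rightarrow> real set \<Rightarrow> (real \<Rightarrow> 'm) \<Rightarrow> bool" where
  "smooth_curve_on A I c \<longleftrightarrow> continuous_on I c \<and>
     (\<forall>(U, \<phi>)\<in>A. smooth_on (I \<inter> c -` U) (\<phi> \<circ> c))"


section \<open>Tangent vectors and vector fields\<close>

text \<open>
  A tangent vector at \<open>p\<close> is the velocity at \<open>p\<close> of a smooth curve, regarded as the operator
  \<open>f \<mapsto> (f \<circ> c)'(0)\<close> on functions that are smooth near \<open>p\<close>. By convention the operator is \<open>0\<close> on all
  other functions, so that equality of tangent vectors is equality in HOL.
\<close>

type_synonym 'm tangent = "('m \<Rightarrow> real) \<Rightarrow> real"

definition velocity ::
  "('m::topological_space, 'e::euclidean_space) chart set \<Rightarrow> (real \<Rightarrow> 'm) \<Rightarrow> real \<Rightarrow> 'm tangent" where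
  "velocity A c t = (\<lambda>f. if smooth_at A (c t) f then deriv (f \<circ> c) t else 0)"

definition tangent_space ::
  "('m::topological_space, 'e::euclidean_space) chart set \<Rightarrow> 'm \<Rightarrow> 'm tangent set" where
  "tangent_space A p =
     {velocity A c 0 | c. \<exists>\<epsilon>>0. smooth_curve_on A {-\<epsilon><..<\<epsilon>} c \<and> c 0 = p}"

definition lincomb :: "real \<Rightarrow> 'm tangent \<Rightarrow> real \<Rightarrow> 'm tangent \<Rightarrow> 'm tangent" where
  "lincomb a u b v = (\<lambda>f. a * u f + b * v f)"

definition pushforward ::
  "('n::topological_space, 'f::euclidean_space) chart set \<Rightarrow> ('m \<Rightarrow> 'n) \<Rightarrow> 'm \<Rightarrow>
   'm tangent \<Rightarrow> 'n tangent" where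
  "pushforward B F p v = (\<lambda>f. if smooth_at B (F p) f then v (f \<circ> F) else 0)"

definition smooth_vector_field ::
  "('m::topological_space, 'e::euclidean_space) chart set \<Rightarrow> ('m \<Rightarrow> 'm tangent) \<Rightarrow> bool" where
  "smooth_vector_field A X \<longleftrightarrow> (\<forall>p. X p \<in> tangent_space A p) \<and>
     (\<forall>p f. smooth_at A p f \<longrightarrow> smooth_at A p (\<lambda>q. X q f))"

definition vf_bracket ::
  "('m::topological_space, 'e::euclidean_space) chart set \<Rightarrow>
   ('m \<Rightarrow> 'm tangent) \<Rightarrow> ('m \<Rightarrow> 'm tangent) \<Rightarrow> ('m \<Rightarrow> 'm tangent)" where
  "vf_bracket A X Y = (\<lambda>p f. if smooth_at A p f
     then X p (\<lambda>q. Y q f) - Y p (\<lambda>q. X q f) else 0)"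

text \<open>The coordinate vector at \<open>p\<close> with components \<open>u\<close>, and the components of a tangent vector.\<close>

definition coord_vec ::
  "('m::topological_space, 'e::euclidean_space) chart set \<Rightarrow> ('m, 'e) chart \<Rightarrow> 'm \<Rightarrow> 'e \<Rightarrow> 'm tangent"
  where
  "coord_vec A = (\<lambda>(U, \<phi>) p u f. if smooth_at A p f
     then frechet_derivative (f \<circ> inv_into U \<phi>) (at (\<phi> p)) u else 0)"

definition components ::
  "('m::topological_space, 'e::euclidean_space) chart set \<Rightarrow> ('m, 'e) chart \<Rightarrow> 'm \<Rightarrow> 'm tangent \<Rightarrow> 'e"
  where
  "components A C p v = (THE u. v = coord_vec A C p u)"


section \<open>Riemannian metrics and parallel transport\<close>

type_synonym 'm metric = "'m \<Rightarrow> 'm tangent \<Rightarrow> 'm tangent \<Rightarrow> real"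

definition metric_in_chart ::
  "('m::topological_space, 'e::euclidean_space) chart set \<Rightarrow> 'm metric \<Rightarrow> ('m, 'e) chart \<Rightarrow>
   'e \<Rightarrow> 'e \<Rightarrow> 'e \<Rightarrow> real" where
  "metric_in_chart A g C x u v =
     (let p = inv_into (fst C) (snd C) x in g p (coord_vec A C p u) (coord_vec A C p v))"

definition riemannian_metric ::
  "('m::topological_space, 'e::euclidean_space) chart set \<Rightarrow> 'm metric \<Rightarrow> bool" where
  "riemannian_metric A g \<longleftrightarrow>
     (\<forall>p. \<forall>u\<in>tangent_space A p. \<forall>v\<in>tangent_space A p. g p u v = g p v u) \<and>
     (\<forall>p. \<forall>u\<in>tangent_space A p. \<forall>v\<in>tangent_space A p. \<forall>w\<in>tangent_space A p. \<forall>a b.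
        g p (lincomb a u b v) w = a * g p u w + b * g p v w) \<and>
     (\<forall>p. \<forall>u\<in>tangent_space A p. u \<noteq> (\<lambda>f. 0) \<longrightarrow> g p u u > 0) \<and>
     (\<forall>(U, \<phi>)\<in>A. \<forall>u v. smooth_on (\<phi> ` U) (\<lambda>x. metric_in_chart A g (U, \<phi>) x u v))"

text \<open>
  The Levi-Civita connection in a chart: for constant-coefficient fields \<open>u\<close>, \<open>v\<close> in the chart,
  \<open>christoffel A g C x u v\<close> is the coordinate expression of \<open>\<nabla>\<^sub>u v\<close> at \<open>x\<close>. It is the unique
  bilinear map that is symmetric (no torsion, as the fields commute) and compatible with the metric.
\<close>

definition christoffel ::
  "('m::topological_space, 'e::euclidean_space) chart set \<Rightarrow> 'm metric \<Rightarrow> ('m, 'e) chart \<Rightarrow>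
   'e \<Rightarrow> 'e \<Rightarrow> 'e \<Rightarrow> 'e" where
  "christoffel A g C x = (THE \<Gamma>. bilinear \<Gamma> \<and> (\<forall>u v. \<Gamma> u v = \<Gamma> v u) \<and>
     (\<forall>u v w. frechet_derivative (\<lambda>y. metric_in_chart A g C y v w) (at x) u =
        metric_in_chart A g C x (\<Gamma> u v) w + metric_in_chart A g C x v (\<Gamma> u w)))"

text \<open>Smooth on \<open>[a, b]\<close> up to the end points, that is, with a smooth extension beyond them.\<close>

definition smooth_arc ::
  "('m::topological_space, 'e::euclidean_space) chart set \<Rightarrow> real \<Rightarrow> real \<Rightarrow> (real \<Rightarrow> 'm) \<Rightarrow> bool" where
  "smooth_arc A a b \<gamma> \<longleftrightarrow> (\<exists>c. \<exists>\<epsilon>>0. smooth_curve_on A {a-\<epsilon><..<b+\<epsilon>} c \<and> (\<forall>t\<in>{a..b}. \<gamma> t = c t))"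

definition piecewise_smooth_path ::
  "('m::topological_space, 'e::euclidean_space) chart set \<Rightarrow> (real \<Rightarrow> 'm) \<Rightarrow> bool" where
  "piecewise_smooth_path A \<gamma> \<longleftrightarrow> path \<gamma> \<and>
     (\<exists>n (s :: nat \<Rightarrow> real). s 0 = 0 \<and> s n = 1 \<and>
        (\<forall>i<n. s i < s (Suc i) \<and> smooth_arc A (s i) (s (Suc i)) \<gamma>))"

text \<open>
  Parallel vector fields along a piecewise smooth path: in every chart the components \<open>a\<close> of \<open>V\<close>
  are continuous and satisfy \<open>a' + \<Gamma>(\<gamma>', a) = 0\<close> except at finitely many times (which may include
  the break points of \<open>\<gamma>\<close>).
\<close>

definition parallel_along ::
  "('m::topological_space, 'e::euclidean_space) chart set \<Rightarrow> 'm metric \<Rightarrow> (real \<Rightarrow> 'm) \<Rightarrow>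
   (real \<Rightarrow> 'm tangent) \<Rightarrow> bool" where
  "parallel_along A g \<gamma> V \<longleftrightarrow>
     (\<forall>t\<in>{0..1}. V t \<in> tangent_space A (\<gamma> t)) \<and>
     (\<exists>S. finite S \<and> (\<forall>(U, \<phi>)\<in>A.
        continuous_on {t\<in>{0..1}. \<gamma> t \<in> U} (\<lambda>t. components A (U, \<phi>) (\<gamma> t) (V t)) \<and>
        (\<forall>t\<in>{0<..<1} - S. \<gamma> t \<in> U \<longrightarrow>
           ((\<lambda>s. components A (U, \<phi>) (\<gamma> s) (V s)) has_vector_derivative
              - christoffel A g (U, \<phi>) (\<phi> (\<gamma> t)) (vector_derivative (\<phi> \<circ> \<gamma>) (at t))
                  (components A (U, \<phi>) (\<gamma> t) (V t))) (at t))))"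

definition parallel_transport ::
  "('m::topological_space, 'e::euclidean_space) chart set \<Rightarrow> 'm metric \<Rightarrow> (real \<Rightarrow> 'm) \<Rightarrow>
   'm tangent \<Rightarrow> 'm tangent" where
  "parallel_transport A g \<gamma> v = (THE w. \<exists>V. parallel_along A g \<gamma> V \<and> V 0 = v \<and> V 1 = w)"


section \<open>Restricted holonomy and irreducibility\<close>

definition restricted_holonomy ::
  "('m::topological_space, 'e::euclidean_space) chart set \<Rightarrow> 'm metric \<Rightarrow> 'm \<Rightarrow>
   ('m tangent \<Rightarrow> 'm tangent) set" where
  "restricted_holonomy A g p =
     {restrict (parallel_transport A g \<gamma>) (tangent_space A p) | \<gamma>.
        piecewise_smooth_path A \<gamma> \<and> pathstart \<gamma> = p \<and> pathfinish \<gamma> = p \<and>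
        homotopic_paths UNIV \<gamma> (\<lambda>_. p)}"

definition tangent_subspace :: "'m tangent set \<Rightarrow> bool" where
  "tangent_subspace W \<longleftrightarrow> (\<lambda>f. 0) \<in> W \<and> (\<forall>u\<in>W. \<forall>v\<in>W. \<forall>a b. lincomb a u b v \<in> W)"

definition acts_irreducibly :: "('m tangent \<Rightarrow> 'm tangent) set \<Rightarrow> 'm tangent set \<Rightarrow> bool" where
  "acts_irreducibly H T \<longleftrightarrow> T \<noteq> {\<lambda>f. 0} \<and>
     (\<forall>W. tangent_subspace W \<and> W \<subseteq> T \<and> (\<forall>h\<in>H. h ` W \<subseteq> W) \<longrightarrow> W = {\<lambda>f. 0} \<or> W = T)"

definition irreducible_riemannian ::
  "('m::topological_space, 'e::euclidean_space) chart set \<Rightarrow> 'm metric \<Rightarrow> bool" where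
  "irreducible_riemannian A g \<longleftrightarrow>
     (\<forall>p. acts_irreducibly (restricted_holonomy A g p) (tangent_space A p))"


section \<open>Lie groups with left invariant metrics\<close>

definition lie_group ::
  "('m::topological_space, 'e::euclidean_space) chart set \<Rightarrow> 'm monoid \<Rightarrow> bool" where
  "lie_group A G \<longleftrightarrow> smooth_atlas A \<and> group G \<and> carrier G = UNIV \<and>
     smooth_map (prod_atlas A A) A (\<lambda>(a, b). a \<otimes>\<^bsub>G\<^esub> b) \<and>
     smooth_map A A (\<lambda>a. inv\<^bsub>G\<^esub> a)"

definition left_invariant_fields ::
  "('m::topological_space, 'e::euclidean_space) chart set \<Rightarrow> 'm monoid \<Rightarrow> ('m \<Rightarrow> 'm tangent) set" where
  "left_invariant_fields A G = {X. smooth_vector_field A X \<and>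
     (\<forall>a p. pushforward A (\<lambda>q. a \<otimes>\<^bsub>G\<^esub> q) p (X p) = X (a \<otimes>\<^bsub>G\<^esub> p))}"

definition left_invariant_metric ::
  "('m::topological_space, 'e::euclidean_space) chart set \<Rightarrow> 'm monoid \<Rightarrow> 'm metric \<Rightarrow> bool" where
  "left_invariant_metric A G g \<longleftrightarrow> riemannian_metric A g \<and>
     (\<forall>a p. \<forall>u\<in>tangent_space A p. \<forall>v\<in>tangent_space A p.
        g (a \<otimes>\<^bsub>G\<^esub> p) (pushforward A (\<lambda>q. a \<otimes>\<^bsub>G\<^esub> q) p u) (pushforward A (\<lambda>q. a \<otimes>\<^bsub>G\<^esub> q) p v)
          = g p u v)"

definition lie_algebra_iso ::
  "('m::topological_space, 'e::euclidean_space) chart set \<Rightarrow> 'm monoid \<Rightarrow>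
   ('v::real_vector \<Rightarrow> 'v \<Rightarrow> 'v) \<Rightarrow> ('v \<Rightarrow> 'm \<Rightarrow> 'm tangent) \<Rightarrow> bool" where
  "lie_algebra_iso A G br \<iota> \<longleftrightarrow> bij_betw \<iota> UNIV (left_invariant_fields A G) \<and>
     (\<forall>a x b y p. \<iota> (a *\<^sub>R x + b *\<^sub>R y) p = lincomb a (\<iota> x p) b (\<iota> y p)) \<and>
     (\<forall>x y. \<iota> (br x y) = vf_bracket A (\<iota> x) (\<iota> y))"

text \<open>
  \<open>(G, g)\<close> is the simply connected Lie group with left invariant metric associated with the metric
  Lie algebra \<open>('v, br, ip)\<close>, up to an identification \<open>\<iota>\<close> of \<open>'v\<close> with the left invariant fields.
\<close>

definition associated_lie_group ::
  "('v::real_vector \<Rightarrow> 'v \<Rightarrow> 'v) \<Rightarrow> ('v \<Rightarrow> 'v \<Rightarrow> real) \<Rightarrow>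
   ('m::topological_space, 'e::euclidean_space) chart set \<Rightarrow> 'm monoid \<Rightarrow> 'm metric \<Rightarrow> bool" where
  "associated_lie_group br ip A G g \<longleftrightarrow>
     lie_group A G \<and> simply_connected (UNIV :: 'm set) \<and> left_invariant_metric A G g \<and>
     (\<exists>\<iota>. lie_algebra_iso A G br \<iota> \<and> (\<forall>x y. g \<one>\<^bsub>G\<^esub> (\<iota> x \<one>\<^bsub>G\<^esub>) (\<iota> y \<one>\<^bsub>G\<^esub>) = ip x y))"


section \<open>Four-dimensional metric Lie algebras\<close>

definition metric_lie_algebra ::
  "('v::euclidean_space \<Rightarrow> 'v \<Rightarrow> 'v) \<Rightarrow> ('v \<Rightarrow> 'v \<Rightarrow> real) \<Rightarrow> bool" where
  "metric_lie_algebra br ip \<longleftrightarrow> bilinear br \<and> (\<forall>x. br x x = 0) \<and>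
     (\<forall>x y z. br x (br y z) + br y (br z x) + br z (br x y) = 0) \<and>
     bilinear ip \<and> (\<forall>x y. ip x y = ip y x) \<and> (\<forall>x. x \<noteq> 0 \<longrightarrow> ip x x > 0)"

abbreviation basis_vec :: "4 \<Rightarrow> real ^ 4" where
  "basis_vec i \<equiv> axis i 1"

text \<open>
  The antisymmetric bilinear extension of a table of brackets \<open>B i j = [e\<^sub>i, e\<^sub>j]\<close>, where the table
  lists at most one of \<open>(i, j)\<close> and \<open>(j, i)\<close> and is \<open>0\<close> elsewhere. (In type \<open>4\<close>, \<open>4 = 0\<close>.)
\<close>

definition bracket_of_table ::
  "(4 \<Rightarrow> 4 \<Rightarrow> real ^ 4) \<Rightarrow> real ^ 4 \<Rightarrow> real ^ 4 \<Rightarrow> real ^ 4" where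
  "bracket_of_table B x y = (\<Sum>i\<in>UNIV. \<Sum>j\<in>UNIV. (x $ i * y $ j - x $ j * y $ i) *\<^sub>R B i j)"

definition d4_half :: "real ^ 4 \<Rightarrow> real ^ 4 \<Rightarrow> real ^ 4" where
  "d4_half = bracket_of_table (\<lambda>i j.
     if (i, j) = (1, 2) then basis_vec 3
     else if (i, j) = (4, 1) then (1/2) *\<^sub>R basis_vec 1
     else if (i, j) = (4, 2) then (1/2) *\<^sub>R basis_vec 2
     else if (i, j) = (4, 3) then basis_vec 3
     else 0)"

definition d4_two :: "real ^ 4 \<Rightarrow> real ^ 4 \<Rightarrow> real ^ 4" where
  "d4_two = bracket_of_table (\<lambda>i j.
     if (i, j) = (1, 2) then basis_vec 3
     else if (i, j) = (4, 1) then basis_vec 1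
     else if (i, j) = (4, 2) then - (1/2) *\<^sub>R basis_vec 2
     else if (i, j) = (4, 3) then (1/2) *\<^sub>R basis_vec 3
     else 0)"

definition d4_prime :: "real \<Rightarrow> real ^ 4 \<Rightarrow> real ^ 4 \<Rightarrow> real ^ 4" where
  "d4_prime \<delta> = bracket_of_table (\<lambda>i j.
     if (i, j) = (1, 2) then basis_vec 3
     else if (i, j) = (4, 1) then (1/2) *\<^sub>R basis_vec 1 - (1/\<delta>) *\<^sub>R basis_vec 2
     else if (i, j) = (4, 2) then (1/\<delta>) *\<^sub>R basis_vec 1 + (1/2) *\<^sub>R basis_vec 2
     else if (i, j) = (4, 3) then basis_vec 3
     else 0)"

definition ip_scaled :: "real \<Rightarrow> real ^ 4 \<Rightarrow> real ^ 4 \<Rightarrow> real" where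
  "ip_scaled t x y = t * (x \<bullet> y)"

lemma ip_scaled_basis: "ip_scaled t (basis_vec i) (basis_vec j) = (if i = j then t else 0)"
  by (simp add: ip_scaled_def inner_axis_axis)

lemma distinct_4: "(1::4) \<noteq> 2" "(1::4) \<noteq> 3" "(1::4) \<noteq> 4" "(2::4) \<noteq> 3" "(2::4) \<noteq> 4" "(3::4) \<noteq> 4"
  by simp_all

lemmas bracket_simps =
  bracket_of_table_def sum_4 axis_def vec_eq_iff forall_4 distinct_4 distinct_4[symmetric]

lemma d4_half_brackets:
  "d4_half (basis_vec 1) (basis_vec 2) = basis_vec 3" "d4_half (basis_vec 4) (basis_vec 1) = (1/2) *\<^sub>R basis_vec 1"
  "d4_half (basis_vec 4) (basis_vec 2) = (1/2) *\<^sub>R basis_vec 2" "d4_half (basis_vec 4) (basis_vec 3) = basis_vec 3"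
  "d4_half (basis_vec 1) (basis_vec 3) = 0" "d4_half (basis_vec 2) (basis_vec 3) = 0"
  by (simp_all add: d4_half_def bracket_simps)

lemma d4_two_brackets:
  "d4_two (basis_vec 1) (basis_vec 2) = basis_vec 3" "d4_two (basis_vec 4) (basis_vec 1) = basis_vec 1"
  "d4_two (basis_vec 4) (basis_vec 2) = - (1/2) *\<^sub>R basis_vec 2" "d4_two (basis_vec 4) (basis_vec 3) = (1/2) *\<^sub>R basis_vec 3"
  "d4_two (basis_vec 1) (basis_vec 3) = 0" "d4_two (basis_vec 2) (basis_vec 3) = 0"
  by (simp_all add: d4_two_def bracket_simps)

lemma d4_prime_brackets:
  "d4_prime \<delta> (basis_vec 1) (basis_vec 2) = basis_vec 3" "d4_prime \<delta> (basis_vec 4) (basis_vec 1) = (1/2) *\<^sub>R basis_vec 1 - (1/\<delta>) *\<^sub>R basis_vec 2"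
  "d4_prime \<delta> (basis_vec 4) (basis_vec 2) = (1/\<delta>) *\<^sub>R basis_vec 1 + (1/2) *\<^sub>R basis_vec 2" "d4_prime \<delta> (basis_vec 4) (basis_vec 3) = basis_vec 3"
  "d4_prime \<delta> (basis_vec 1) (basis_vec 3) = 0" "d4_prime \<delta> (basis_vec 2) (basis_vec 3) = 0"
  by (simp_all add: d4_prime_def bracket_simps)

lemma bilinear_bracket_of_table: "bilinear (bracket_of_table B)"
  unfolding bilinear_def
  by (intro conjI allI; rule linearI)
    (simp_all add: bracket_of_table_def sum.distrib[symmetric] scaleR_sum_right algebra_simps
      flip: scaleR_add_left)

lemma bracket_of_table_self: "bracket_of_table B x x = 0"
  by (simp add: bracket_of_table_def mult.commute)

lemma metric_lie_algebra_ip_scaled: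
  assumes "t > 0" "bilinear br" "\<And>x. br x x = 0"
    and "\<And>x y z. br x (br y z) + br y (br z x) + br z (br x y) = 0"
  shows "metric_lie_algebra br (ip_scaled t)"
  using assms unfolding metric_lie_algebra_def
  by (auto simp: ip_scaled_def bilinear_def inner_commute algebra_simps intro!: linearI)

lemma metric_lie_algebra_d4_half: "t > 0 \<Longrightarrow> metric_lie_algebra d4_half (ip_scaled t)"
  by (rule metric_lie_algebra_ip_scaled)
    (simp_all add: d4_half_def bilinear_bracket_of_table bracket_of_table_self,
     simp add: bracket_simps field_simps)

lemma metric_lie_algebra_d4_two: "t > 0 \<Longrightarrow> metric_lie_algebra d4_two (ip_scaled t)"
  by (rule metric_lie_algebra_ip_scaled)
    (simp_all add: d4_two_def bilinear_bracket_of_table bracket_of_table_self,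
     simp add: bracket_simps field_simps)

lemma metric_lie_algebra_d4_prime: "t > 0 \<Longrightarrow> metric_lie_algebra (d4_prime \<delta>) (ip_scaled t)"
  by (rule metric_lie_algebra_ip_scaled)
    (simp_all add: d4_prime_def bilinear_bracket_of_table bracket_of_table_self,
     simp add: bracket_simps algebra_simps)

end

theory Submission
  imports Defs
begin

text \<open>
  The left invariant fields form a global frame of the tangent bundle in which the geometry has
  constant coefficients: the field \<open>X v\<close> of a vector \<open>v\<close> satisfies \<open>\<langle>X v, X w\<rangle> = t (v \<bullet> w)\<close> and
  \<open>[X v, X w] = X [v, w]\<close>. The Koszul formula therefore gives \<open>\<nabla>\<^bsub>X v\<^esub> X w = X (N v w)\<close> with constant
  skew-symmetric operators \<open>N v\<close> (\<open>christoffel_eq\<close>), and the curvature is the constant matrix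
  \<open>R(v, w) = [N v, N w] - N [v, w]\<close>.

  The core of the proof is that the orthogonal projection \<open>Q\<close> onto a subspace of a tangent space at
  \<open>p\<close> that is invariant under the restricted holonomy commutes with every \<open>R(v, w)\<close>
  (\<open>curvature_commutes_if_loops_commute\<close>). Take a ball around \<open>p\<close> in a chart and carry \<open>Q\<close> along
  the rays from \<open>p\<close> by parallel transport; this gives a field \<open>F\<close> of projections. Every triangle with
  vertex \<open>p\<close> in the ball is a contractible loop (\<open>triangle_holonomy\<close>), so the invariance says that
  parallel transport along an arbitrary segment \<open>[x, y]\<close>, not only along a ray, carries \<open>F x\<close> to \<open>F y\<close>.
  Written in the frame, where \<open>\<theta>\<close> denotes the dual coframe, this is the linear system
  \<open>dF(u) = [F, N(\<theta> u)]\<close>. Its coefficients are smooth, so \<open>F\<close> is smooth, and the derivative of \<open>F\<close>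
  along the field \<open>X v\<close> is \<open>[F, N v]\<close>. Comparing \<open>X v (X w F) - X w (X v F)\<close> with \<open>X [v, w] F\<close> gives
  \<open>[F, R(v, w)] = 0\<close>, in particular at \<open>p\<close>, where \<open>F = Q\<close>. Thus no expansion of the holonomy of
  shrinking loops enters. Parallel transport exists because the transport equation is linear
  (\<open>linear_ode_solution\<close>), and it is unique because the operators \<open>N v\<close> are skew
  (\<open>horizontal_unique\<close>).

  It remains to see that only scalar matrices are symmetric and commute with the curvature; a
  projection that is scalar is \<open>0\<close> or \<open>1\<close>. All three families are extensions of the Heisenberg
  algebra by the derivation \<open>ad e\<^sub>4\<close>. In the cases (a) and (c) this derivation has the same symmetric
  part, the rotation in (c) does not affect the curvature, and two curvature matrices
  suffice to force a symmetric matrix in their commutant to be scalar. Two curvature matrices also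
  suffice in the case (b).
\<close>


section \<open>Calculus of smooth maps on open sets\<close>

lemma frechet_derivative_eq:
  "(f has_derivative f') (at x) \<Longrightarrow> frechet_derivative f (at x) = f'"
  using frechet_derivative_at by metis

text \<open>
  Derivatives are local, so on an open set only the values on that set matter. Coordinate
  expressions below agree with the functions of interest only on a chart domain.
\<close>

lemma Ck_on_cong:
  assumes "open S" "\<And>x. x \<in> S \<Longrightarrow> f x = g x" "Ck_on k S f"
  shows "Ck_on k S g"
  using assms(2,3)
proof (induction k arbitrary: f g)
  case 0
  then show ?case by (auto cong: continuous_on_cong)
next
  case (Suc k)
  have "frechet_derivative f (at x) = frechet_derivative g (at x)" if "x \<in> S" for x
    using Suc.prems that assms(1) by (intro frechet_derivative_transform_within_open) auto
  moreover have "g differentiable at x" if "x \<in> S" for x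
    using Suc.prems that assms(1)
    by (metis (no_types, lifting) Ck_on.simps(2) differentiable_def has_derivative_transform_within_open)
  ultimately show ?case
    using Suc.prems Suc.IH[of "\<lambda>x. frechet_derivative f (at x) v" "\<lambda>x. frechet_derivative g (at x) v" for v]
    by auto
qed

text \<open>
  The form in which regularity is gained: a derivative known explicitly on \<open>S\<close> and of class
  \<open>k\<close> there makes \<open>f\<close> of class \<open>k + 1\<close>.
\<close>

lemma Ck_on_SucI:
  assumes "open S" "\<And>x. x \<in> S \<Longrightarrow> (f has_derivative f' x) (at x)"
    and "\<And>v. Ck_on k S (\<lambda>x. f' x v)"
  shows "Ck_on (Suc k) S f"
proof -
  have "Ck_on k S (\<lambda>x. frechet_derivative f (at x) v)" for v
    by (rule Ck_on_cong[OF assms(1) _ assms(3)[of v]]) (simp add: frechet_derivative_eq[OF assms(2)])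
  then show ?thesis
    using assms(2) by (auto simp: differentiable_def)
qed

lemma Ck_on_SucD:
  assumes "Ck_on (Suc k) S f"
  shows "x \<in> S \<Longrightarrow> (f has_derivative frechet_derivative f (at x)) (at x)"
    and "Ck_on k S (\<lambda>x. frechet_derivative f (at x) v)"
  using assms by (auto simp: frechet_derivative_works)

lemma Ck_on_mono_degree: "Ck_on (Suc k) S f \<Longrightarrow> Ck_on k S f"
proof (induction k arbitrary: f)
  case 0
  then show ?case
    by (auto intro!: continuous_at_imp_continuous_on differentiable_imp_continuous_within)
next
  case (Suc k)
  then show ?case by (metis Ck_on.simps(2))
qed

lemma Ck_on_subset: "Ck_on k S f \<Longrightarrow> T \<subseteq> S \<Longrightarrow> Ck_on k T f"
  by (induction k arbitrary: f) (auto intro: continuous_on_subset)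

lemma Ck_on_locally:
  assumes "\<And>x. x \<in> S \<Longrightarrow> \<exists>T. open T \<and> x \<in> T \<and> Ck_on k T f"
  shows "Ck_on k S f"
  using assms
proof (induction k arbitrary: f)
  case 0
  show ?case unfolding Ck_on.simps
  proof (intro continuous_at_imp_continuous_on ballI)
    fix x assume "x \<in> S"
    from 0[OF this] obtain T where "open T" "x \<in> T" "continuous_on T f" by auto
    then show "isCont f x" by (simp add: continuous_on_eq_continuous_at)
  qed
next
  case (Suc k)
  show ?case unfolding Ck_on.simps
  proof (intro conjI ballI allI)
    show "f differentiable at x" if "x \<in> S" for x
      using Suc.prems[OF that] by auto
    show "Ck_on k S (\<lambda>x. frechet_derivative f (at x) v)" for v
    proof (rule Suc.IH)
      fix x assume "x \<in> S"
      from Suc.prems[OF this] show "\<exists>T. open T \<and> x \<in> T \<and> Ck_on k T (\<lambda>x. frechet_derivative f (at x) v)"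
        unfolding Ck_on.simps by meson
    qed
  qed
qed

lemma Ck_on_const: "Ck_on k S (\<lambda>x. c)"
  by (induction k arbitrary: c) (auto simp: frechet_derivative_const)

lemma Ck_on_add:
  assumes "open S" "Ck_on k S f" "Ck_on k S g"
  shows "Ck_on k S (\<lambda>x. f x + g x)"
  using assms(2,3)
proof (induction k arbitrary: f g)
  case 0
  then show ?case by (simp add: continuous_on_add)
next
  case (Suc k)
  note D = Ck_on_SucD[OF Suc.prems(1)] Ck_on_SucD[OF Suc.prems(2)]
  show ?case
    by (rule Ck_on_SucI[OF assms(1) has_derivative_add[OF D(1) D(3)]])
      (assumption | rule Suc.IH[OF D(2) D(4)])+
qed

lemma Ck_on_sum:
  assumes "open S" "\<And>i. i \<in> I \<Longrightarrow> Ck_on k S (f i)"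
  shows "Ck_on k S (\<lambda>x. \<Sum>i\<in>I. f i x)"
  using assms(2)
  by (induction I rule: infinite_finite_induct) (auto intro: Ck_on_const Ck_on_add[OF assms(1)])

lemma Ck_on_linear:
  assumes "open S" "bounded_linear L" "Ck_on k S f"
  shows "Ck_on k S (\<lambda>x. L (f x))"
  using assms(3)
proof (induction k arbitrary: f)
  case 0
  then show ?case using assms(2) by (auto intro: bounded_linear.continuous_on)
next
  case (Suc k)
  note D = Ck_on_SucD[OF Suc.prems(1)]
  show ?case
    by (rule Ck_on_SucI[OF assms(1) bounded_linear.has_derivative[OF assms(2) D(1)]])
      (assumption | rule Suc.IH[OF D(2)])+
qed

lemma Ck_on_ident: "open S \<Longrightarrow> Ck_on k S (\<lambda>x. x)"
  by (cases k) (auto intro!: Ck_on_SucI Ck_on_const has_derivative_ident)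

lemma Ck_on_bilinear:
  assumes "open S" "bounded_bilinear bl" "Ck_on k S f" "Ck_on k S g"
  shows "Ck_on k S (\<lambda>x. bl (f x) (g x))"
  using assms(3,4)
proof (induction k arbitrary: f g)
  case 0
  then show ?case using assms(2) by (auto intro: bounded_bilinear.continuous_on)
next
  case (Suc k)
  note D = Ck_on_SucD[OF Suc.prems(1)] Ck_on_SucD[OF Suc.prems(2)]
  note M = Suc.prems[THEN Ck_on_mono_degree]
  show ?case
    by (rule Ck_on_SucI[OF assms(1) bounded_bilinear.FDERIV[OF assms(2) D(1) D(3)]])
      (assumption | intro Ck_on_add[OF assms(1)] Suc.IH D(2,4) M)+
qed

text \<open>
  By induction, since the chain rule expresses the derivative of \<open>g \<circ> f\<close> as a sum of products
  of components of the derivative of \<open>f\<close> with partial derivatives of \<open>g\<close> composed with \<open>f\<close>.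
\<close>

lemma Ck_on_compose:
  fixes f :: "'a::euclidean_space \<Rightarrow> 'b::euclidean_space" and g :: "'b \<Rightarrow> 'c::real_normed_vector"
  assumes "open S" "open T" "Ck_on k S f" "Ck_on k T g" "f ` S \<subseteq> T"
  shows "Ck_on k S (\<lambda>x. g (f x))"
  using assms(3-5)
proof (induction k arbitrary: f g)
  case 0
  then show ?case by (auto intro: continuous_on_compose2)
next
  case (Suc k)
  note D = Ck_on_SucD[OF Suc.prems(1)] Ck_on_SucD[OF Suc.prems(2)]
  let ?f' = "\<lambda>x. frechet_derivative f (at x)" and ?g' = "\<lambda>y. frechet_derivative g (at y)"
  show ?case
  proof (rule Ck_on_SucI[OF assms(1)])
    show "((\<lambda>x. g (f x)) has_derivative (\<lambda>v. \<Sum>b\<in>Basis. (?f' x v \<bullet> b) *\<^sub>R ?g' (f x) b)) (at x)"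
      if "x \<in> S" for x
    proof -
      have d: "(g has_derivative ?g' (f x)) (at (f x))"
        using D(3) Suc.prems(3) that by blast
      then interpret bounded_linear "?g' (f x)" by (rule has_derivative_bounded_linear)
      have "?g' (f x) w = (\<Sum>b\<in>Basis. (w \<bullet> b) *\<^sub>R ?g' (f x) b)" for w
        by (subst euclidean_representation[of w, symmetric]) (simp only: sum scaleR)
      then have "(\<lambda>v. ?g' (f x) (?f' x v)) = (\<lambda>v. \<Sum>b\<in>Basis. (?f' x v \<bullet> b) *\<^sub>R ?g' (f x) b)"
        by blast
      then show ?thesis
        using has_derivative_compose[OF D(1)[OF that] d] by simp
    qed
    show "Ck_on k S (\<lambda>x. \<Sum>b\<in>Basis. (?f' x v \<bullet> b) *\<^sub>R ?g' (f x) b)" for v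
      by (intro Ck_on_sum[OF assms(1)] Ck_on_bilinear[OF assms(1) bounded_bilinear_scaleR]
          Ck_on_linear[OF assms(1) bounded_linear_inner_left] Suc.IH Suc.prems(3)
          D(2,4) Ck_on_mono_degree[OF Suc.prems(1)])
  qed
qed

lemma smooth_on_D:
  assumes "smooth_on S f" "x \<in> S"
  shows "(f has_derivative frechet_derivative f (at x)) (at x)"
  using assms Ck_on_SucD(1) unfolding smooth_on_def by blast

lemma smooth_on_cong:
  "open S \<Longrightarrow> (\<And>x. x \<in> S \<Longrightarrow> f x = g x) \<Longrightarrow> smooth_on S f \<Longrightarrow> smooth_on S g"
  unfolding smooth_on_def using Ck_on_cong by blast

lemma smooth_on_subset: "smooth_on S f \<Longrightarrow> T \<subseteq> S \<Longrightarrow> smooth_on T f"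
  unfolding smooth_on_def using Ck_on_subset by blast

lemma smooth_on_locally:
  assumes "\<And>x. x \<in> S \<Longrightarrow> \<exists>T. open T \<and> x \<in> T \<and> smooth_on T f"
  shows "smooth_on S f"
  unfolding smooth_on_def
proof
  show "Ck_on k S f" for k
    by (rule Ck_on_locally) (use assms in \<open>auto simp: smooth_on_def\<close>)
qed

lemma smooth_on_const: "smooth_on S (\<lambda>x. c)"
  unfolding smooth_on_def using Ck_on_const by blast

lemma smooth_on_add:
  "open S \<Longrightarrow> smooth_on S f \<Longrightarrow> smooth_on S g \<Longrightarrow> smooth_on S (\<lambda>x. f x + g x)"
  unfolding smooth_on_def using Ck_on_add by blast

lemma smooth_on_sum:
  "open S \<Longrightarrow> (\<And>i. i \<in> I \<Longrightarrow> smooth_on S (f i)) \<Longrightarrow> smooth_on S (\<lambda>x. \<Sum>i\<in>I. f i x)"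
  unfolding smooth_on_def by (simp add: Ck_on_sum)

lemma smooth_on_linear:
  "open S \<Longrightarrow> bounded_linear L \<Longrightarrow> smooth_on S f \<Longrightarrow> smooth_on S (\<lambda>x. L (f x))"
  unfolding smooth_on_def using Ck_on_linear by blast

lemma smooth_on_ident: "open S \<Longrightarrow> smooth_on S (\<lambda>x. x)"
  unfolding smooth_on_def using Ck_on_ident by blast

lemma smooth_on_bilinear:
  "open S \<Longrightarrow> bounded_bilinear bl \<Longrightarrow> smooth_on S f \<Longrightarrow> smooth_on S g
    \<Longrightarrow> smooth_on S (\<lambda>x. bl (f x) (g x))"
  unfolding smooth_on_def using Ck_on_bilinear by blast

lemma smooth_on_compose:
  fixes f :: "'a::euclidean_space \<Rightarrow> 'b::euclidean_space" and g :: "'b \<Rightarrow> 'c::real_normed_vector"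
  shows "open S \<Longrightarrow> open T \<Longrightarrow> smooth_on S f \<Longrightarrow> smooth_on T g \<Longrightarrow> f ` S \<subseteq> T
    \<Longrightarrow> smooth_on S (\<lambda>x. g (f x))"
  unfolding smooth_on_def using Ck_on_compose by blast

lemma smooth_on_continuous_on: "smooth_on S f \<Longrightarrow> continuous_on S f"
  unfolding smooth_on_def by (metis Ck_on.simps(1))

lemma smooth_on_componentwise:
  fixes f :: "'a::real_normed_vector \<Rightarrow> 'b::euclidean_space"
  assumes "open S" "\<And>b. b \<in> Basis \<Longrightarrow> smooth_on S (\<lambda>x. f x \<bullet> b)"
  shows "smooth_on S f"
proof -
  have "smooth_on S (\<lambda>x. \<Sum>b\<in>Basis. (f x \<bullet> b) *\<^sub>R b)"
    by (intro smooth_on_sum assms smooth_on_linear[of S "\<lambda>r. r *\<^sub>R b" for b] bounded_linear_scaleR_left)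
  then show ?thesis by (simp add: euclidean_representation)
qed


section \<open>Linear differential equations and derivatives along segments\<close>

text \<open>
  Picard iteration: the iterates are bounded by the terms of the exponential series, so the series
  of iterates and the series of their derivatives converge uniformly on the whole interval.
\<close>

lemma linear_ode_solution:
  fixes bl :: "'a::real_normed_vector \<Rightarrow> 'b::banach \<Rightarrow> 'b"
  assumes bl: "bounded_bilinear bl" and contL: "continuous_on {0..1::real} L"
  shows "\<exists>y. y 0 = y0 \<and>
    (\<forall>t\<in>{0..1}. (y has_vector_derivative bl (L t) (y t)) (at t within {0..1}))"
proof -
  interpret bounded_bilinear bl by (rule bl)
  obtain B where B: "B > 0" "\<And>a b. norm (bl a b) \<le> norm a * norm b * B"
    using pos_bounded by blast
  have "bounded (L ` {0..1})"
    using compact_continuous_image[OF contL] compact_imp_bounded by blast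
  then obtain C where C: "C > 0" "\<And>t. t \<in> {0..1} \<Longrightarrow> norm (L t) \<le> C"
    unfolding bounded_pos by blast
  define K where "K = C * B"
  have K: "norm (bl (L t) y) \<le> K * norm y" if "t \<in> {0..1}" for t y
  proof -
    have "norm (L t) * (norm y * B) \<le> C * (norm y * B)"
      using C(2)[OF that] B(1) by (intro mult_right_mono) auto
    then show ?thesis using B(2)[of "L t" y] by (simp add: K_def mult_ac)
  qed
  have "K > 0" using B C by (simp add: K_def)
  define Y where "Y = rec_nat (\<lambda>t. y0) (\<lambda>_ f t. integral {0..t} (\<lambda>s. bl (L s) (f s)))"
  have Y0: "Y 0 = (\<lambda>t. y0)" and YS: "Y (Suc n) = (\<lambda>t. integral {0..t} (\<lambda>s. bl (L s) (Y n s)))" for n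
    by (simp_all add: Y_def)
  have contY: "continuous_on {0..1} (Y n)" for n
  proof (induction n)
    case (Suc n)
    have "continuous_on {0..1} (\<lambda>s. bl (L s) (Y n s))"
      by (intro continuous_on contL Suc)
    then show ?case
      unfolding YS by (intro indefinite_integral_continuous_1 integrable_continuous_real)
  qed (simp add: Y0)
  have contbY: "continuous_on {0..1} (\<lambda>s. bl (L s) (Y n s))" for n
    by (intro continuous_on contL contY)
  have derY: "(Y (Suc n) has_vector_derivative bl (L t) (Y n t)) (at t within {0..1})"
    if "t \<in> {0..1}" for n t
    unfolding YS by (rule integral_has_vector_derivative[OF contbY that])
  have bound: "norm (Y n t) \<le> norm y0 * ((K * t) ^ n / fact n)" if "t \<in> {0..1}" for n t
    using that
  proof (induction n arbitrary: t)
    case (Suc n)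
    let ?b = "\<lambda>n s. norm y0 * ((K * s) ^ n / fact n)"
    have "((\<lambda>s. K * ?b n s) has_integral ?b (Suc n) t - ?b (Suc n) 0) {0..t}"
    proof (rule fundamental_theorem_of_calculus)
      fix s assume "s \<in> {0..t}"
      have "((\<lambda>s. ?b (Suc n) s) has_real_derivative
          norm y0 * (real (Suc n) * (K * s) ^ n * K / fact (Suc n))) (at s within {0..t})"
        by (rule derivative_eq_intros refl | simp del: fact_Suc)+
      also have "norm y0 * (real (Suc n) * (K * s) ^ n * K / fact (Suc n)) = K * ?b n s"
        unfolding fact_Suc of_nat_mult by (simp del: of_nat_Suc)
      finally show "((\<lambda>s. ?b (Suc n) s) has_vector_derivative K * ?b n s) (at s within {0..t})"
        by (simp add: has_real_derivative_iff_has_vector_derivative)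
    qed (use Suc.prems in auto)
    then have int: "((\<lambda>s. K * ?b n s) has_integral ?b (Suc n) t) {0..t}" by simp
    have "norm (integral {0..t} (\<lambda>s. bl (L s) (Y n s))) \<le> integral {0..t} (\<lambda>s. K * ?b n s)"
    proof (rule integral_norm_bound_integral)
      show "(\<lambda>s. bl (L s) (Y n s)) integrable_on {0..t}"
        using Suc.prems by (intro integrable_continuous_real continuous_on_subset[OF contbY]) auto
      show "(\<lambda>s. K * ?b n s) integrable_on {0..t}" using int by blast
      fix s assume "s \<in> {0..t}"
      then have s: "s \<in> {0..1}" using Suc.prems by auto
      show "norm (bl (L s) (Y n s)) \<le> K * ?b n s"
        using order_trans[OF K[OF s] mult_left_mono[OF Suc.IH[OF s]]] \<open>K > 0\<close> by simp
    qed
    then show ?case using integral_unique[OF int] by (simp add: YS)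
  qed (simp add: Y0)
  define y where "y = (\<lambda>t. \<Sum>n. Y n t)"
  have "uniform_limit {0..1} (\<lambda>n t. \<Sum>i<n. Y i t) y sequentially"
    unfolding y_def
  proof (rule Weierstrass_m_test)
    show "summable (\<lambda>n. norm y0 * (K ^ n / fact n))"
      using summable_exp_generic[of K] by (intro summable_mult) (simp add: divide_inverse mult.commute)
    show "norm (Y n t) \<le> norm y0 * (K ^ n / fact n)" if "t \<in> {0..1}" for n t
    proof -
      have "(K * t) ^ n \<le> K ^ n"
        using that \<open>K > 0\<close> by (intro power_mono) (auto simp: mult_le_cancel_left1)
      then have "norm y0 * ((K * t) ^ n / fact n) \<le> norm y0 * (K ^ n / fact n)"
        by (intro mult_left_mono divide_right_mono) auto
      then show ?thesis using bound[OF that, of n] by linarith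
    qed
  qed
  note unif = this
  let ?f' = "\<lambda>n t h. h *\<^sub>R (case n of 0 \<Rightarrow> 0 | Suc m \<Rightarrow> bl (L t) (Y m t))"
  have "\<exists>z. \<forall>t\<in>{0..1}. (\<lambda>n. Y n t) sums z t \<and>
      (z has_derivative (\<lambda>h. h *\<^sub>R bl (L t) (y t))) (at t within {0..1})"
  proof (rule has_derivative_series[where f' = ?f'])
    show "(Y n has_derivative ?f' n t) (at t within {0..1})" if "t \<in> {0..1}" for n t
      using derY[OF that] by (cases n) (auto simp: Y0 has_vector_derivative_def)
    show "\<forall>\<^sub>F n in sequentially. \<forall>t\<in>{0..1}. \<forall>h.
        norm ((\<Sum>i<n. ?f' i t h) - h *\<^sub>R bl (L t) (y t)) \<le> e * norm h" if "e > 0" for e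
    proof -
      have "\<forall>\<^sub>F n in sequentially. \<forall>t\<in>{0..1}. dist (\<Sum>i<n. Y i t) (y t) < e / K"
        using uniform_limitD[OF unif, of "e / K"] that \<open>K > 0\<close> by simp
      then have "\<forall>\<^sub>F n in sequentially. \<forall>t\<in>{0..1}. \<forall>h.
        norm ((\<Sum>i<Suc n. ?f' i t h) - h *\<^sub>R bl (L t) (y t)) \<le> e * norm h"
      proof eventually_elim
        case (elim n)
        show ?case
        proof (intro ballI allI)
          fix t h :: real assume t: "t \<in> {0..1}"
          have "(\<Sum>i<Suc n. ?f' i t h) - h *\<^sub>R bl (L t) (y t) = h *\<^sub>R bl (L t) ((\<Sum>i<n. Y i t) - y t)"
            unfolding sum.lessThan_Suc_shift
            by (simp add: diff_right sum_right scaleR_right_diff_distrib scaleR_sum_right)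
          moreover have "norm (bl (L t) ((\<Sum>i<n. Y i t) - y t)) \<le> e"
          proof -
            have "K * norm ((\<Sum>i<n. Y i t) - y t) \<le> K * (e / K)"
              using elim t \<open>K > 0\<close> by (intro mult_left_mono) (auto simp: dist_norm intro: less_imp_le)
            then show ?thesis using K[OF t, of "(\<Sum>i<n. Y i t) - y t"] \<open>K > 0\<close> by simp
          qed
          ultimately show "norm ((\<Sum>i<Suc n. ?f' i t h) - h *\<^sub>R bl (L t) (y t)) \<le> e * norm h"
            by (simp del: sum.lessThan_Suc add: mult.commute[of e] mult_left_mono)
        qed
      qed
      then show ?thesis by (rule eventually_sequentially_Suc[THEN iffD1])
    qed
    show "(\<lambda>n. Y n 0) sums y0"
    proof -
      have "Y n 0 = (if n = 0 then y0 else 0)" for n by (cases n) (simp_all add: Y0 YS)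
      then show ?thesis using sums_single[of 0 "\<lambda>_. y0"] by simp
    qed
  qed auto
  then obtain z where z: "\<And>t. t \<in> {0..1} \<Longrightarrow> (\<lambda>n. Y n t) sums z t"
    and z': "\<And>t. t \<in> {0..1} \<Longrightarrow> (z has_derivative (\<lambda>h. h *\<^sub>R bl (L t) (y t))) (at t within {0..1})"
    by blast
  have zy: "z t = y t" if "t \<in> {0..1}" for t
    using sums_unique[OF z[OF that]] by (simp add: y_def)
  have "Y n 0 = (if n = 0 then y0 else 0)" for n by (cases n) (simp_all add: Y0 YS)
  then have "(\<lambda>n. Y n 0) sums y0" using sums_single[of 0 "\<lambda>_. y0"] by simp
  then have "z 0 = y0" using z[of 0] sums_unique2 by force
  then show ?thesis using z' zy by (intro exI[of _ z]) (auto simp: has_vector_derivative_def)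
qed

lemma linear_sum_Basis:
  fixes f :: "'v::euclidean_space \<Rightarrow> 'w::real_vector"
  assumes "linear f"
  shows "f v = (\<Sum>b\<in>Basis. (v \<bullet> b) *\<^sub>R f b)"
proof -
  interpret linear f by (rule assms)
  have "f v = f (\<Sum>b\<in>Basis. (v \<bullet> b) *\<^sub>R b)" by (simp add: euclidean_representation)
  then show ?thesis by (simp only: sum scale)
qed

lemma segment_derivative_bound:
  fixes F :: "'a::real_normed_vector \<Rightarrow> 'b::real_normed_vector"
  assumes der: "\<And>s. s \<in> {0..1} \<Longrightarrow>
      ((\<lambda>s. F (linepath x y s)) has_vector_derivative L (linepath x y s) (y - x)) (at s within {0..1})"
    and bound: "\<And>s. s \<in> {0..1} \<Longrightarrow> norm (L (linepath x y s) (y - x)) \<le> K * norm (y - x)"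
  shows "norm (F y - F x) \<le> K * norm (y - x)"
proof -
  have "norm (F (linepath x y 1) - F (linepath x y 0)) \<le> K * norm (y - x) * norm (1 - 0 :: real)"
  proof (rule differentiable_bound[OF convex_closed_interval])
    fix s :: real assume s: "s \<in> {0..1}"
    show "((\<lambda>s. F (linepath x y s)) has_derivative (\<lambda>h. h *\<^sub>R L (linepath x y s) (y - x))) (at s within {0..1})"
      using der[OF s] unfolding has_vector_derivative_def .
    show "onorm (\<lambda>h. h *\<^sub>R L (linepath x y s) (y - x)) \<le> K * norm (y - x)"
      by (rule onorm_le) (simp add: mult.commute[of _ "\<bar>_\<bar>"] mult_left_mono bound[OF s])
  qed simp_all
  then show ?thesis by (simp add: linepath_def)
qed

lemma norm_linear_le:
  fixes f :: "'a::euclidean_space \<Rightarrow> 'b::real_normed_vector"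
  assumes "linear f"
  shows "norm (f u) \<le> (\<Sum>b\<in>Basis. norm (f b)) * norm u"
proof -
  have "norm (f u) \<le> (\<Sum>b\<in>Basis. norm ((u \<bullet> b) *\<^sub>R f b))"
    unfolding linear_sum_Basis[OF assms, of u] by (rule norm_sum)
  also have "\<dots> \<le> (\<Sum>b\<in>Basis. norm u * norm (f b))"
    by (rule sum_mono) (simp add: Basis_le_norm mult_right_mono)
  finally show ?thesis by (simp add: sum_distrib_left mult.commute)
qed

text \<open>
  At \<open>x\<close>, the map \<open>y \<mapsto> F y - L x y\<close> has along segments a derivative that is small near \<open>x\<close>
  because \<open>L\<close> is continuous. Hence it is Lipschitz with a small constant near \<open>x\<close>.
\<close>

lemma has_derivative_if_along_segments:
  fixes F :: "'a::euclidean_space \<Rightarrow> 'b::real_normed_vector"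
  assumes B: "open B" "convex B"
    and der: "\<And>x y s. x \<in> B \<Longrightarrow> y \<in> B \<Longrightarrow> s \<in> {0..1} \<Longrightarrow>
      ((\<lambda>s. F (linepath x y s)) has_vector_derivative L (linepath x y s) (y - x)) (at s within {0..1})"
    and lin: "\<And>x. x \<in> B \<Longrightarrow> linear (L x)"
    and cont: "\<And>u. continuous_on B (\<lambda>x. L x u)"
    and x: "x \<in> B"
  shows "(F has_derivative L x) (at x)"
  unfolding has_derivative_at_alt
proof (intro conjI allI impI)
  show "bounded_linear (L x)" using lin[OF x] by (simp add: linear_conv_bounded_linear)
  fix e :: real assume e: "e > 0"
  let ?S = "\<lambda>z. \<Sum>b\<in>Basis. norm (L z b - L x b)"
  have "continuous_on B ?S" by (intro continuous_intros cont)
  then have o: "open (B \<inter> ?S -` {..<e})" by (rule continuous_open_preimage[OF _ B(1)]) simp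
  have "x \<in> B \<inter> ?S -` {..<e}" using x e by simp
  with o obtain d where d: "d > 0" "ball x d \<subseteq> B \<inter> ?S -` {..<e}" by (rule openE)
  show "\<exists>d>0. \<forall>y. norm (y - x) < d \<longrightarrow> norm (F y - F x - L x (y - x)) \<le> e * norm (y - x)"
  proof (intro exI[of _ d] conjI allI impI d(1))
    fix y assume "norm (y - x) < d"
    then have y: "y \<in> ball x d" by (simp add: dist_norm norm_minus_commute)
    have xy: "x \<in> ball x d" using d(1) by simp
    have "norm ((F y - L x y) - (F x - L x x)) \<le> e * norm (y - x)"
    proof (rule segment_derivative_bound[where L = "\<lambda>z u. L z u - L x u"])
      fix s :: real assume s: "s \<in> {0..1}"
      have "linepath x y s \<in> closed_segment x y"
        unfolding linepath_image_01[symmetric] using s by (rule imageI)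
      then have z: "linepath x y s \<in> ball x d"
        using closed_segment_subset[OF xy y convex_ball] by blast
      then have zB: "linepath x y s \<in> B" "?S (linepath x y s) < e" using d(2) by auto
      have "(linepath x y has_vector_derivative (y - x)) (at s within {0..1})"
        by (rule has_vector_derivative_linepath_within)
      from bounded_linear.has_vector_derivative[OF _ this, of "L x"]
      have "((\<lambda>s. L x (linepath x y s)) has_vector_derivative L x (y - x)) (at s within {0..1})"
        using lin[OF x] by (simp add: linear_conv_bounded_linear)
      then show "((\<lambda>s. F (linepath x y s) - L x (linepath x y s)) has_vector_derivative
          L (linepath x y s) (y - x) - L x (y - x)) (at s within {0..1})"
        using der[OF x _ s, of y] y d(2) by (intro has_vector_derivative_diff) auto
      have "norm (L (linepath x y s) (y - x) - L x (y - x)) \<le> ?S (linepath x y s) * norm (y - x)"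
        by (rule norm_linear_le[OF linear_compose_sub[OF lin[OF zB(1)] lin[OF x]]])
      also have "\<dots> \<le> e * norm (y - x)" using zB(2) by (intro mult_right_mono) auto
      finally show "norm (L (linepath x y s) (y - x) - L x (y - x)) \<le> e * norm (y - x)" .
    qed
    moreover have "(F y - L x y) - (F x - L x x) = F y - F x - L x (y - x)"
      by (simp add: linear_diff[OF lin[OF x]])
    ultimately show "norm (F y - F x - L x (y - x)) \<le> e * norm (y - x)" by simp
  qed
qed

lemma vector_derivative_zero_constant:
  fixes f :: "real \<Rightarrow> 'b::banach"
  assumes "\<And>s. s \<in> {0..1} \<Longrightarrow> (f has_vector_derivative 0) (at s within {0..1})" "s \<in> {0..1}"
  shows "f s = f 0"
proof (rule has_derivative_zero_unique_strong_interval[OF finite.emptyI _ refl _ assms(2)])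
  show "continuous_on {0..1} f"
    unfolding continuous_on_eq_continuous_within using assms(1) has_vector_derivative_continuous by blast
qed (use assms(1) in \<open>simp add: has_vector_derivative_def\<close>)


section \<open>Matrices and orthogonal projections\<close>

lemma bounded_bilinear_matrix_mult:
  "bounded_bilinear ((**) :: real ^ 'n ^ 'm \<Rightarrow> real ^ 'p ^ 'n \<Rightarrow> real ^ 'p ^ 'm)"
  unfolding bilinear_conv_bounded_bilinear[symmetric] bilinear_def
  by (intro allI conjI linearI)
    (simp_all add: matrix_matrix_mult_def vec_eq_iff sum.distrib[symmetric] sum_distrib_left algebra_simps)

interpretation matrix_mult: bounded_bilinear "(**) :: real ^ 'n ^ 'n \<Rightarrow> real ^ 'n ^ 'n \<Rightarrow> real ^ 'n ^ 'n"
  by (rule bounded_bilinear_matrix_mult)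

lemma bounded_bilinear_matrix_vector_mult:
  "bounded_bilinear ((*v) :: real ^ 'n ^ 'm \<Rightarrow> real ^ 'n \<Rightarrow> real ^ 'm)"
  unfolding bilinear_conv_bounded_bilinear[symmetric] bilinear_def
  by (intro allI conjI linearI)
    (simp_all add: matrix_vector_mult_def vec_eq_iff sum.distrib[symmetric] sum_distrib_left algebra_simps)

lemma bounded_linear_transpose: "bounded_linear (transpose :: real ^ 'n ^ 'm \<Rightarrow> real ^ 'm ^ 'n)"
  unfolding linear_conv_bounded_linear[symmetric]
  by (rule linearI) (simp_all add: transpose_def vec_eq_iff)

lemma inner_matrix_vector: "(A *v v) \<bullet> w = v \<bullet> (transpose A *v w)" for A :: "real ^ 'n ^ 'm"
  by (metis dot_lmul_matrix inner_commute transpose_matrix_vector)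

text \<open>
  The rows of an orthogonal matrix are unit vectors.
\<close>

lemma orthogonal_norm_bound:
  fixes P :: "real ^ 'n ^ 'n"
  assumes "P ** transpose P = mat 1"
  shows "norm P \<le> real CARD('n)"
proof -
  have "norm (P $ i) = 1" for i
  proof -
    have "(P ** transpose P) $ i $ i = P $ i \<bullet> P $ i"
      by (simp add: matrix_matrix_mult_def transpose_def inner_vec_def)
    then have "P $ i \<bullet> P $ i = 1" by (simp add: assms mat_def)
    then show ?thesis by (simp add: norm_eq_sqrt_inner)
  qed
  then have "(\<Sum>i\<in>UNIV. norm (P $ i)) = real CARD('n)" by simp
  moreover have "norm P \<le> (\<Sum>i\<in>UNIV. norm (P $ i))"
    unfolding norm_vec_def[of P] by (rule L2_set_le_sum) simp
  ultimately show ?thesis by simp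
qed

text \<open>
  The projection is the sum of \<open>b b\<^sup>T\<close> over an orthonormal basis of the subspace.
\<close>

lemma orthogonal_projection_matrix:
  fixes S :: "(real ^ 'n) set"
  assumes "subspace S"
  shows "\<exists>Q :: real ^ 'n ^ 'n. transpose Q = Q \<and> Q ** Q = Q \<and> (\<forall>v. v \<in> S \<longleftrightarrow> Q *v v = v)"
proof -
  obtain B where B: "B \<subseteq> S" "pairwise orthogonal B" "\<And>x. x \<in> B \<Longrightarrow> norm x = 1" "independent B" "span B = S"
    using orthonormal_basis_subspace[OF assms] by metis
  have fin: "finite B" using B(4) by (rule independent_imp_finite)
  define f where "f v = (\<Sum>b\<in>B. (v \<bullet> b) *\<^sub>R b)" for v
  have lin: "linear f"
    unfolding f_def by (rule linearI) (simp_all add: inner_add_left scaleR_left_distrib sum.distrib scaleR_sum_right)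
  have fS: "f v \<in> S" for v
    unfolding f_def B(5)[symmetric] by (intro span_sum span_scale span_base)
  have fB: "f b = b" if "b \<in> B" for b
  proof -
    have "f b = (\<Sum>c\<in>B. (if c = b then b else 0))"
      unfolding f_def
    proof (rule sum.cong)
      fix c assume c: "c \<in> B"
      have "b \<bullet> b = 1" using B(3)[OF that] by (simp add: norm_eq_1)
      moreover have "b \<bullet> c = 0" if "c \<noteq> b"
        using pairwiseD[OF B(2) \<open>b \<in> B\<close> c] that by (simp add: orthogonal_def)
      ultimately show "(b \<bullet> c) *\<^sub>R c = (if c = b then b else 0)"
        by (cases "c = b") simp_all
    qed simp
    then show ?thesis using that fin by simp
  qed
  have id: "f v = v" if "v \<in> S" for v
    by (rule linear_eq_on_span[OF lin linear_id, of B, simplified]) (use fB that B(5) in auto)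
  have Q: "matrix f *v v = f v" for v by (simp add: matrix_works lin)
  show ?thesis
  proof (intro exI[of _ "matrix f"] conjI allI)
    show "transpose (matrix f) = matrix f"
      unfolding matrix_eq
    proof (intro allI, rule vector_eq_rdot[THEN iffD1], rule allI)
      fix v w
      have "(transpose (matrix f) *v v) \<bullet> w = v \<bullet> f w"
        by (simp only: inner_matrix_vector transpose_transpose Q)
      also have "\<dots> = f v \<bullet> w"
        unfolding f_def by (simp add: inner_sum_left inner_sum_right inner_commute mult.commute)
      finally show "(transpose (matrix f) *v v) \<bullet> w = (matrix f *v v) \<bullet> w" by (simp only: Q)
    qed
    show "matrix f ** matrix f = matrix f"
      unfolding matrix_eq by (simp add: matrix_vector_mul_assoc[symmetric] Q id fS)
    show "v \<in> S \<longleftrightarrow> matrix f *v v = v" for v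
      unfolding Q using id[of v] fS[of v] by auto
  qed
qed

text \<open>
  An isometry that maps the range of \<open>Q\<close> into itself maps it onto itself by comparing dimensions,
  and therefore preserves the orthogonal complement as well.
\<close>

lemma isometry_commutes_with_projection:
  fixes Q H :: "real ^ 'n ^ 'n"
  assumes Q: "transpose Q = Q" "Q ** Q = Q" and H: "transpose H ** H = mat 1"
    and inv: "\<And>v. Q *v v = v \<Longrightarrow> Q *v (H *v v) = H *v v"
  shows "H ** Q = Q ** H"
proof -
  let ?S = "{v. Q *v v = v}"
  have QQ: "Q *v (Q *v v) = Q *v v" for v by (simp add: matrix_vector_mul_assoc Q(2))
  have iso: "(H *v v) \<bullet> (H *v w) = v \<bullet> w" for v w
    by (simp add: inner_matrix_vector matrix_vector_mul_assoc H del: transpose_matrix_vector)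
  have S: "subspace ?S"
    by (rule subspaceI) (simp_all add: matrix_vector_right_distrib matrix_vector_mult_scaleR)
  have injH: "inj ((*v) H)"
    by (rule inj_on_inverseI[of _ "(*v) (transpose H)"]) (simp add: matrix_vector_mul_assoc H del: transpose_matrix_vector)
  have "(*v) H ` ?S = ?S"
  proof (rule subspace_dim_equal)
    show "subspace ((*v) H ` ?S)" by (rule linear_subspace_image[OF matrix_vector_mul_linear S])
    show "(*v) H ` ?S \<subseteq> ?S" using inv by auto
    show "dim ?S \<le> dim ((*v) H ` ?S)"
      using dim_image_eq[OF matrix_vector_mul_linear inj_on_subset[OF injH]] by simp
  qed (rule S)
  note onto = this
  have "Q *v (H *v n) = 0" if n: "Q *v n = 0" for n
  proof -
    have "Q *v (H *v n) \<in> ?S" using QQ by simp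
    then obtain w where w: "Q *v w = w" "Q *v (H *v n) = H *v w" using onto by force
    have "(Q *v (H *v n)) \<bullet> (Q *v (H *v n)) = (H *v n) \<bullet> (Q *v (H *v w))"
      using inner_matrix_vector[of Q "H *v n"] Q(1) by (simp add: w(2))
    also have "\<dots> = n \<bullet> w" using inv[OF w(1)] by (simp add: iso)
    also have "\<dots> = n \<bullet> (transpose Q *v w)" by (simp add: Q(1) w(1) del: transpose_matrix_vector)
    also have "\<dots> = 0" using inner_matrix_vector[of Q n w] n by simp
    finally show ?thesis by simp
  qed
  note ker = this
  have n0: "Q *v (H *v (v - Q *v v)) = 0" for v
    by (rule ker) (simp add: QQ matrix_vector_mult_diff_distrib)
  have "H *v (Q *v v) = Q *v (H *v v)" for v
    using n0[of v] inv[OF QQ, of v] by (simp add: matrix_vector_mult_diff_distrib)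
  then show ?thesis unfolding matrix_eq by (simp add: matrix_vector_mul_assoc[symmetric])
qed


section \<open>Charts and tangent vectors\<close>

locale manifold =
  fixes A :: "('m::topological_space, 'e::euclidean_space) chart set"
  assumes atlas: "smooth_atlas A"
begin

lemma chartD:
  assumes "(U, \<phi>) \<in> A"
  shows "open U" "open (\<phi> ` U)" "continuous_on U \<phi>" "continuous_on (\<phi> ` U) (inv_into U \<phi>)"
    and "inj_on \<phi> U"
proof -
  have "open U \<and> open (\<phi> ` U) \<and> homeomorphism U (\<phi> ` U) \<phi> (inv_into U \<phi>)"
    using assms atlas unfolding smooth_atlas_def by blast
  then show "open U" "open (\<phi> ` U)" "continuous_on U \<phi>" "continuous_on (\<phi> ` U) (inv_into U \<phi>)"
    "inj_on \<phi> U"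
    unfolding homeomorphism_def by (auto intro: inj_on_inverseI[of U "inv_into U \<phi>"])
qed

lemma chart_inv:
  assumes "(U, \<phi>) \<in> A"
  shows "q \<in> U \<Longrightarrow> inv_into U \<phi> (\<phi> q) = q"
    and "x \<in> \<phi> ` U \<Longrightarrow> \<phi> (inv_into U \<phi> x) = x"
    and "x \<in> \<phi> ` U \<Longrightarrow> inv_into U \<phi> x \<in> U"
  by (rule inv_into_f_f[OF chartD(5)[OF assms]] f_inv_into_f inv_into_into; assumption)+

lemma chart_cover: "\<exists>(U, \<phi>)\<in>A. p \<in> U"
proof -
  have "(\<Union>(U, \<phi>)\<in>A. U) = UNIV" using atlas unfolding smooth_atlas_def by (rule conjunct1)
  then have "p \<in> (\<Union>(U, \<phi>)\<in>A. U)" by simp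
  then show ?thesis by (simp add: case_prod_beta)
qed

lemma transition_smooth:
  "(U, \<phi>) \<in> A \<Longrightarrow> (V, \<psi>) \<in> A \<Longrightarrow> smooth_on (\<phi> ` (U \<inter> V)) (\<psi> \<circ> inv_into U \<phi>)"
  using atlas unfolding smooth_atlas_def by blast

lemma chart_image_open:
  assumes C: "(U, \<phi>) \<in> A" and "open W"
  shows "open (\<phi> ` (U \<inter> W))"
proof -
  have "\<phi> ` (U \<inter> W) = \<phi> ` U \<inter> inv_into U \<phi> -` W"
    using chart_inv[OF C] by force
  then show ?thesis
    using continuous_open_preimage[OF chartD(4)[OF C] chartD(2)[OF C] \<open>open W\<close>] by simp
qed

text \<open>
  A smooth expression in one chart is smooth in all others by the chain rule. As smoothness at \<open>p\<close> is
  a local condition, this provides test functions without any extension from the chart domain.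
\<close>

lemma smooth_at_chart:
  assumes C: "(U, \<phi>) \<in> A" and B: "open B" "B \<subseteq> \<phi> ` U" "p \<in> U" "\<phi> p \<in> B" and h: "smooth_on B h"
  shows "smooth_at A p (h \<circ> \<phi>)"
proof -
  let ?W = "U \<inter> \<phi> -` B"
  have W: "open ?W"
    by (rule continuous_open_preimage[OF chartD(3)[OF C] chartD(1)[OF C] B(1)])
  have "smooth_on (\<psi> ` (V \<inter> ?W)) (h \<circ> \<phi> \<circ> inv_into V \<psi>)" if V: "(V, \<psi>) \<in> A" for V \<psi>
  proof -
    have "smooth_on (\<psi> ` (V \<inter> ?W)) (\<lambda>x. h ((\<phi> \<circ> inv_into V \<psi>) x))"
    proof (rule smooth_on_compose[OF chart_image_open[OF V W] B(1) _ h])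
      show "smooth_on (\<psi> ` (V \<inter> ?W)) (\<phi> \<circ> inv_into V \<psi>)"
        by (rule smooth_on_subset[OF transition_smooth[OF V C]]) auto
      show "(\<phi> \<circ> inv_into V \<psi>) ` \<psi> ` (V \<inter> ?W) \<subseteq> B"
        using chart_inv(1)[OF V] by auto
    qed
    then show ?thesis by (simp add: comp_def)
  qed
  then show ?thesis
    unfolding smooth_at_def using W B by (intro exI[of _ ?W] conjI) (auto simp del: Int_iff)
qed

lemma smooth_at_imp_chart:
  assumes C: "(U, \<phi>) \<in> A" and "p \<in> U" "smooth_at A p f"
  shows "\<exists>B. open B \<and> \<phi> p \<in> B \<and> B \<subseteq> \<phi> ` U \<and> smooth_on B (f \<circ> inv_into U \<phi>)"
proof -
  obtain W where W: "open W" "p \<in> W" "smooth_on (\<phi> ` (U \<inter> W)) (f \<circ> inv_into U \<phi>)"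
    using assms unfolding smooth_at_def by blast
  then show ?thesis using chart_image_open[OF C W(1)] \<open>p \<in> U\<close> by blast
qed

lemma smooth_at_differentiable:
  assumes "(U, \<phi>) \<in> A" "p \<in> U" "smooth_at A p f"
  shows "((f \<circ> inv_into U \<phi>) has_derivative frechet_derivative (f \<circ> inv_into U \<phi>) (at (\<phi> p))) (at (\<phi> p))"
  using smooth_at_imp_chart[OF assms] smooth_on_D by blast

lemma coord_vec_apply:
  "coord_vec A (U, \<phi>) p u f =
    (if smooth_at A p f then frechet_derivative (f \<circ> inv_into U \<phi>) (at (\<phi> p)) u else 0)"
  by (simp add: coord_vec_def)

lemma coord_vec_on_chart:
  assumes C: "(U, \<phi>) \<in> A" and B: "open B" "B \<subseteq> \<phi> ` U" "p \<in> U" "\<phi> p \<in> B" and h: "smooth_on B h"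
  shows "coord_vec A (U, \<phi>) p u (h \<circ> \<phi>) = frechet_derivative h (at (\<phi> p)) u"
proof -
  have d: "((h \<circ> \<phi> \<circ> inv_into U \<phi>) has_derivative frechet_derivative h (at (\<phi> p))) (at (\<phi> p))"
    by (rule has_derivative_transform_within_open[OF smooth_on_D[OF h B(4)] B(1,4)])
      (use B(2) chart_inv(2)[OF C] in auto)
  show ?thesis
    unfolding coord_vec_apply frechet_derivative_eq[OF d] using smooth_at_chart[OF assms] by simp
qed

lemma coord_vec_coordinate:
  assumes "(U, \<phi>) \<in> A" "p \<in> U"
  shows "coord_vec A (U, \<phi>) p u ((\<lambda>x. x \<bullet> b) \<circ> \<phi>) = u \<bullet> b"
    and "smooth_at A p ((\<lambda>x. x \<bullet> b) \<circ> \<phi>)"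
proof -
  have h: "smooth_on (\<phi> ` U) (\<lambda>x. x \<bullet> b)"
    by (rule smooth_on_linear[OF _ bounded_linear_inner_left smooth_on_ident]) (use chartD[OF assms(1)] in auto)
  have d: "((\<lambda>x. x \<bullet> b) has_derivative (\<lambda>x. x \<bullet> b)) (at (\<phi> p))"
    by (rule bounded_linear.has_derivative[OF bounded_linear_inner_left has_derivative_ident])
  have p: "\<phi> p \<in> \<phi> ` U" using assms(2) by simp
  show "coord_vec A (U, \<phi>) p u ((\<lambda>x. x \<bullet> b) \<circ> \<phi>) = u \<bullet> b"
    unfolding coord_vec_on_chart[OF assms(1) chartD(2)[OF assms(1)] order_refl assms(2) p h]
      frechet_derivative_eq[OF d] ..
  show "smooth_at A p ((\<lambda>x. x \<bullet> b) \<circ> \<phi>)"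
    by (rule smooth_at_chart[OF assms(1) chartD(2)[OF assms(1)] order_refl assms(2) p h])
qed

lemma coord_vec_inject:
  assumes "(U, \<phi>) \<in> A" "p \<in> U"
  shows "coord_vec A (U, \<phi>) p u = coord_vec A (U, \<phi>) p v \<longleftrightarrow> u = v"
proof
  assume "coord_vec A (U, \<phi>) p u = coord_vec A (U, \<phi>) p v"
  then have "coord_vec A (U, \<phi>) p u ((\<lambda>x. x \<bullet> b) \<circ> \<phi>) = coord_vec A (U, \<phi>) p v ((\<lambda>x. x \<bullet> b) \<circ> \<phi>)" for b
    by (rule fun_cong)
  then show "u = v"
    unfolding coord_vec_coordinate(1)[OF assms] by (rule euclidean_eqI)
qed simp

lemma components_coord_vec:
  assumes "(U, \<phi>) \<in> A" "p \<in> U"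
  shows "components A (U, \<phi>) p (coord_vec A (U, \<phi>) p u) = u"
  unfolding components_def by (rule the_equality) (simp_all add: coord_vec_inject[OF assms])

lemma coord_vec_lincomb:
  assumes "(U, \<phi>) \<in> A" "p \<in> U"
  shows "coord_vec A (U, \<phi>) p (a *\<^sub>R u + b *\<^sub>R v) =
    lincomb a (coord_vec A (U, \<phi>) p u) b (coord_vec A (U, \<phi>) p v)"
proof
  fix f
  show "coord_vec A (U, \<phi>) p (a *\<^sub>R u + b *\<^sub>R v) f =
    lincomb a (coord_vec A (U, \<phi>) p u) b (coord_vec A (U, \<phi>) p v) f"
  proof (cases "smooth_at A p f")
    case True
    interpret bounded_linear "frechet_derivative (f \<circ> inv_into U \<phi>) (at (\<phi> p))"
      by (rule has_derivative_bounded_linear[OF smooth_at_differentiable[OF assms True]])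
    show ?thesis using True by (simp add: coord_vec_apply lincomb_def add scaleR)
  qed (simp add: coord_vec_apply lincomb_def)
qed

text \<open>
  The chain rule for the transition map \<open>\<psi> \<circ> \<phi>\<^sup>-\<^sup>1\<close>.
\<close>

lemma coord_vec_change:
  assumes C: "(U, \<phi>) \<in> A" "p \<in> U" and C': "(V, \<psi>) \<in> A" "p \<in> V"
    and d: "((\<psi> \<circ> inv_into U \<phi>) has_derivative D) (at (\<phi> p))"
  shows "coord_vec A (U, \<phi>) p u = coord_vec A (V, \<psi>) p (D u)"
proof
  fix f
  show "coord_vec A (U, \<phi>) p u f = coord_vec A (V, \<psi>) p (D u) f"
  proof (cases "smooth_at A p f")
    case True
    let ?D' = "frechet_derivative (f \<circ> inv_into V \<psi>) (at (\<psi> p))"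
    have eq: "(\<psi> \<circ> inv_into U \<phi>) (\<phi> p) = \<psi> p" using chart_inv(1)[OF C] by simp
    note has_derivative_compose[OF d, unfolded eq, OF smooth_at_differentiable[OF C' True]]
    then have "((f \<circ> inv_into U \<phi>) has_derivative (\<lambda>u. ?D' (D u))) (at (\<phi> p))"
    proof (rule has_derivative_transform_within_open)
      show "open (\<phi> ` (U \<inter> V))" by (rule chart_image_open[OF C(1) chartD(1)[OF C'(1)]])
    qed (use C C' chart_inv(1)[OF C(1)] chart_inv(1)[OF C'(1)] in auto)
    from frechet_derivative_eq[OF this] show ?thesis using True by (simp add: coord_vec_apply)
  qed (simp add: coord_vec_apply)
qed

text \<open>
  By the chain rule for the transition maps.
\<close>

lemma smooth_curve_on_chart:
  assumes C: "(U, \<phi>) \<in> A" and I: "open I" and c: "smooth_on I c" "c ` I \<subseteq> \<phi> ` U"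
  shows "smooth_curve_on A I (\<lambda>t::real. inv_into U \<phi> (c t))"
proof -
  have cont: "continuous_on I (\<lambda>t. inv_into U \<phi> (c t))"
    by (rule continuous_on_compose2[OF chartD(4)[OF C] smooth_on_continuous_on[OF c(1)] c(2)])
  have "smooth_on (I \<inter> (\<lambda>t. inv_into U \<phi> (c t)) -` V) (\<psi> \<circ> (\<lambda>t. inv_into U \<phi> (c t)))"
    if V: "(V, \<psi>) \<in> A" for V \<psi>
  proof -
    let ?S = "I \<inter> (\<lambda>t. inv_into U \<phi> (c t)) -` V"
    have S: "open ?S" by (rule continuous_open_preimage[OF cont I chartD(1)[OF V]])
    have "smooth_on ?S (\<lambda>t. (\<psi> \<circ> inv_into U \<phi>) (c t))"
    proof (rule smooth_on_compose[OF S _ _ transition_smooth[OF C V]])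
      show "open (\<phi> ` (U \<inter> V))" by (rule chart_image_open[OF C chartD(1)[OF V]])
      show "smooth_on ?S c" by (rule smooth_on_subset[OF c(1)]) auto
      show "c ` ?S \<subseteq> \<phi> ` (U \<inter> V)"
      proof
        fix x assume "x \<in> c ` ?S"
        then have "inv_into U \<phi> x \<in> U \<inter> V" "\<phi> (inv_into U \<phi> x) = x"
          using c(2) chart_inv(2,3)[OF C] by auto
        then show "x \<in> \<phi> ` (U \<inter> V)" by (metis imageI)
      qed
    qed
    then show ?thesis by (simp add: comp_def)
  qed
  with cont show ?thesis unfolding smooth_curve_on_def by auto
qed

lemma velocity_eq_coord_vec:
  assumes C: "(U, \<phi>) \<in> A" and I: "open I" "t \<in> I" and c: "smooth_curve_on A I c" "c t \<in> U"
  shows "\<exists>d. ((\<phi> \<circ> c) has_vector_derivative d) (at t)"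
    and "((\<phi> \<circ> c) has_vector_derivative d) (at t) \<Longrightarrow> velocity A c t = coord_vec A (U, \<phi>) (c t) d"
proof -
  have cont: "continuous_on I c" and sm: "smooth_on (I \<inter> c -` U) (\<phi> \<circ> c)"
    using c(1) C unfolding smooth_curve_on_def by auto
  have S: "open (I \<inter> c -` U)" "t \<in> I \<inter> c -` U"
    using continuous_open_preimage[OF cont I(1) chartD(1)[OF C]] I(2) c(2) by auto
  show "\<exists>d. ((\<phi> \<circ> c) has_vector_derivative d) (at t)"
    by (rule exI, rule vector_derivative_works[THEN iffD1, OF differentiableI[OF smooth_on_D[OF sm S(2)]]])
  assume d: "((\<phi> \<circ> c) has_vector_derivative d) (at t)"
  show "velocity A c t = coord_vec A (U, \<phi>) (c t) d"
  proof
    fix f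
    show "velocity A c t f = coord_vec A (U, \<phi>) (c t) d f"
    proof (cases "smooth_at A (c t) f")
      case True
      let ?D = "frechet_derivative (f \<circ> inv_into U \<phi>) (at (\<phi> (c t)))"
      note D = smooth_at_differentiable[OF C c(2) True]
      interpret bounded_linear ?D by (rule has_derivative_bounded_linear[OF D])
      have eq: "(\<phi> \<circ> c) t = \<phi> (c t)" by simp
      note has_derivative_compose[OF d[unfolded has_vector_derivative_def], unfolded eq, OF D]
      then have "((f \<circ> c) has_derivative (\<lambda>h. ?D (h *\<^sub>R d))) (at t)"
        by (rule has_derivative_transform_within_open[OF _ S]) (use chart_inv(1)[OF C] in auto)
      then have "((f \<circ> c) has_real_derivative ?D d) (at t)"
        by (simp add: has_field_derivative_def scaleR mult.commute[of _ "?D d"] mult_commute_abs)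
      then show ?thesis using True by (simp add: velocity_def coord_vec_apply DERIV_imp_deriv)
    qed (simp add: velocity_def coord_vec_apply)
  qed
qed

lemma affine_smooth: "open I \<Longrightarrow> smooth_on I (\<lambda>t::real. a + (t * r + s) *\<^sub>R (u::'e))"
proof -
  assume I: "open I"
  have "smooth_on I (\<lambda>t. (a + s *\<^sub>R u) + t *\<^sub>R (r *\<^sub>R u))"
    by (intro smooth_on_add I smooth_on_const smooth_on_linear[OF I bounded_linear_scaleR_left] smooth_on_ident)
  then show ?thesis by (simp add: algebra_simps)
qed

text \<open>
  A velocity is the coordinate vector of the derivative in the chart, and every coordinate vector is
  the velocity of a straight line in the chart.
\<close>

lemma tangent_space_eq:
  assumes C: "(U, \<phi>) \<in> A" and p: "p \<in> U"
  shows "tangent_space A p = range (coord_vec A (U, \<phi>) p)"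
proof
  show "tangent_space A p \<subseteq> range (coord_vec A (U, \<phi>) p)"
  proof
    fix v assume "v \<in> tangent_space A p"
    then obtain c e where c: "v = velocity A c 0" "e > 0" "smooth_curve_on A {-e<..<e} c" "c 0 = p"
      unfolding tangent_space_def by blast
    then have "0 \<in> {-e<..<e}" "c 0 \<in> U" using p by auto
    from velocity_eq_coord_vec[OF C open_greaterThanLessThan this(1) c(3) this(2)]
    show "v \<in> range (coord_vec A (U, \<phi>) p)" using c by blast
  qed
  show "range (coord_vec A (U, \<phi>) p) \<subseteq> tangent_space A p"
  proof clarify
    fix u
    let ?c = "\<lambda>t::real. \<phi> p + (t * 1 + 0) *\<^sub>R u"
    have "open (?c -` (\<phi> ` U))"
      by (intro continuous_open_vimage chartD(2)[OF C] continuous_intros)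
    moreover have "0 \<in> ?c -` (\<phi> ` U)" using p by simp
    ultimately obtain e where e: "e > 0" "ball 0 e \<subseteq> ?c -` (\<phi> ` U)"
      using open_contains_ball by blast
    have I: "{-e<..<e} = ball 0 e" by (auto simp: dist_real_def)
    let ?g = "\<lambda>t. inv_into U \<phi> (?c t)"
    have g: "smooth_curve_on A {-e<..<e} ?g"
      by (rule smooth_curve_on_chart[OF C _ affine_smooth]) (use e I in auto)
    have g0: "?g 0 = p" using p chart_inv(1)[OF C] by simp
    have "((\<phi> \<circ> ?g) has_vector_derivative u) (at 0)"
    proof (rule has_vector_derivative_transform_within_open)
      show "(?c has_vector_derivative u) (at 0)"
        by (auto intro!: derivative_eq_intros)
      show "?c t = (\<phi> \<circ> ?g) t" if "t \<in> ball 0 e" for t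
        using e(2) that chart_inv(2)[OF C] by auto
    qed (use e in auto)
    then have "velocity A ?g 0 = coord_vec A (U, \<phi>) p u"
      using velocity_eq_coord_vec(2)[OF C open_greaterThanLessThan _ g, of 0 u] e(1) g0 p by simp
    then show "coord_vec A (U, \<phi>) p u \<in> tangent_space A p"
      unfolding tangent_space_def using e(1) g g0 by (intro CollectI exI[of _ ?g] conjI exI[of _ e]) auto
  qed
qed

end


section \<open>The Levi-Civita connection in a left invariant frame\<close>

text \<open>
  The Koszul formula for fields of constant length and constant mutual angles, in which only the
  bracket terms survive: \<open>koszul br a b\<close> is the covariant derivative of \<open>b\<close> in the direction \<open>a\<close>.
\<close>

definition koszul :: "('v::euclidean_space \<Rightarrow> 'v \<Rightarrow> 'v) \<Rightarrow> 'v \<Rightarrow> 'v \<Rightarrow> 'v" where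
  "koszul br a b = (\<Sum>c\<in>Basis. ((br a b \<bullet> c - br b c \<bullet> a + br c a \<bullet> b) / 2) *\<^sub>R c)"

lemma koszul_inner:
  assumes "bilinear br"
  shows "koszul br a b \<bullet> c = (br a b \<bullet> c - br b c \<bullet> a + br c a \<bullet> b) / 2"
proof -
  let ?f = "\<lambda>c. (br a b \<bullet> c - br b c \<bullet> a + br c a \<bullet> b) / 2"
  have "linear ?f"
    by (rule linearI) (simp_all add: bilinear_ladd[OF assms] bilinear_radd[OF assms]
      bilinear_lmul[OF assms] bilinear_rmul[OF assms] inner_add_left inner_add_right field_simps)
  have "koszul br a b \<bullet> c = (\<Sum>d\<in>Basis. (c \<bullet> d) *\<^sub>R ?f d)"
    unfolding koszul_def inner_sum_left
    by (rule sum.cong) (simp_all add: inner_commute)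
  also have "\<dots> = ?f c" by (rule linear_sum_Basis[OF \<open>linear ?f\<close>, symmetric])
  finally show ?thesis .
qed

lemma bilinear_koszul:
  assumes "bilinear br"
  shows "bilinear (koszul br)"
  unfolding bilinear_def
  by (intro allI conjI; rule linearI; rule vector_eq_rdot[THEN iffD1]; rule allI)
    (simp_all add: koszul_inner[OF assms] inner_add_left inner_add_right bilinear_ladd[OF assms]
      bilinear_radd[OF assms] bilinear_lmul[OF assms] bilinear_rmul[OF assms] field_simps)

text \<open>
  Compatibility with the metric.
\<close>

lemma koszul_skew:
  assumes "bilinear br" "\<And>v w. br v w = - br w v"
  shows "koszul br a b \<bullet> c + b \<bullet> koszul br a c = 0"
proof -
  have "br a b \<bullet> c = - (br b a \<bullet> c)" "br b c \<bullet> a = - (br c b \<bullet> a)" "br c a \<bullet> b = - (br a c \<bullet> b)"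
    using assms(2)[of a b] assms(2)[of b c] assms(2)[of c a] by simp_all
  then show ?thesis
    by (simp add: koszul_inner[OF assms(1)] inner_commute[of b "koszul br a c"] field_simps)
qed

lemma koszul_torsion_free:
  assumes "bilinear br" "\<And>v w. br v w = - br w v"
  shows "koszul br a b - koszul br b a = br a b"
proof (rule vector_eq_rdot[THEN iffD1], rule allI)
  fix c
  have "br a b \<bullet> c = - (br b a \<bullet> c)" "br b c \<bullet> a = - (br c b \<bullet> a)" "br c a \<bullet> b = - (br a c \<bullet> b)"
    using assms(2)[of a b] assms(2)[of b c] assms(2)[of c a] by simp_all
  then show "(koszul br a b - koszul br b a) \<bullet> c = br a b \<bullet> c"
    by (simp add: koszul_inner[OF assms(1)] inner_diff_left field_simps)
qed

text \<open>
  The properties of the left invariant fields on which the argument rests: a smooth frame \<open>X\<close>,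
  orthogonal of constant length, whose brackets have constant coefficients.
\<close>

locale left_frame = manifold A for A :: "('m::topological_space, real ^ 'n) chart set" +
  fixes g :: "'m metric" and X :: "real ^ 'n \<Rightarrow> 'm \<Rightarrow> 'm tangent"
    and br :: "real ^ 'n \<Rightarrow> real ^ 'n \<Rightarrow> real ^ 'n" and t :: real
  assumes metric: "riemannian_metric A g"
    and t_pos: "t > 0"
    and X_field: "smooth_vector_field A (X v)"
    and X_lin: "X (a *\<^sub>R v + b *\<^sub>R w) p = lincomb a (X v p) b (X w p)"
    and X_orth: "g p (X v p) (X w p) = t * (v \<bullet> w)"
    and X_bracket: "X (br v w) = vf_bracket A (X v) (X w)"
    and br_bilinear: "bilinear br"
    and br_anti: "br v w = - br w v"
begin

abbreviation "N \<equiv> koszul br"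

lemmas N_bilinear = bilinear_koszul[OF br_bilinear]
lemmas N_skew = koszul_skew[OF br_bilinear br_anti]
lemmas N_torsion = koszul_torsion_free[OF br_bilinear br_anti]

end

text \<open>
  A frame seen in one chart. The function \<open>E v\<close> below is the coordinate expression of the field
  \<open>X v\<close>, and \<open>\<theta>\<close> is the dual coframe, computed with the metric \<open>G\<close> in the chart.
\<close>

locale frame_chart = left_frame A g X br t
  for A :: "('m::topological_space, real ^ 'n) chart set" and g X br t +
  fixes U :: "'m set" and \<phi> :: "'m \<Rightarrow> real ^ 'n"
  assumes C: "(U, \<phi>) \<in> A"
begin

abbreviation "pt \<equiv> inv_into U \<phi>"
abbreviation "G \<equiv> metric_in_chart A g (U, \<phi>)"

definition E :: "real ^ 'n \<Rightarrow> real ^ 'n \<Rightarrow> real ^ 'n" where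
  "E v x = components A (U, \<phi>) (pt x) (X v (pt x))"

definition \<theta> :: "real ^ 'n \<Rightarrow> real ^ 'n \<Rightarrow> real ^ 'n" where
  "\<theta> x u = (\<Sum>b\<in>Basis. (G x u (E b x) / t) *\<^sub>R b)"

abbreviation "dE v x \<equiv> frechet_derivative (E v) (at x)"

lemmas openV = chartD(2)[OF C]
lemmas pt_phi = chart_inv(1)[OF C] and phi_pt = chart_inv(2)[OF C] and pt_in = chart_inv(3)[OF C]

lemma X_coord: "p \<in> U \<Longrightarrow> X v p = coord_vec A (U, \<phi>) p (E v (\<phi> p))"
proof -
  assume p: "p \<in> U"
  have "X v p \<in> tangent_space A p" using X_field unfolding smooth_vector_field_def by blast
  then obtain u where "X v p = coord_vec A (U, \<phi>) p u" using tangent_space_eq[OF C p] by blast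
  then show ?thesis by (simp add: E_def pt_phi[OF p] components_coord_vec[OF C p])
qed

lemma X_coord_pt: "x \<in> \<phi> ` U \<Longrightarrow> X v (pt x) = coord_vec A (U, \<phi>) (pt x) (E v x)"
  using X_coord[OF pt_in] by (simp add: phi_pt)

lemma E_lin:
  assumes x: "x \<in> \<phi> ` U"
  shows "E (a *\<^sub>R v + b *\<^sub>R w) x = a *\<^sub>R E v x + b *\<^sub>R E w x"
proof -
  have "coord_vec A (U, \<phi>) (pt x) (E (a *\<^sub>R v + b *\<^sub>R w) x) =
      coord_vec A (U, \<phi>) (pt x) (a *\<^sub>R E v x + b *\<^sub>R E w x)"
    unfolding coord_vec_lincomb[OF C pt_in[OF x]] X_coord_pt[OF x, symmetric] X_lin ..
  then show ?thesis unfolding coord_vec_inject[OF C pt_in[OF x]] .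
qed

lemma linear_E: "x \<in> \<phi> ` U \<Longrightarrow> linear (\<lambda>v. E v x)"
  using E_lin[of x 1 _ 1] E_lin[of x _ _ 0 0] by (intro linearI) simp_all

lemma X_coordinate_function:
  assumes x: "x \<in> \<phi> ` U"
  shows "X v (pt x) ((\<lambda>x. x \<bullet> b) \<circ> \<phi>) = E v x \<bullet> b"
  unfolding X_coord_pt[OF x] by (rule coord_vec_coordinate(1)[OF C pt_in[OF x]])

lemma smooth_at_X: "smooth_at A p f \<Longrightarrow> smooth_at A p (\<lambda>q. X v q f)"
  using X_field unfolding smooth_vector_field_def by blast

text \<open>
  A smooth field maps coordinate functions to smooth functions, and these are its components.
\<close>

lemma E_smooth: "smooth_on (\<phi> ` U) (E v)"
proof (rule smooth_on_componentwise[OF openV], rule smooth_on_locally)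
  fix b x assume x: "x \<in> \<phi> ` U"
  let ?f = "(\<lambda>x. x \<bullet> b) \<circ> \<phi>"
  obtain B where B: "open B" "\<phi> (pt x) \<in> B" "B \<subseteq> \<phi> ` U" "smooth_on B ((\<lambda>q. X v q ?f) \<circ> pt)"
    using smooth_at_imp_chart[OF C pt_in[OF x] smooth_at_X[OF coord_vec_coordinate(2)[OF C pt_in[OF x]]]]
    by blast
  have "smooth_on B (\<lambda>x. E v x \<bullet> b)"
    by (rule smooth_on_cong[OF B(1) _ B(4)]) (use B(3) X_coordinate_function in auto)
  then show "\<exists>T. open T \<and> x \<in> T \<and> smooth_on T (\<lambda>x. E v x \<bullet> b)"
    using B phi_pt[OF x] by auto
qed

lemma dE: "x \<in> \<phi> ` U \<Longrightarrow> (E v has_derivative dE v x) (at x)"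
  by (rule smooth_on_D[OF E_smooth])

lemma dE_lin:
  assumes x: "x \<in> \<phi> ` U"
  shows "dE (a *\<^sub>R v + b *\<^sub>R w) x u = a *\<^sub>R dE v x u + b *\<^sub>R dE w x u"
proof -
  have "((\<lambda>x. a *\<^sub>R E v x + b *\<^sub>R E w x) has_derivative (\<lambda>u. a *\<^sub>R dE v x u + b *\<^sub>R dE w x u)) (at x)"
    by (intro has_derivative_add has_derivative_scaleR_right dE x)
  then have "(E (a *\<^sub>R v + b *\<^sub>R w) has_derivative (\<lambda>u. a *\<^sub>R dE v x u + b *\<^sub>R dE w x u)) (at x)"
    by (rule has_derivative_transform_within_open[OF _ openV x]) (simp add: E_lin)
  from frechet_derivative_eq[OF this] show ?thesis by simp
qed

lemma linear_dE: "x \<in> \<phi> ` U \<Longrightarrow> linear (dE v x)"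
  using dE has_derivative_linear by blast

lemma linear_dE_left: "x \<in> \<phi> ` U \<Longrightarrow> linear (\<lambda>v. dE v x u)"
  using dE_lin[of x 1 _ 1] dE_lin[of x _ _ 0 0] by (intro linearI) simp_all

lemma coord_in_tangent: "x \<in> \<phi> ` U \<Longrightarrow> coord_vec A (U, \<phi>) (pt x) u \<in> tangent_space A (pt x)"
  using tangent_space_eq[OF C pt_in] by blast

lemma G_sym: "x \<in> \<phi> ` U \<Longrightarrow> G x u v = G x v u"
  using metric coord_in_tangent[of x] unfolding riemannian_metric_def metric_in_chart_def Let_def
  by simp

lemma G_lin: "x \<in> \<phi> ` U \<Longrightarrow> G x (a *\<^sub>R u + b *\<^sub>R v) w = a * G x u w + b * G x v w"
  using metric coord_in_tangent[of x] coord_vec_lincomb[OF C pt_in[of x]]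
  unfolding riemannian_metric_def metric_in_chart_def Let_def by simp

lemma G_bilinear: "x \<in> \<phi> ` U \<Longrightarrow> bilinear (G x)"
  unfolding bilinear_def
  using G_lin[of x 1 _ 1] G_lin[of x _ _ 0 0] G_sym[of x]
  by (intro conjI allI linearI) (simp_all add: G_sym)

lemma G_pos:
  assumes x: "x \<in> \<phi> ` U" and "u \<noteq> 0"
  shows "G x u u > 0"
proof -
  have "coord_vec A (U, \<phi>) (pt x) 0 = (\<lambda>f. 0)"
    using coord_vec_lincomb[OF C pt_in[OF x], of 0 0 0 0] by (simp add: lincomb_def)
  then have "coord_vec A (U, \<phi>) (pt x) u \<noteq> (\<lambda>f. 0)"
    using coord_vec_inject[OF C pt_in[OF x], of u 0] \<open>u \<noteq> 0\<close> by simp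
  then show ?thesis
    using metric coord_in_tangent[OF x] unfolding riemannian_metric_def metric_in_chart_def Let_def
    by simp
qed

lemma G_E: "x \<in> \<phi> ` U \<Longrightarrow> G x (E v x) (E w x) = t * (v \<bullet> w)"
  unfolding metric_in_chart_def Let_def by (simp add: X_coord_pt[symmetric] X_orth)

lemma G_smooth: "smooth_on (\<phi> ` U) (\<lambda>x. G x u v)"
  using metric C unfolding riemannian_metric_def by blast

lemma G_expand:
  assumes x: "x \<in> \<phi> ` U"
  shows "G x u v = (\<Sum>d\<in>Basis. \<Sum>e\<in>Basis. (u \<bullet> d) * ((v \<bullet> e) * G x d e))"
proof -
  have l: "linear (\<lambda>u. G x u v)" and r: "linear (G x d)" for d
    using G_bilinear[OF x] unfolding bilinear_def by auto
  have "G x u v = (\<Sum>d\<in>Basis. (u \<bullet> d) * G x d v)"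
    using linear_sum_Basis[OF l, of u] by simp
  also have "\<dots> = (\<Sum>d\<in>Basis. (u \<bullet> d) * (\<Sum>e\<in>Basis. (v \<bullet> e) * G x d e))"
    using linear_sum_Basis[OF r, of _ v] by simp
  finally show ?thesis by (simp add: sum_distrib_left)
qed

lemma smooth_G_fields:
  assumes "open S" "S \<subseteq> \<phi> ` U" "smooth_on S p" "smooth_on S q"
  shows "smooth_on S (\<lambda>x. G x (p x) (q x))"
proof (rule smooth_on_cong[OF assms(1)])
  show "smooth_on S (\<lambda>x. \<Sum>d\<in>Basis. \<Sum>e\<in>Basis. (p x \<bullet> d) * ((q x \<bullet> e) * G x d e))"
    by (intro smooth_on_sum assms(1) smooth_on_bilinear[OF assms(1) bounded_bilinear_mult]
        smooth_on_linear[OF assms(1) bounded_linear_inner_left] assms(3,4) smooth_on_subset[OF G_smooth assms(2)])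
qed (use G_expand assms(2) in auto)

abbreviation "dG x u v w \<equiv> frechet_derivative (\<lambda>y. G y v w) (at x) u"

lemma dG: "x \<in> \<phi> ` U \<Longrightarrow> ((\<lambda>y. G y v w) has_derivative (\<lambda>u. dG x u v w)) (at x)"
  by (rule smooth_on_D[OF G_smooth])

lemma dG_expand:
  assumes x: "x \<in> \<phi> ` U"
  shows "dG x u v w = (\<Sum>d\<in>Basis. \<Sum>e\<in>Basis. (v \<bullet> d) * ((w \<bullet> e) * dG x u d e))"
proof -
  have "((\<lambda>x. \<Sum>d\<in>Basis. \<Sum>e\<in>Basis. (v \<bullet> d) * ((w \<bullet> e) * G x d e)) has_derivative
      (\<lambda>u. \<Sum>d\<in>Basis. \<Sum>e\<in>Basis. (v \<bullet> d) * ((w \<bullet> e) * dG x u d e))) (at x)"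
    by (intro has_derivative_sum has_derivative_mult_right dG x)
  then have "((\<lambda>x. G x v w) has_derivative
      (\<lambda>u. \<Sum>d\<in>Basis. \<Sum>e\<in>Basis. (v \<bullet> d) * ((w \<bullet> e) * dG x u d e))) (at x)"
    by (rule has_derivative_transform_within_open[OF _ openV x]) (simp add: G_expand[symmetric])
  from frechet_derivative_eq[OF this] show ?thesis by simp
qed

text \<open>
  The product rule for the metric applied to two fields, where \<open>dG\<close> differentiates the metric with
  its arguments held constant.
\<close>

lemma G_fields_derivative:
  assumes x: "x \<in> \<phi> ` U" and p: "(p has_derivative p') (at x)" and q: "(q has_derivative q') (at x)"
  shows "((\<lambda>x. G x (p x) (q x)) has_derivative
    (\<lambda>u. dG x u (p x) (q x) + G x (p' u) (q x) + G x (p x) (q' u))) (at x)"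
proof -
  let ?D = "\<lambda>u. \<Sum>d\<in>Basis. \<Sum>e\<in>Basis. (p x \<bullet> d) * ((q x \<bullet> e) * dG x u d e + (q' u \<bullet> e) * G x d e)
      + (p' u \<bullet> d) * ((q x \<bullet> e) * G x d e)"
  have "((\<lambda>x. \<Sum>d\<in>Basis. \<Sum>e\<in>Basis. (p x \<bullet> d) * ((q x \<bullet> e) * G x d e)) has_derivative ?D) (at x)"
    by (intro has_derivative_sum has_derivative_mult has_derivative_inner_left p q dG x)
  then have "((\<lambda>x. G x (p x) (q x)) has_derivative ?D) (at x)"
    by (rule has_derivative_transform_within_open[OF _ openV x]) (simp add: G_expand[symmetric])
  moreover have "?D u = dG x u (p x) (q x) + G x (p' u) (q x) + G x (p x) (q' u)" for u
    unfolding dG_expand[OF x, of "p x"] G_expand[OF x, of "p' u"] G_expand[OF x, of "p x" "q' u"]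
    by (simp add: sum.distrib[symmetric] distrib_left add_ac)
  ultimately show ?thesis by simp
qed

lemma \<theta>_E: "x \<in> \<phi> ` U \<Longrightarrow> \<theta> x (E v x) = v"
  using t_pos by (simp add: \<theta>_def G_E euclidean_representation)

lemma linear_\<theta>: "x \<in> \<phi> ` U \<Longrightarrow> linear (\<theta> x)"
  unfolding \<theta>_def
  by (intro linear_compose_sum ballI linearI)
    (simp_all add: bilinear_ladd[OF G_bilinear] bilinear_lmul[OF G_bilinear] add_divide_distrib scaleR_left_distrib)

text \<open>
  The frame consists of linearly independent fields because the coframe is a left inverse, hence it
  spans by dimension.
\<close>

lemma E_\<theta>: 
  assumes x: "x \<in> \<phi> ` U" 
  shows "E (\<theta> x u) x = u"
proof -
  have "inj (\<lambda>v. E v x)" using \<theta>_E[OF x] by (rule inj_on_inverseI)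
  then have "surj (\<lambda>v. E v x)" using linear_injective_imp_surjective[OF linear_E[OF x]] by blast
  then obtain v where "u = E v x" by blast
  then show ?thesis using \<theta>_E[OF x] by simp
qed

lemma \<theta>_smooth: "smooth_on (\<phi> ` U) (\<lambda>x. \<theta> x u)"
  unfolding \<theta>_def
  by (intro smooth_on_sum openV smooth_on_linear[OF openV bounded_linear_scaleR_left]
      smooth_on_linear[OF openV bounded_linear_divide] smooth_G_fields[OF openV order_refl]
      smooth_on_const E_smooth)

text \<open>
  A field is determined by its values on the coordinate functions, which are its components. Applying
  a second field to these values differentiates the components.
\<close>

lemma bracket_E:
  assumes x: "x \<in> \<phi> ` U"
  shows "dE w x (E v x) - dE v x (E w x) = E (br v w) x"
proof (rule euclidean_eqI)
  fix b
  let ?f = "(\<lambda>x. x \<bullet> b) \<circ> \<phi>"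
  note sm = coord_vec_coordinate(2)[OF C pt_in[OF x], of b]
  have iter: "X v (pt x) (\<lambda>q. X w q ?f) = dE w x (E v x) \<bullet> b" for v w
  proof -
    have "((\<lambda>y. E w y \<bullet> b) has_derivative (\<lambda>u. dE w x u \<bullet> b)) (at x)"
      by (rule has_derivative_inner_left[OF dE[OF x]])
    then have "(((\<lambda>q. X w q ?f) \<circ> pt) has_derivative (\<lambda>u. dE w x u \<bullet> b)) (at x)"
      by (rule has_derivative_transform_within_open[OF _ openV x])
        (simp only: o_apply[of "\<lambda>q. X w q ?f"] X_coordinate_function)
    from frechet_derivative_eq[OF this] show ?thesis
      unfolding X_coord_pt[OF x, of v] coord_vec_apply phi_pt[OF x] using smooth_at_X[OF sm, of w] by simp
  qed
  have "E (br v w) x \<bullet> b = X (br v w) (pt x) ?f" by (rule X_coordinate_function[OF x, symmetric])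
  also have "\<dots> = X v (pt x) (\<lambda>q. X w q ?f) - X w (pt x) (\<lambda>q. X v q ?f)"
    unfolding X_bracket vf_bracket_def using sm by simp
  finally show "(dE w x (E v x) - dE v x (E w x)) \<bullet> b = E (br v w) x \<bullet> b"
    unfolding iter by (simp add: inner_diff_left)
qed

text \<open>
  The right hand side is the connection whose covariant derivatives of the frame fields are those
  of the Koszul formula. It is symmetric because \<open>koszul\<close> is torsion free and metric because the
  operators \<open>N v\<close> are skew and the frame has constant inner products. Uniqueness is the usual
  argument: a trilinear form that is symmetric in the first two arguments and skew in the last two
  vanishes.
\<close>

lemma christoffel_eq:
  assumes x: "x \<in> \<phi> ` U"
  shows "christoffel A g (U, \<phi>) x = (\<lambda>u v. E (N (\<theta> x u) (\<theta> x v)) x - dE (\<theta> x v) x u)"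
    (is "_ = ?\<Gamma>")
  unfolding christoffel_def
proof (rule the_equality)
  have lE: "linear (\<lambda>v. E v x)" and l\<theta>: "linear (\<theta> x)"
    using linear_E[OF x] linear_\<theta>[OF x] by auto
  have "bilinear ?\<Gamma>"
    unfolding bilinear_def
    by (intro allI conjI; rule linearI)
      (simp_all add: linear_add[OF l\<theta>] linear_scale[OF l\<theta>] linear_add[OF linear_dE[OF x]]
        linear_scale[OF linear_dE[OF x]] linear_add[OF linear_dE_left[OF x]] linear_scale[OF linear_dE_left[OF x]]
        linear_add[OF lE] linear_scale[OF lE] bilinear_ladd[OF N_bilinear] bilinear_radd[OF N_bilinear]
        bilinear_lmul[OF N_bilinear] bilinear_rmul[OF N_bilinear] algebra_simps)
  moreover have "?\<Gamma> u v = ?\<Gamma> v u" for u v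
  proof -
    let ?a = "\<theta> x u" and ?b = "\<theta> x v"
    have "dE ?b x u - dE ?a x v = E (br ?a ?b) x"
      using bracket_E[OF x, of ?b ?a] by (simp add: E_\<theta>[OF x])
    also have "\<dots> = E (N ?a ?b) x - E (N ?b ?a) x"
      by (simp only: N_torsion linear_diff[OF lE, symmetric])
    finally show ?thesis by (simp add: algebra_simps)
  qed
  moreover have "dG x u v w = G x (?\<Gamma> u v) w + G x v (?\<Gamma> u w)" for u v w
  proof -
    let ?a = "\<theta> x v" and ?b = "\<theta> x w" and ?c = "\<theta> x u"
    have v: "E ?a x = v" and w: "E ?b x = w" using E_\<theta>[OF x] by auto
    have deriv: "((\<lambda>y. G y (E ?a y) (E ?b y)) has_derivative
        (\<lambda>u. dG x u v w + G x (dE ?a x u) w + G x v (dE ?b x u))) (at x)"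
      using G_fields_derivative[OF x dE[OF x, of ?a] dE[OF x, of ?b]] by (simp add: v w)
    have "(\<lambda>u. dG x u v w + G x (dE ?a x u) w + G x v (dE ?b x u)) = (\<lambda>u. 0)"
    proof (rule has_derivative_unique[OF deriv])
      show "((\<lambda>y. G y (E ?a y) (E ?b y)) has_derivative (\<lambda>u. 0)) (at x)"
        by (rule has_derivative_transform_within_open[OF has_derivative_const openV x]) (simp add: G_E)
    qed
    then have "dG x u v w + G x (dE ?a x u) w + G x v (dE ?b x u) = 0"
      by (rule fun_cong)
    moreover have "G x (E (N ?c ?a) x) w + G x v (E (N ?c ?b) x) = 0"
      using G_E[OF x, of "N ?c ?a" ?b] G_E[OF x, of ?a "N ?c ?b"] N_skew[of ?c ?a ?b]
      by (simp add: v w distrib_left[symmetric])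
    ultimately show ?thesis
      by (simp add: bilinear_lsub[OF G_bilinear[OF x]] bilinear_rsub[OF G_bilinear[OF x]])
  qed
  ultimately show ok: "bilinear ?\<Gamma> \<and> (\<forall>u v. ?\<Gamma> u v = ?\<Gamma> v u) \<and>
     (\<forall>u v w. dG x u v w = G x (?\<Gamma> u v) w + G x v (?\<Gamma> u w))" by blast
  fix \<Gamma>' assume ok': "bilinear \<Gamma>' \<and> (\<forall>u v. \<Gamma>' u v = \<Gamma>' v u) \<and>
     (\<forall>u v w. dG x u v w = G x (\<Gamma>' u v) w + G x v (\<Gamma>' u w))"
  define \<Delta> where "\<Delta> u v = \<Gamma>' u v - ?\<Gamma> u v" for u v
  have sym: "\<Delta> u v = \<Delta> v u" for u v
    using ok ok' unfolding \<Delta>_def by metis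
  have skew: "G x (\<Delta> u v) w = - G x (\<Delta> u w) v" for u v w
  proof -
    have "G x (\<Gamma>' u v) w + G x v (\<Gamma>' u w) = G x (?\<Gamma> u v) w + G x v (?\<Gamma> u w)"
      using ok ok' by metis
    then show ?thesis
      unfolding \<Delta>_def bilinear_lsub[OF G_bilinear[OF x]]
      by (simp add: G_sym[OF x, of v] bilinear_lsub[OF G_bilinear[OF x]])
  qed
  have "G x (\<Delta> u v) w = - G x (\<Delta> u v) w" for u v w
    by (metis sym skew minus_minus)
  then have "G x (\<Delta> u v) (\<Delta> u v) = 0" for u v
    by (metis add.inverse_neutral equal_neg_zero)
  then have "\<Delta> u v = 0" for u v
    using G_pos[OF x] by (metis less_irrefl)
  then show "\<Gamma>' = ?\<Gamma>" unfolding \<Delta>_def by (intro ext) (metis eq_iff_diff_eq_0)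
qed

lemma christoffel_E:
  assumes x: "x \<in> \<phi> ` U"
  shows "christoffel A g (U, \<phi>) x u (E b x) = E (N (\<theta> x u) b) x - dE b x u"
  unfolding christoffel_eq[OF x] \<theta>_E[OF x] ..

end


section \<open>Parallel transport in a left invariant frame\<close>

context left_frame
begin

lemma frame_chartI: "(U, \<phi>) \<in> A \<Longrightarrow> frame_chart A g X br t U \<phi>"
  by unfold_locales

lemma X_inject: "X v p = X w p \<longleftrightarrow> v = w"
proof
  assume eq: "X v p = X w p"
  have "g p (X v p) (X u p) = g p (X w p) (X u p)" for u by (simp only: eq)
  then have "v \<bullet> u = w \<bullet> u" for u using t_pos by (simp add: X_orth)
  then have "\<forall>u. v \<bullet> u = w \<bullet> u" ..
  then show "v = w" by (rule vector_eq_rdot[THEN iffD1])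
qed simp

end

context frame_chart
begin

lemma E_expand: "x \<in> \<phi> ` U \<Longrightarrow> E v x = (\<Sum>b\<in>Basis. (v \<bullet> b) *\<^sub>R E b x)"
  by (rule linear_sum_Basis[OF linear_E])

lemma \<theta>_expand: "x \<in> \<phi> ` U \<Longrightarrow> \<theta> x v = (\<Sum>b\<in>Basis. (v \<bullet> b) *\<^sub>R \<theta> x b)"
  by (rule linear_sum_Basis[OF linear_\<theta>])

text \<open>
  The product rule for a field of linear maps \<open>F x\<close>, evaluated along a curve \<open>c\<close> on a moving vector
  \<open>a\<close>. It applies both to the frame and to the coframe.
\<close>

lemma field_along_curve_derivative:
  fixes F :: "real ^ 'n \<Rightarrow> real ^ 'n \<Rightarrow> real ^ 'n"
  assumes F: "\<And>x v. x \<in> \<phi> ` U \<Longrightarrow> F x v = (\<Sum>b\<in>Basis. (v \<bullet> b) *\<^sub>R F x b)"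
    and sm: "\<And>v. smooth_on (\<phi> ` U) (\<lambda>x. F x v)"
    and c: "(c has_vector_derivative u) (at s)" "c s \<in> \<phi> ` U"
    and a: "(a has_vector_derivative \<alpha>) (at s)"
  shows "((\<lambda>s. F (c s) (a s)) has_vector_derivative
    F (c s) \<alpha> + (\<Sum>b\<in>Basis. (a s \<bullet> b) *\<^sub>R frechet_derivative (\<lambda>x. F x b) (at (c s)) u)) (at s)"
proof -
  let ?D = "\<lambda>b. frechet_derivative (\<lambda>x. F x b) (at (c s))"
  have D: "((\<lambda>x. F x b) has_derivative ?D b) (at (c s))" for b
    by (rule smooth_on_D[OF sm c(2)])
  have Fc: "((\<lambda>s. F (c s) b) has_vector_derivative ?D b u) (at s)" for b
  proof -
    have "((\<lambda>s. F (c s) b) has_derivative (\<lambda>h. ?D b (h *\<^sub>R u))) (at s)"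
      by (rule has_derivative_compose[OF c(1)[unfolded has_vector_derivative_def] D])
    then show ?thesis
      unfolding has_vector_derivative_def linear_scale[OF has_derivative_linear[OF D]] .
  qed
  have ab: "((\<lambda>s. a s \<bullet> b) has_real_derivative \<alpha> \<bullet> b) (at s)" for b
    using has_derivative_inner_left[OF a[unfolded has_vector_derivative_def], of b]
    by (simp add: has_field_derivative_def mult.commute[of _ "\<alpha> \<bullet> b"] mult_commute_abs)
  have sum': "((\<lambda>s. \<Sum>b\<in>Basis. (a s \<bullet> b) *\<^sub>R F (c s) b) has_vector_derivative
      (\<Sum>b\<in>Basis. (a s \<bullet> b) *\<^sub>R ?D b u + (\<alpha> \<bullet> b) *\<^sub>R F (c s) b)) (at s)"
    by (intro has_vector_derivative_sum has_vector_derivative_scaleR ab Fc)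
  have eq: "(\<Sum>b\<in>Basis. (a s \<bullet> b) *\<^sub>R ?D b u + (\<alpha> \<bullet> b) *\<^sub>R F (c s) b) =
      F (c s) \<alpha> + (\<Sum>b\<in>Basis. (a s \<bullet> b) *\<^sub>R ?D b u)"
    unfolding sum.distrib F[OF c(2), of \<alpha>] by (rule add.commute)
  obtain e where e: "e > 0" "\<And>s'. dist s' s < e \<Longrightarrow> c s' \<in> \<phi> ` U"
  proof -
    have "isCont c s" using c(1) has_vector_derivative_continuous by blast
    then have "\<forall>\<^sub>F s' in at s. c s' \<in> \<phi> ` U"
      unfolding isCont_def using topological_tendstoD[OF _ openV c(2)] by blast
    then obtain e where "e > 0" "\<forall>s'. s' \<noteq> s \<and> dist s' s < e \<longrightarrow> c s' \<in> \<phi> ` U"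
      unfolding eventually_at by auto
    then show ?thesis using that[of e] c(2) by metis
  qed
  show ?thesis
  proof (rule has_vector_derivative_transform_within_open[OF sum'[unfolded eq] open_ball])
    show "s \<in> ball s e" using e(1) by simp
    fix s' assume "s' \<in> ball s e"
    then have "c s' \<in> \<phi> ` U" using e(2) by (simp add: dist_commute)
    then show "(\<Sum>b\<in>Basis. (a s' \<bullet> b) *\<^sub>R F (c s') b) = F (c s') (a s')"
      by (rule F[symmetric])
  qed
qed

lemma E_along_curve_derivative:
  assumes c: "(c has_vector_derivative u) (at s)" "c s \<in> \<phi> ` U"
    and a: "(a has_vector_derivative \<alpha>) (at s)"
  shows "((\<lambda>s. E (a s) (c s)) has_vector_derivative E \<alpha> (c s) + dE (a s) (c s) u) (at s)"
  using field_along_curve_derivative[OF E_expand E_smooth c a]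
  unfolding linear_sum_Basis[OF linear_dE_left[OF c(2)], of "a s" u, symmetric] .

text \<open>
  The equation of parallel transport in the frame: \<open>a\<close> contains the frame coefficients of a parallel
  field along the curve with chart expression \<open>c\<close>. The finite set \<open>S\<close> contains the times at which the
  curve may have a corner.
\<close>

definition horizontal :: "real set \<Rightarrow> (real \<Rightarrow> real ^ 'n) \<Rightarrow> (real \<Rightarrow> real ^ 'n) \<Rightarrow> bool" where
  "horizontal S c a \<longleftrightarrow> path c \<and> c ` {0..1} \<subseteq> \<phi> ` U \<and> path a \<and> finite S \<and>
    (\<forall>s\<in>{0<..<1} - S. \<exists>u. (c has_vector_derivative u) (at s) \<and>
       (a has_vector_derivative - N (\<theta> (c s) u) (a s)) (at s))"

lemma horizontal_in_chart: "horizontal S c a \<Longrightarrow> s \<in> {0..1} \<Longrightarrow> c s \<in> \<phi> ` U"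
  unfolding horizontal_def image_subset_iff by simp

text \<open>
  The operators \<open>N v\<close> are skew, so the distance between two solutions is constant.
\<close>

lemma horizontal_unique:
  assumes "horizontal S c a" "horizontal S' c a'" "a 0 = a' 0" "s \<in> {0..1}"
  shows "a s = a' s"
proof -
  define d where "d s = a s - a' s" for s
  have "(\<lambda>s. d s \<bullet> d s) s = 0"
  proof (rule has_derivative_zero_unique_strong_interval[OF _ _ _ _ assms(4)])
    show "finite (S \<union> S' \<union> {0, 1})" using assms unfolding horizontal_def by auto
    show "continuous_on {0..1} (\<lambda>s. d s \<bullet> d s)"
      using assms(1,2) unfolding horizontal_def path_def d_def by (auto intro!: continuous_intros)
    show "d 0 \<bullet> d 0 = 0" using assms(3) by (simp add: d_def)
    fix s assume "s \<in> {0..1} - (S \<union> S' \<union> {0, 1})"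
    then have s: "s \<in> {0<..<1} - S" "s \<in> {0<..<1} - S'" by auto
    obtain u where u: "(c has_vector_derivative u) (at s)"
        "(a has_vector_derivative - N (\<theta> (c s) u) (a s)) (at s)"
      using assms(1) s(1) unfolding horizontal_def by blast
    obtain u' where u': "(c has_vector_derivative u') (at s)"
        "(a' has_vector_derivative - N (\<theta> (c s) u') (a' s)) (at s)"
      using assms(2) s(2) unfolding horizontal_def by blast
    have "u' = u" using vector_derivative_unique_at[OF u(1) u'(1)] by simp
    have "(d has_vector_derivative - N (\<theta> (c s) u) (d s)) (at s)"
      using has_vector_derivative_diff[OF u(2) u'(2)[unfolded \<open>u' = u\<close>]]
      unfolding d_def bilinear_rsub[OF N_bilinear] by simp
    note D = this[unfolded has_vector_derivative_def]
    have "d s \<bullet> N (\<theta> (c s) u) (d s) = 0"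
      using N_skew[of "\<theta> (c s) u" "d s" "d s"] by (simp add: inner_commute)
    then have "((\<lambda>s. d s \<bullet> d s) has_derivative (\<lambda>h. 0)) (at s)"
      using has_derivative_inner[OF D D] by (simp add: inner_commute)
    then show "((\<lambda>s. d s \<bullet> d s) has_derivative (\<lambda>h. 0)) (at s within {0..1})"
      by (rule has_derivative_at_withinI)
  qed
  then show ?thesis by (simp add: d_def)
qed

lemma horizontal_join:
  assumes 1: "horizontal S1 c1 a1" and 2: "horizontal S2 c2 a2" and eq: "c1 1 = c2 0" "a1 1 = a2 0"
  shows "\<exists>S. horizontal S (c1 +++ c2) (a1 +++ a2)"
proof
  let ?S = "insert (1/2) ((\<lambda>s. s / 2) ` S1 \<union> (\<lambda>s. (s + 1) / 2) ` S2)"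
  show "horizontal ?S (c1 +++ c2) (a1 +++ a2)"
    unfolding horizontal_def
  proof (intro conjI ballI)
    show "path (c1 +++ c2)" "path (a1 +++ a2)"
      using 1 2 eq unfolding horizontal_def by (simp_all add: pathfinish_def pathstart_def)
    show "(c1 +++ c2) ` {0..1} \<subseteq> \<phi> ` U"
      using order_trans[OF path_image_join_subset Un_least, of c1 "\<phi> ` U" c2] 1 2
      unfolding horizontal_def path_image_def by simp
    show "finite ?S" using 1 2 unfolding horizontal_def by simp
    fix s assume s: "s \<in> {0<..<1} - ?S"
    show "\<exists>u. (c1 +++ c2 has_vector_derivative u) (at s) \<and>
       (a1 +++ a2 has_vector_derivative - N (\<theta> ((c1 +++ c2) s) u) ((a1 +++ a2) s)) (at s)"
    proof (cases "s < 1/2")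
      case True
      have "2 * s \<notin> S1"
      proof
        assume "2 * s \<in> S1"
        then have "2 * s / 2 \<in> (\<lambda>s. s / 2) ` S1" by (rule imageI)
        then show False using s by simp
      qed
      then have "2 * s \<in> {0<..<1} - S1" using s True by auto
      then obtain u where u: "(c1 has_vector_derivative u) (at (2 * s))"
          "(a1 has_vector_derivative - N (\<theta> (c1 (2 * s)) u) (a1 (2 * s))) (at (2 * s))"
        using 1 unfolding horizontal_def by blast
      have l: "((\<lambda>s. 2 * s) has_vector_derivative 2) (at s)" by (auto intro!: derivative_eq_intros)
      have tr: "(f1 +++ f2 has_vector_derivative 2 *\<^sub>R v) (at s)"
        if "(f1 has_vector_derivative v) (at (2 * s))" for f1 f2 :: "real \<Rightarrow> real ^ 'n" and v
        by (rule has_vector_derivative_transform_within_open[OF vector_diff_chain_at[OF l that], of "{..<1/2}"])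
          (use True in \<open>auto simp: joinpaths_def\<close>)
      have [simp]: "(f1 +++ f2) s = f1 (2 * s)" for f1 f2 :: "real \<Rightarrow> real ^ 'n"
        using True by (simp add: joinpaths_def)
      have x: "c1 (2 * s) \<in> \<phi> ` U" by (rule horizontal_in_chart[OF 1]) (use s True in simp)
      show ?thesis
        using tr[OF u(1), of c2] tr[OF u(2), of a2]
        by (intro exI[of _ "2 *\<^sub>R u"])
          (simp add: linear_scale[OF linear_\<theta>[OF x]] bilinear_lmul[OF N_bilinear])
    next
      case False
      then have gt: "s > 1/2" using s by auto
      have "2 * s - 1 \<notin> S2"
      proof
        assume "2 * s - 1 \<in> S2"
        then have "(2 * s - 1 + 1) / 2 \<in> (\<lambda>s. (s + 1) / 2) ` S2" by (rule imageI)
        then show False using s by simp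
      qed
      then have "2 * s - 1 \<in> {0<..<1} - S2" using s gt by auto
      then obtain u where u: "(c2 has_vector_derivative u) (at (2 * s - 1))"
          "(a2 has_vector_derivative - N (\<theta> (c2 (2 * s - 1)) u) (a2 (2 * s - 1))) (at (2 * s - 1))"
        using 2 unfolding horizontal_def by blast
      have l: "((\<lambda>s. 2 * s - 1) has_vector_derivative 2) (at s)" by (auto intro!: derivative_eq_intros)
      have tr: "(f1 +++ f2 has_vector_derivative 2 *\<^sub>R v) (at s)"
        if "(f2 has_vector_derivative v) (at (2 * s - 1))" for f1 f2 :: "real \<Rightarrow> real ^ 'n" and v
        by (rule has_vector_derivative_transform_within_open[OF vector_diff_chain_at[OF l that], of "{1/2<..}"])
          (use gt in \<open>auto simp: joinpaths_def\<close>)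
      have [simp]: "(f1 +++ f2) s = f2 (2 * s - 1)" for f1 f2 :: "real \<Rightarrow> real ^ 'n"
        using gt by (simp add: joinpaths_def)
      have x: "c2 (2 * s - 1) \<in> \<phi> ` U" by (rule horizontal_in_chart[OF 2]) (use s gt in simp)
      show ?thesis
        using tr[OF u(1), of c1] tr[OF u(2), of a1]
        by (intro exI[of _ "2 *\<^sub>R u"])
          (simp add: linear_scale[OF linear_\<theta>[OF x]] bilinear_lmul[OF N_bilinear])
    qed
  qed
qed

lemma path_pt: "path c \<Longrightarrow> c ` {0..1} \<subseteq> \<phi> ` U \<Longrightarrow> path (pt \<circ> c)"
  unfolding path_def
  by (rule continuous_on_compose[OF _ continuous_on_subset[OF chartD(4)[OF C]]])

text \<open>
  A parallel field must satisfy the transport equation in every chart. The frame coefficients are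
  the same in all charts and the coframe is natural, so the computation in another chart \<open>(V, \<psi>)\<close>
  reduces to the formula for the Christoffel symbols there.
\<close>

lemma horizontal_imp_parallel:
  assumes h: "horizontal S c a"
  shows "parallel_along A g (pt \<circ> c) (\<lambda>s. X (a s) ((pt \<circ> c) s))"
  unfolding parallel_along_def
proof (intro conjI ballI exI)
  let ?\<gamma> = "pt \<circ> c"
  show "X (a s) (?\<gamma> s) \<in> tangent_space A (?\<gamma> s)" for s
    using X_field unfolding smooth_vector_field_def by blast
  show "finite S" using h unfolding horizontal_def by simp
  have cU: "c s \<in> \<phi> ` U" if "s \<in> {0..1}" for s by (rule horizontal_in_chart[OF h that])
  have contc: "continuous_on {0..1} c" and conta: "continuous_on {0..1} a"
    using h unfolding horizontal_def path_def by auto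
  have cont\<gamma>: "continuous_on {0..1} ?\<gamma>"
    using path_pt h unfolding horizontal_def path_def by blast
  fix ch assume "ch \<in> A"
  obtain V \<psi> where ch: "ch = (V, \<psi>)" by (cases ch)
  with \<open>ch \<in> A\<close> have C': "(V, \<psi>) \<in> A" by simp
  interpret c2: frame_chart A g X br t V \<psi> by (rule frame_chartI[OF C'])
  have comp: "components A (V, \<psi>) (?\<gamma> s) (X (a s) (?\<gamma> s)) = c2.E (a s) (\<psi> (?\<gamma> s))" if "?\<gamma> s \<in> V" for s
    unfolding c2.X_coord[OF that] by (rule components_coord_vec[OF C' that])
  have V: "\<psi> (?\<gamma> s) \<in> \<psi> ` V" if "?\<gamma> s \<in> V" for s using that by (rule imageI)
  have "continuous_on {s \<in> {0..1}. ?\<gamma> s \<in> V} (\<lambda>s. components A (V, \<psi>) (?\<gamma> s) (X (a s) (?\<gamma> s)))"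
  proof (rule continuous_on_eq)
    let ?T = "{s \<in> {0..1}. ?\<gamma> s \<in> V}"
    show "continuous_on ?T (\<lambda>s. \<Sum>b\<in>Basis. (a s \<bullet> b) *\<^sub>R c2.E b (\<psi> (?\<gamma> s)))"
    proof (intro continuous_on_sum continuous_on_scaleR continuous_on_inner continuous_on_const)
      show "continuous_on ?T a" by (rule continuous_on_subset[OF conta]) auto
      have "continuous_on ?T (\<lambda>s. \<psi> (?\<gamma> s))"
        by (rule continuous_on_compose2[OF chartD(3)[OF C'] continuous_on_subset[OF cont\<gamma>]]) auto
      then show "continuous_on ?T (\<lambda>s. c2.E b (\<psi> (?\<gamma> s)))" for b
        by (rule continuous_on_compose2[OF smooth_on_continuous_on[OF c2.E_smooth]]) auto
    qed
    fix s assume "s \<in> ?T"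
    then have s: "?\<gamma> s \<in> V" by blast
    show "(\<Sum>b\<in>Basis. (a s \<bullet> b) *\<^sub>R c2.E b (\<psi> (?\<gamma> s))) = components A (V, \<psi>) (?\<gamma> s) (X (a s) (?\<gamma> s))"
      unfolding comp[OF s] by (rule c2.E_expand[OF V[OF s], symmetric])
  qed
  moreover have "((\<lambda>s. components A (V, \<psi>) (?\<gamma> s) (X (a s) (?\<gamma> s))) has_vector_derivative
      - christoffel A g (V, \<psi>) (\<psi> (?\<gamma> s)) (vector_derivative (\<psi> \<circ> ?\<gamma>) (at s))
        (components A (V, \<psi>) (?\<gamma> s) (X (a s) (?\<gamma> s)))) (at s)"
    if s: "s \<in> {0<..<1} - S" and sV: "?\<gamma> s \<in> V" for s
  proof -
    obtain u where u: "(c has_vector_derivative u) (at s)"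
        "(a has_vector_derivative - N (\<theta> (c s) u) (a s)) (at s)"
      using h s unfolding horizontal_def by blast
    have x: "c s \<in> \<phi> ` U" using cU s by simp
    note p = pt_in[OF x]
    let ?y = "\<psi> (?\<gamma> s)"
    have xV: "c s \<in> \<phi> ` (U \<inter> V)"
      using p phi_pt[OF x] sV by (metis Int_iff comp_apply imageI)
    define D where "D = frechet_derivative (\<psi> \<circ> pt) (at (c s))"
    have D: "((\<psi> \<circ> pt) has_derivative D) (at (c s))"
      unfolding D_def by (rule smooth_on_D[OF transition_smooth[OF C C'] xV])
    have "((\<lambda>s. (\<psi> \<circ> pt) (c s)) has_derivative (\<lambda>h. D (h *\<^sub>R u))) (at s)"
      by (rule has_derivative_compose[OF u(1)[unfolded has_vector_derivative_def] D])
    then have d\<gamma>: "((\<psi> \<circ> ?\<gamma>) has_vector_derivative D u) (at s)"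
      unfolding has_vector_derivative_def linear_scale[OF has_derivative_linear[OF D]]
      by (simp add: comp_def)
    let ?v = "\<theta> (c s) u"
    have "coord_vec A (V, \<psi>) (pt (c s)) (c2.E ?v ?y) = coord_vec A (U, \<phi>) (pt (c s)) (E ?v (c s))"
      using c2.X_coord[OF sV, of ?v] X_coord[OF p, of ?v] phi_pt[OF x] by simp
    also have "\<dots> = coord_vec A (V, \<psi>) (pt (c s)) (D (E ?v (c s)))"
      by (rule coord_vec_change[OF C p C']) (use sV D phi_pt[OF x] in simp_all)
    finally have "c2.E ?v ?y = D u"
      using coord_vec_inject[OF C', of "pt (c s)"] sV E_\<theta>[OF x] by simp
    then have \<theta>2: "c2.\<theta> ?y (D u) = ?v" using c2.\<theta>_E[OF V[OF sV], of ?v] by simp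
    have "((\<lambda>s. c2.E (a s) ((\<psi> \<circ> ?\<gamma>) s)) has_vector_derivative
        c2.E (- N ?v (a s)) ((\<psi> \<circ> ?\<gamma>) s) + c2.dE (a s) ((\<psi> \<circ> ?\<gamma>) s) (D u)) (at s)"
      by (rule c2.E_along_curve_derivative[OF d\<gamma> _ u(2)]) (use V[OF sV] in simp)
    moreover have "c2.E (- N ?v (a s)) ((\<psi> \<circ> ?\<gamma>) s) + c2.dE (a s) ((\<psi> \<circ> ?\<gamma>) s) (D u) =
        - christoffel A g (V, \<psi>) ?y (vector_derivative (\<psi> \<circ> ?\<gamma>) (at s))
          (components A (V, \<psi>) (?\<gamma> s) (X (a s) (?\<gamma> s)))"
      unfolding comp[OF sV] vector_derivative_at[OF d\<gamma>] c2.christoffel_E[OF V[OF sV]] \<theta>2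
      using linear_neg[OF c2.linear_E[OF V[OF sV]], of "N ?v (a s)"] by simp
    ultimately have "((\<lambda>s. c2.E (a s) (\<psi> (?\<gamma> s))) has_vector_derivative
        - christoffel A g (V, \<psi>) ?y (vector_derivative (\<psi> \<circ> ?\<gamma>) (at s))
          (components A (V, \<psi>) (?\<gamma> s) (X (a s) (?\<gamma> s)))) (at s)"
      by simp
    moreover have "open ({0<..<1} \<inter> ?\<gamma> -` V)"
      by (rule continuous_open_preimage[OF continuous_on_subset[OF cont\<gamma>] _ chartD(1)[OF C']]) auto
    ultimately show ?thesis
      by (rule has_vector_derivative_transform_within_open) (use s sV comp in auto)
  qed
  ultimately show "case ch of (U, \<phi>) \<Rightarrow>
        continuous_on {s \<in> {0..1}. ?\<gamma> s \<in> U} (\<lambda>s. components A (U, \<phi>) (?\<gamma> s) (X (a s) (?\<gamma> s))) \<and>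
        (\<forall>s\<in>{0<..<1} - S. ?\<gamma> s \<in> U \<longrightarrow>
          ((\<lambda>s. components A (U, \<phi>) (?\<gamma> s) (X (a s) (?\<gamma> s))) has_vector_derivative
            - christoffel A g (U, \<phi>) (\<phi> (?\<gamma> s)) (vector_derivative (\<phi> \<circ> ?\<gamma>) (at s))
                (components A (U, \<phi>) (?\<gamma> s) (X (a s) (?\<gamma> s)))) (at s))"
    unfolding ch by simp
qed

text \<open>
  Conversely, the frame coefficients \<open>\<theta> (c s) (b s)\<close> of a parallel field with components \<open>b\<close> are
  differentiable where \<open>b\<close> is, and their derivative is determined by \<open>E (a s) (c s) = b s\<close>.
\<close>

lemma parallel_imp_horizontal:
  assumes par: "parallel_along A g (pt \<circ> c) V"
    and c: "path c" "c ` {0..1} \<subseteq> \<phi> ` U" "finite S0"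
      "\<And>s. s \<in> {0<..<1} - S0 \<Longrightarrow> \<exists>u. (c has_vector_derivative u) (at s)"
  shows "\<exists>S a. horizontal S c a \<and> (\<forall>s\<in>{0..1}. V s = X (a s) (pt (c s)))"
proof -
  define b where "b s = components A (U, \<phi>) (pt (c s)) (V s)" for s
  define a where "a s = \<theta> (c s) (b s)" for s
  have cU: "c s \<in> \<phi> ` U" if "s \<in> {0..1}" for s using c(2) that by blast
  obtain S where S: "finite S" and all: "\<forall>(U, \<phi>)\<in>A.
      continuous_on {s\<in>{0..1}. (pt \<circ> c) s \<in> U} (\<lambda>s. components A (U, \<phi>) ((pt \<circ> c) s) (V s)) \<and>
      (\<forall>s\<in>{0<..<1} - S. (pt \<circ> c) s \<in> U \<longrightarrow>
        ((\<lambda>s. components A (U, \<phi>) ((pt \<circ> c) s) (V s)) has_vector_derivative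
           - christoffel A g (U, \<phi>) (\<phi> ((pt \<circ> c) s)) (vector_derivative (\<phi> \<circ> (pt \<circ> c)) (at s))
                (components A (U, \<phi>) ((pt \<circ> c) s) (V s))) (at s))"
    using par[unfolded parallel_along_def, THEN conjunct2] by (elim exE conjE) (rule that)
  note tang = bspec[OF par[unfolded parallel_along_def, THEN conjunct1]]
  from bspec[OF all C, unfolded prod.case]
  have cont0: "continuous_on {s\<in>{0..1}. (pt \<circ> c) s \<in> U} b"
    and der0: "\<And>s. s \<in> {0<..<1} - S \<Longrightarrow> (pt \<circ> c) s \<in> U \<Longrightarrow> (b has_vector_derivative
           - christoffel A g (U, \<phi>) (\<phi> ((pt \<circ> c) s)) (vector_derivative (\<phi> \<circ> (pt \<circ> c)) (at s)) (b s)) (at s)"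
    unfolding b_def comp_def by auto
  have "{s\<in>{0..1}. (pt \<circ> c) s \<in> U} = {0..1}" using pt_in[OF cU] by auto
  with cont0 have contb: "continuous_on {0..1} b" by simp
  have Ea: "E (a s) (c s) = b s" if "s \<in> {0..1}" for s
    unfolding a_def by (rule E_\<theta>[OF cU[OF that]])
  have V: "V s = X (a s) (pt (c s))" if s: "s \<in> {0..1}" for s
  proof -
    obtain u where u: "V s = coord_vec A (U, \<phi>) (pt (c s)) u"
      using tang[OF s] tangent_space_eq[OF C pt_in[OF cU[OF s]]] by auto
    then have "b s = u" unfolding b_def by (simp add: components_coord_vec[OF C pt_in[OF cU[OF s]]])
    then show ?thesis unfolding X_coord_pt[OF cU[OF s]] Ea[OF s] u by simp
  qed
  have contc: "continuous_on {0..1} c" using c(1) unfolding path_def .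
  have "path a"
    unfolding path_def
  proof (rule continuous_on_eq)
    show "continuous_on {0..1} (\<lambda>s. \<Sum>d\<in>Basis. (b s \<bullet> d) *\<^sub>R \<theta> (c s) d)"
      by (intro continuous_on_sum continuous_on_scaleR continuous_on_inner continuous_on_const contb
          continuous_on_compose2[OF smooth_on_continuous_on[OF \<theta>_smooth] contc] c(2))
    show "(\<Sum>d\<in>Basis. (b s \<bullet> d) *\<^sub>R \<theta> (c s) d) = a s" if "s \<in> {0..1}" for s
      unfolding a_def by (rule \<theta>_expand[OF cU[OF that], symmetric])
  qed
  moreover have "\<exists>u. (c has_vector_derivative u) (at s) \<and>
      (a has_vector_derivative - N (\<theta> (c s) u) (a s)) (at s)" if s: "s \<in> {0<..<1} - (S \<union> S0)" for s
  proof -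
    have s01: "s \<in> {0..1}" using s by simp
    note x = cU[OF s01]
    obtain u where u: "(c has_vector_derivative u) (at s)" using c(4) s by blast
    have "((\<phi> \<circ> (pt \<circ> c)) has_vector_derivative u) (at s)"
      by (rule has_vector_derivative_transform_within_open[OF u, of "{0<..<1}"])
        (use s phi_pt[OF cU] in auto)
    note vd = vector_derivative_at[OF this]
    have b': "(b has_vector_derivative - christoffel A g (U, \<phi>) (c s) u (b s)) (at s)"
      using der0[of s] s pt_in[OF x] vd phi_pt[OF x] by simp
    obtain \<alpha> where \<alpha>: "(a has_vector_derivative \<alpha>) (at s)"
      using field_along_curve_derivative[OF \<theta>_expand \<theta>_smooth u x b'] unfolding a_def by blast
    have "(b has_vector_derivative E \<alpha> (c s) + dE (a s) (c s) u) (at s)"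
      by (rule has_vector_derivative_transform_within_open[OF E_along_curve_derivative[OF u x \<alpha>], of "{0<..<1}"])
        (use s Ea in auto)
    from vector_derivative_unique_at[OF this b']
    have "E \<alpha> (c s) = - (christoffel A g (U, \<phi>) (c s) u (E (a s) (c s)) + dE (a s) (c s) u)"
      unfolding Ea[OF s01] by (simp add: algebra_simps)
    also have "\<dots> = E (- N (\<theta> (c s) u) (a s)) (c s)"
      unfolding christoffel_E[OF x] using linear_neg[OF linear_E[OF x], of "N (\<theta> (c s) u) (a s)"] by simp
    finally have "\<theta> (c s) (E \<alpha> (c s)) = \<theta> (c s) (E (- N (\<theta> (c s) u) (a s)) (c s))" by simp
    then have "\<alpha> = - N (\<theta> (c s) u) (a s)" unfolding \<theta>_E[OF x] .
    then show ?thesis using u \<alpha> by blast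
  qed
  ultimately have "horizontal (S \<union> S0) c a"
    unfolding horizontal_def using c S by auto
  then show ?thesis using V by blast
qed

text \<open>
  Parallel transport is defined by a unique description, so existence and uniqueness of the
  parallel field are both needed to compute it.
\<close>

lemma parallel_transport_eq:
  assumes h: "horizontal S c a"
  shows "parallel_transport A g (pt \<circ> c) (X (a 0) (pt (c 0))) = X (a 1) (pt (c 1))"
  unfolding parallel_transport_def
proof (rule the_equality)
  show "\<exists>V. parallel_along A g (pt \<circ> c) V \<and> V 0 = X (a 0) (pt (c 0)) \<and> V 1 = X (a 1) (pt (c 1))"
    using horizontal_imp_parallel[OF h] by (intro exI conjI) (assumption, simp_all)
  fix w assume "\<exists>V. parallel_along A g (pt \<circ> c) V \<and> V 0 = X (a 0) (pt (c 0)) \<and> V 1 = w"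
  then obtain V where V: "parallel_along A g (pt \<circ> c) V" "V 0 = X (a 0) (pt (c 0))" "V 1 = w" by blast
  have "\<exists>S' a'. horizontal S' c a' \<and> (\<forall>s\<in>{0..1}. V s = X (a' s) (pt (c s)))"
  proof (rule parallel_imp_horizontal[OF V(1), of S])
    show "path c" "c ` {0..1} \<subseteq> \<phi> ` U" "finite S" using h unfolding horizontal_def by simp_all
    show "\<exists>u. (c has_vector_derivative u) (at s)" if "s \<in> {0<..<1} - S" for s
      using h that unfolding horizontal_def by blast
  qed
  then obtain S' a' where a': "horizontal S' c a'" "\<And>s. s \<in> {0..1} \<Longrightarrow> V s = X (a' s) (pt (c s))"
    by blast
  have "a 0 = a' 0" using a'(2)[of 0] V(2) by (simp add: X_inject)
  then have "a 1 = a' 1" by (rule horizontal_unique[OF h a'(1)]) simp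
  then show "w = X (a 1) (pt (c 1))" using a'(2)[of 1] V(3) by simp
qed

end


section \<open>Holonomy of triangles in a chart\<close>

definition koszul_matrix :: "(real ^ 'n \<Rightarrow> real ^ 'n \<Rightarrow> real ^ 'n) \<Rightarrow> real ^ 'n \<Rightarrow> real ^ 'n ^ 'n" where
  "koszul_matrix br w = matrix (koszul br w)"

text \<open>
  The curvature operator \<open>[\<nabla>\<^sub>v, \<nabla>\<^sub>w] - \<nabla>\<^bsub>[v, w]\<^esub>\<close> in the frame.
\<close>

definition koszul_curvature ::
  "(real ^ 'n \<Rightarrow> real ^ 'n \<Rightarrow> real ^ 'n) \<Rightarrow> real ^ 'n \<Rightarrow> real ^ 'n \<Rightarrow> real ^ 'n ^ 'n" where
  "koszul_curvature br v w = koszul_matrix br v ** koszul_matrix br w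
     - koszul_matrix br w ** koszul_matrix br v - koszul_matrix br (br v w)"

context left_frame
begin

abbreviation "NM \<equiv> koszul_matrix br"
abbreviation "curv \<equiv> koszul_curvature br"

lemma NM_apply: "NM w *v v = N w v"
  unfolding koszul_matrix_def using N_bilinear unfolding bilinear_def by (simp add: matrix_works)

lemma linear_NM: "linear NM"
proof (rule linearI)
  show "NM (v + w) = NM v + NM w" for v w
    unfolding matrix_eq by (simp add: NM_apply matrix_vector_mult_add_rdistrib bilinear_ladd[OF N_bilinear])
  show "NM (r *\<^sub>R v) = r *\<^sub>R NM v" for r v
    unfolding matrix_eq by (simp add: NM_apply scaleR_matrix_vector_assoc[symmetric] bilinear_lmul[OF N_bilinear])
qed

lemma transpose_NM: "transpose (NM w) = - NM w"
proof -
  have "transpose (NM w) *v v = (- NM w) *v v" for v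
  proof (rule vector_eq_rdot[THEN iffD1], rule allI)
    fix z
    have "(transpose (NM w) *v v) \<bullet> z = v \<bullet> N w z"
      by (simp only: inner_matrix_vector transpose_transpose NM_apply)
    also have "\<dots> = - (N w v \<bullet> z)" using N_skew[of w v z] by simp
    also have "\<dots> = ((- NM w) *v v) \<bullet> z"
      using bounded_bilinear.minus_left[OF bounded_bilinear_matrix_vector_mult, of "NM w" v] by (simp add: NM_apply)
    finally show "(transpose (NM w) *v v) \<bullet> z = ((- NM w) *v v) \<bullet> z" .
  qed
  then show ?thesis unfolding matrix_eq by blast
qed

end

context frame_chart
begin

abbreviation "M x u \<equiv> NM (\<theta> x u)"

lemma linear_M: "x \<in> \<phi> ` U \<Longrightarrow> linear (M x)"
  using linear_compose[OF linear_\<theta> linear_NM] by (simp add: comp_def)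

lemma M_smooth: "smooth_on (\<phi> ` U) (\<lambda>x. M x u)"
  by (rule smooth_on_linear[OF openV _ \<theta>_smooth]) (simp add: linear_NM linear_conv_bounded_linear[symmetric])

text \<open>
  The matrix \<open>\<Phi> s\<close> represents, in the frame, the parallel transport from \<open>x\<close> along the segment
  towards \<open>y\<close> up to time \<open>s\<close>.
\<close>

definition transport_matrix :: "real ^ 'n \<Rightarrow> real ^ 'n \<Rightarrow> (real \<Rightarrow> real ^ 'n ^ 'n) \<Rightarrow> bool" where
  "transport_matrix x y \<Phi> \<longleftrightarrow> \<Phi> 0 = mat 1 \<and>
    (\<forall>s\<in>{0..1}. (\<Phi> has_vector_derivative - (M (linepath x y s) (y - x) ** \<Phi> s)) (at s within {0..1}))"

lemma transport_matrix_exists: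
  assumes "closed_segment x y \<subseteq> \<phi> ` U"
  shows "\<exists>\<Phi>. transport_matrix x y \<Phi>"
proof -
  have "continuous_on {0..1} (\<lambda>s. - M (linepath x y s) (y - x))"
    by (intro continuous_on_minus continuous_on_compose2[OF smooth_on_continuous_on[OF M_smooth]])
      (use assms in \<open>auto simp: linepath_image_01\<close>)
  from linear_ode_solution[OF bounded_bilinear_matrix_mult this, of "mat 1"]
  show ?thesis unfolding transport_matrix_def by (simp only: matrix_mult.minus_left)
qed

lemma transport_matrixD:
  assumes "transport_matrix x y \<Phi>"
  shows "\<Phi> 0 = mat 1"
    "s \<in> {0..1} \<Longrightarrow> (\<Phi> has_vector_derivative - (M (linepath x y s) (y - x) ** \<Phi> s)) (at s within {0..1})"
  using assms unfolding transport_matrix_def by auto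

lemma transport_matrix_conj_derivative:
  assumes \<Phi>: "transport_matrix x y \<Phi>" and s: "s \<in> {0..1}"
  shows "((\<lambda>s. transpose (\<Phi> s)) has_vector_derivative transpose (\<Phi> s) ** M (linepath x y s) (y - x))
    (at s within {0..1})"
proof -
  have "transpose (- (M (linepath x y s) (y - x) ** \<Phi> s)) = transpose (\<Phi> s) ** M (linepath x y s) (y - x)"
    using linear_neg[OF bounded_linear.linear[OF bounded_linear_transpose], of "M (linepath x y s) (y - x) ** \<Phi> s"]
    by (simp add: matrix_transpose_mul transpose_NM matrix_mult.minus_right)
  then show ?thesis
    using bounded_linear.has_vector_derivative[OF bounded_linear_transpose transport_matrixD(2)[OF \<Phi> s]] by simp
qed

lemma transport_matrix_orthogonal:
  assumes \<Phi>: "transport_matrix x y \<Phi>" and s: "s \<in> {0..1}"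
  shows "transpose (\<Phi> s) ** \<Phi> s = mat 1" "\<Phi> s ** transpose (\<Phi> s) = mat 1"
proof -
  have "(\<lambda>s. transpose (\<Phi> s) ** \<Phi> s) s = (\<lambda>s. transpose (\<Phi> s) ** \<Phi> s) 0"
  proof (rule vector_derivative_zero_constant[OF _ s])
    fix s :: real assume s: "s \<in> {0..1}"
    show "((\<lambda>s. transpose (\<Phi> s) ** \<Phi> s) has_vector_derivative 0) (at s within {0..1})"
      using bounded_bilinear.has_vector_derivative[OF bounded_bilinear_matrix_mult
          transport_matrix_conj_derivative[OF \<Phi> s] transport_matrixD(2)[OF \<Phi> s]]
      by (simp add: matrix_mult.minus_right matrix_mul_assoc)
  qed
  then show "transpose (\<Phi> s) ** \<Phi> s = mat 1" by (simp add: transport_matrixD(1)[OF \<Phi>] transpose_mat)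
  then show "\<Phi> s ** transpose (\<Phi> s) = mat 1" by (simp add: matrix_left_right_inverse)
qed

text \<open>
  Transport along a part of a segment is transport along a segment. This turns statements about
  end points of segments into statements about all their points.
\<close>

lemma transport_matrix_initial_segment:
  assumes U: "closed_segment x y \<subseteq> \<phi> ` U" and \<Phi>: "transport_matrix x y \<Phi>" and r: "r \<in> {0..1}"
  shows "transport_matrix x (linepath x y r) (\<lambda>s. \<Phi> (r * s))"
  unfolding transport_matrix_def
proof (intro conjI ballI)
  show "\<Phi> (r * 0) = mat 1" using transport_matrixD(1)[OF \<Phi>] by simp
  fix s :: real assume s: "s \<in> {0..1}"
  have sub: "(*) r ` {0..1} \<subseteq> {0..1}" using r by (auto simp: mult_le_one)
  then have rs: "r * s \<in> {0..1}" using s by blast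
  have l: "linepath x (linepath x y r) s = linepath x y (r * s)" and d: "linepath x y r - x = r *\<^sub>R (y - x)"
    by (simp_all add: linepath_def algebra_simps)
  have "linepath x y (r * s) \<in> closed_segment x y"
    unfolding linepath_image_01[symmetric] using rs by (rule imageI)
  then have "linepath x y (r * s) \<in> \<phi> ` U" using U by blast
  note eq = linear_scale[OF linear_M[OF this], of r "y - x"]
  have "((*) r has_vector_derivative r) (at s within {0..1})" by (auto intro!: derivative_eq_intros)
  from vector_diff_chain_within[OF this has_vector_derivative_within_subset[OF transport_matrixD(2)[OF \<Phi> rs] sub]]
  have "((\<lambda>s. \<Phi> (r * s)) has_vector_derivative r *\<^sub>R - (M (linepath x y (r * s)) (y - x) ** \<Phi> (r * s))) (at s within {0..1})"
    by (simp add: comp_def)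
  then show "((\<lambda>s. \<Phi> (r * s)) has_vector_derivative
      - (M (linepath x (linepath x y r) s) (linepath x y r - x) ** \<Phi> (r * s))) (at s within {0..1})"
    by (simp add: l d eq matrix_mult.scaleR_left)
qed

lemma transport_matrix_reverse:
  assumes U: "closed_segment x y \<subseteq> \<phi> ` U" and \<Phi>: "transport_matrix x y \<Phi>"
  shows "transport_matrix y x (\<lambda>s. \<Phi> (1 - s) ** transpose (\<Phi> 1))"
  unfolding transport_matrix_def
proof (intro conjI ballI)
  show "\<Phi> (1 - 0) ** transpose (\<Phi> 1) = mat 1" using transport_matrix_orthogonal(2)[OF \<Phi>, of 1] by simp
  fix s :: real assume s: "s \<in> {0..1}"
  then have s': "1 - s \<in> {0..1}" by auto
  have sub: "(\<lambda>s. 1 - s) ` {0..1::real} \<subseteq> {0..1}" by auto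
  have l: "linepath y x s = linepath x y (1 - s)" by (simp add: linepath_def algebra_simps)
  have "linepath x y (1 - s) \<in> closed_segment x y"
    unfolding linepath_image_01[symmetric] using s' by (rule imageI)
  then have "linepath x y (1 - s) \<in> \<phi> ` U" using U by blast
  note eq = linear_neg[OF linear_M[OF this], of "y - x", simplified]
  have "((\<lambda>s. 1 - s) has_vector_derivative - 1) (at s within {0..1})" by (auto intro!: derivative_eq_intros)
  from vector_diff_chain_within[OF this has_vector_derivative_within_subset[OF transport_matrixD(2)[OF \<Phi> s'] sub]]
  have "((\<lambda>s. \<Phi> (1 - s)) has_vector_derivative M (linepath x y (1 - s)) (y - x) ** \<Phi> (1 - s)) (at s within {0..1})"
    by (simp add: comp_def)
  from bounded_linear.has_vector_derivative[OF matrix_mult.bounded_linear_left this, of "transpose (\<Phi> 1)"]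
  show "((\<lambda>s. \<Phi> (1 - s) ** transpose (\<Phi> 1)) has_vector_derivative
      - (M (linepath y x s) (x - y) ** (\<Phi> (1 - s) ** transpose (\<Phi> 1)))) (at s within {0..1})"
    by (simp add: l eq matrix_mult.minus_left matrix_mul_assoc)
qed

lemma transport_matrix_horizontal:
  assumes U: "closed_segment x y \<subseteq> \<phi> ` U" and \<Phi>: "transport_matrix x y \<Phi>"
  shows "horizontal {} (linepath x y) (\<lambda>s. \<Phi> s *v v)"
  unfolding horizontal_def
proof (intro conjI ballI)
  show "path (linepath x y)" by simp
  show "linepath x y ` {0..1} \<subseteq> \<phi> ` U" using U by (simp add: linepath_image_01)
  have D: "((\<lambda>s. \<Phi> s *v v) has_vector_derivative - N (\<theta> (linepath x y s) (y - x)) (\<Phi> s *v v)) (at s within {0..1})"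
    if s: "s \<in> {0..1}" for s
  proof -
    from bounded_linear.has_vector_derivative[OF bounded_bilinear.bounded_linear_left[OF bounded_bilinear_matrix_vector_mult]
        transport_matrixD(2)[OF \<Phi> s], of v]
    show ?thesis
      by (simp add: bounded_bilinear.minus_left[OF bounded_bilinear_matrix_vector_mult]
          matrix_vector_mul_assoc[symmetric] NM_apply)
  qed
  show "path (\<lambda>s. \<Phi> s *v v)"
    unfolding path_def continuous_on_eq_continuous_within
    using has_vector_derivative_continuous[OF D] by blast
  fix s :: real assume "s \<in> {0<..<1} - {}"
  then have s: "s \<in> {0..1}" "at s within {0..1} = at s"
    by (simp_all add: at_within_Icc_at)
  have "(linepath x y has_vector_derivative (y - x)) (at s)" by (rule has_vector_derivative_linepath_within)
  then show "\<exists>u. (linepath x y has_vector_derivative u) (at s) \<and>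
      ((\<lambda>s. \<Phi> s *v v) has_vector_derivative - N (\<theta> (linepath x y s) u) (\<Phi> s *v v)) (at s)"
    using D[OF s(1)] unfolding s(2) by (intro exI[of _ "y - x"] conjI)
qed simp

lemma smooth_arc_affine:
  assumes U: "\<And>s. s \<in> {a..b} \<Longrightarrow> x + (s * r + q) *\<^sub>R u \<in> \<phi> ` U" and ab: "a \<le> b"
    and \<gamma>: "\<And>s. s \<in> {a..b} \<Longrightarrow> \<gamma> s = pt (x + (s * r + q) *\<^sub>R u)"
  shows "smooth_arc A a b \<gamma>"
proof -
  let ?c = "\<lambda>s. x + (s * r + q) *\<^sub>R u"
  have O: "open (?c -` (\<phi> ` U))"
    by (intro continuous_open_vimage openV continuous_intros)
  have "a \<in> ?c -` (\<phi> ` U)" "b \<in> ?c -` (\<phi> ` U)" using U ab by auto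
  then obtain d e where d: "d > 0" "ball a d \<subseteq> ?c -` (\<phi> ` U)" and e: "e > 0" "ball b e \<subseteq> ?c -` (\<phi> ` U)"
    using O open_contains_ball by metis
  let ?e = "min d e"
  have "?c ` {a - ?e<..<b + ?e} \<subseteq> \<phi> ` U"
  proof clarify
    fix s assume s: "s \<in> {a - ?e<..<b + ?e}"
    consider "s \<in> ball a d" | "s \<in> ball b e" | "s \<in> {a..b}"
      using s by (auto simp: dist_real_def) linarith
    then show "?c s \<in> \<phi> ` U" using d(2) e(2) U by cases auto
  qed
  from smooth_curve_on_chart[OF C open_greaterThanLessThan affine_smooth this]
  have "smooth_curve_on A {a - ?e<..<b + ?e} (\<lambda>s. pt (?c s))" by simp
  then show ?thesis
    unfolding smooth_arc_def using d(1) e(1) \<gamma> by (intro exI[of _ "\<lambda>s. pt (?c s)"] exI[of _ ?e]) auto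
qed

text \<open>
  A triangle in a convex part of the chart contracts within it. The product of the three transport
  matrices is therefore an element of the restricted holonomy group.
\<close>

lemma triangle_holonomy:
  assumes B: "convex B" "B \<subseteq> \<phi> ` U" and pts: "x0 \<in> B" "x \<in> B" "y \<in> B"
    and trs: "transport_matrix x0 x \<Phi>1" "transport_matrix x y \<Phi>2" "transport_matrix y x0 \<Phi>3"
  shows "\<exists>h\<in>restricted_holonomy A g (pt x0). \<forall>v.
    h (X v (pt x0)) = X (\<Phi>3 1 *v (\<Phi>2 1 *v (\<Phi>1 1 *v v))) (pt x0)"
proof -
  define c where "c = linepath x0 x +++ (linepath x y +++ linepath y x0)"
  have seg: "closed_segment x0 x \<subseteq> B" "closed_segment x y \<subseteq> B" "closed_segment y x0 \<subseteq> B"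
    using pts B(1) by (simp_all add: closed_segment_subset)
  note segU = seg[THEN order_trans, OF B(2)]
  have pathc: "path c" unfolding c_def by simp
  have imc: "c ` {0..1} \<subseteq> B"
    using seg unfolding c_def path_image_def[symmetric] by (simp add: path_image_join)
  have imU: "c ` {0..1} \<subseteq> \<phi> ` U" using imc B(2) by (rule order_trans)
  have c01: "c 0 = x0" "c 1 = x0" by (simp_all add: c_def joinpaths_def linepath_def)
  have "restrict (parallel_transport A g (pt \<circ> c)) (tangent_space A (pt x0)) \<in> restricted_holonomy A g (pt x0)"
    unfolding restricted_holonomy_def
  proof (intro CollectI exI[of _ "pt \<circ> c"] conjI refl)
    show "pathstart (pt \<circ> c) = pt x0" "pathfinish (pt \<circ> c) = pt x0"
      by (simp_all add: pathstart_def pathfinish_def c01)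
    have "homotopic_paths B c (\<lambda>_. x0)"
    proof (rule homotopic_paths_linear[OF pathc])
      show "path (\<lambda>_. x0)" unfolding path_def by simp
      show "closed_segment (c s) x0 \<subseteq> B" if "s \<in> {0..1}" for s
        using imc that pts(1) B(1) by (intro closed_segment_subset) auto
    qed (simp_all add: pathstart_def pathfinish_def c01)
    from homotopic_paths_continuous_image[OF this continuous_on_subset[OF chartD(4)[OF C] B(2)], of UNIV]
    show "homotopic_paths UNIV (pt \<circ> c) (\<lambda>_. pt x0)" by (simp add: comp_def)
    show "piecewise_smooth_path A (pt \<circ> c)"
      unfolding piecewise_smooth_path_def
    proof (intro conjI exI[of _ "3::nat"] exI[of _ "(\<lambda>i. [0, 1/2, 3/4, 1] ! i) :: nat \<Rightarrow> real"] allI impI)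
      show "path (pt \<circ> c)" by (rule path_pt[OF pathc imU])
      have arc1: "smooth_arc A 0 (1/2) (pt \<circ> c)"
      proof (rule smooth_arc_affine[where x = x0 and r = 2 and q = 0 and u = "x - x0"])
        fix s :: real assume s: "s \<in> {0..1/2}"
        then have "c s = x0 + (s * 2 + 0) *\<^sub>R (x - x0)"
          by (simp add: c_def joinpaths_def linepath_def algebra_simps)
        moreover have "c s \<in> \<phi> ` U" using imU s by auto
        ultimately show "x0 + (s * 2 + 0) *\<^sub>R (x - x0) \<in> \<phi> ` U"
          "(pt \<circ> c) s = pt (x0 + (s * 2 + 0) *\<^sub>R (x - x0))" by simp_all
      qed simp
      have arc2: "smooth_arc A (1/2) (3/4) (pt \<circ> c)"
      proof (rule smooth_arc_affine[where x = x and r = 4 and q = "-2" and u = "y - x"])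
        fix s :: real assume s: "s \<in> {1/2..3/4}"
        have "c s = x + (s * 4 + - 2) *\<^sub>R (y - x)"
        proof (cases "s = 1/2")
          case False
          then show ?thesis using s
            by (simp add: c_def joinpaths_def linepath_def algebra_simps)
        next
          case True
          show ?thesis unfolding True by (simp add: c_def joinpaths_def linepath_def)
        qed
        moreover have "c s \<in> \<phi> ` U" using imU s by auto
        ultimately show "x + (s * 4 + - 2) *\<^sub>R (y - x) \<in> \<phi> ` U"
          "(pt \<circ> c) s = pt (x + (s * 4 + - 2) *\<^sub>R (y - x))" by simp_all
      qed simp
      have arc3: "smooth_arc A (3/4) 1 (pt \<circ> c)"
      proof (rule smooth_arc_affine[where x = y and r = 4 and q = "-3" and u = "x0 - y"])
        fix s :: real assume s: "s \<in> {3/4..1}"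
        have "c s = y + (s * 4 + - 3) *\<^sub>R (x0 - y)"
        proof (cases "s = 3/4")
          case False
          then show ?thesis using s
            by (simp add: c_def joinpaths_def linepath_def algebra_simps)
        next
          case True
          show ?thesis unfolding True by (simp add: c_def joinpaths_def linepath_def)
        qed
        moreover have "c s \<in> \<phi> ` U" using imU s by auto
        ultimately show "y + (s * 4 + - 3) *\<^sub>R (x0 - y) \<in> \<phi> ` U"
          "(pt \<circ> c) s = pt (y + (s * 4 + - 3) *\<^sub>R (x0 - y))" by simp_all
      qed simp
      fix i :: nat assume "i < 3"
      then consider "i = 0" | "i = 1" | "i = 2" by linarith
      then show "[0, 1/2, 3/4, 1] ! i < ([0, 1/2, 3/4, 1] ! Suc i :: real)"
        and "smooth_arc A ([0, 1/2, 3/4, 1] ! i) ([0, 1/2, 3/4, 1] ! Suc i) (pt \<circ> c)"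
        using arc1 arc2 arc3 by (cases; simp add: numeral_2_eq_2)+
    qed (simp_all add: numeral_3_eq_3)
  qed
  moreover have "restrict (parallel_transport A g (pt \<circ> c)) (tangent_space A (pt x0)) (X v (pt x0)) =
      X (\<Phi>3 1 *v (\<Phi>2 1 *v (\<Phi>1 1 *v v))) (pt x0)" for v
  proof -
    let ?a1 = "\<lambda>s. \<Phi>1 s *v v" let ?a2 = "\<lambda>s. \<Phi>2 s *v ?a1 1" let ?a3 = "\<lambda>s. \<Phi>3 s *v ?a2 1"
    have init: "?a2 0 = ?a1 1" "?a3 0 = ?a2 1" "?a1 0 = v"
      using trs[THEN transport_matrixD(1)] by (simp_all add: matrix_vector_mul_lid)
    have e1: "linepath x y 1 = linepath y x0 0" by (simp add: linepath_def)
    obtain S where S: "horizontal S (linepath x y +++ linepath y x0) (?a2 +++ ?a3)"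
      using horizontal_join[OF transport_matrix_horizontal[OF segU(2) trs(2)] transport_matrix_horizontal[OF segU(3) trs(3)]
          e1 init(2)[symmetric]] by blast
    have e2: "linepath x0 x 1 = (linepath x y +++ linepath y x0) 0" "\<Phi>1 1 *v v = (?a2 +++ ?a3) 0"
      using init by (simp_all add: joinpaths_def linepath_def)
    obtain S' where "horizontal S' c (?a1 +++ (?a2 +++ ?a3))"
      using horizontal_join[OF transport_matrix_horizontal[OF segU(1) trs(1)] S e2] unfolding c_def by blast
    from parallel_transport_eq[OF this]
    have "parallel_transport A g (pt \<circ> c) (X v (pt x0)) = X (?a3 1) (pt x0)"
      using init by (simp add: c01 joinpaths_def)
    moreover have "X v (pt x0) \<in> tangent_space A (pt x0)"
      using X_field unfolding smooth_vector_field_def by blast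
    ultimately show ?thesis by simp
  qed
  ultimately show ?thesis by blast
qed

end


section \<open>From invariant subspaces to the curvature\<close>

context frame_chart
begin

text \<open>
  The field \<open>F\<close> of the proof is \<open>Q\<close> transported along rays from \<open>x0\<close>. As the holonomy of triangles
  commutes with \<open>Q\<close>, the field is parallel along every segment. It therefore satisfies a linear first
  order system with smooth coefficients, and the curvature is the integrability condition of this
  system, obtained by evaluating the brackets of the frame fields on \<open>F\<close>.
\<close>

lemma curvature_commutes_if_loops_commute:
  assumes r: "cball x0 r \<subseteq> \<phi> ` U" "r > 0"
    and loops: "\<And>x y \<Phi>1 \<Phi>2 \<Phi>3. x \<in> ball x0 r \<Longrightarrow> y \<in> ball x0 r \<Longrightarrow> transport_matrix x0 x \<Phi>1 \<Longrightarrow> transport_matrix x y \<Phi>2 \<Longrightarrow>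
      transport_matrix y x0 \<Phi>3 \<Longrightarrow> (\<Phi>3 1 ** \<Phi>2 1 ** \<Phi>1 1) ** Q = Q ** (\<Phi>3 1 ** \<Phi>2 1 ** \<Phi>1 1)"
  shows "Q ** curv v w = curv v w ** Q"
proof -
  define B where "B = ball x0 r"
  have B: "open B" "convex B" "B \<subseteq> \<phi> ` U" "x0 \<in> B"
    using r ball_subset_cball[of x0 r] by (auto simp: B_def)
  have seg: "closed_segment x y \<subseteq> B" if "x \<in> B" "y \<in> B" for x y
    using that B(2) by (rule closed_segment_subset)
  have segU: "closed_segment x y \<subseteq> \<phi> ` U" if "x \<in> B" "y \<in> B" for x y
    using seg[OF that] B(3) by (rule order_trans)
  have lB: "linepath x y s \<in> B" if "x \<in> B" "y \<in> B" "s \<in> {0..1}" for x y s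
    using seg[OF that(1,2)] that(3) unfolding linepath_image_01[symmetric] by blast
  define \<Psi> where "\<Psi> x = (SOME \<Phi>. transport_matrix x0 x \<Phi>)" for x
  have \<Psi>: "transport_matrix x0 x (\<Psi> x)" if "x \<in> B" for x
    unfolding \<Psi>_def using transport_matrix_exists[OF segU[OF B(4) that]] by (rule someI_ex)
  define P where "P x = \<Psi> x 1" for x
  have P: "transpose (P x) ** P x = mat 1" "P x ** transpose (P x) = mat 1" if "x \<in> B" for x
    using transport_matrix_orthogonal[OF \<Psi>[OF that], of 1] unfolding P_def by auto
  define F where "F x = P x ** Q ** transpose (P x)" for x
  \<comment> \<open>The loop from \<open>x0\<close> along the ray to \<open>x\<close>, along the segment
    to \<open>y\<close>, and back along the ray.\<close>
  have step: "\<Phi> 1 ** F x = F y ** \<Phi> 1" if xy: "x \<in> B" "y \<in> B" and \<Phi>: "transport_matrix x y \<Phi>" for x y \<Phi>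
  proof -
    have rev_tm: "transport_matrix y x0 (\<lambda>s. \<Psi> y (1 - s) ** transpose (\<Psi> y 1))"
      by (rule transport_matrix_reverse[OF segU[OF B(4) xy(2)] \<Psi>[OF xy(2)]])
    have "(transpose (P y) ** \<Phi> 1 ** P x) ** Q = Q ** (transpose (P y) ** \<Phi> 1 ** P x)"
      using loops[OF _ _ \<Psi>[OF xy(1)] \<Phi> rev_tm] xy transport_matrixD(1)[OF \<Psi>[OF xy(2)]]
      by (simp add: B_def P_def matrix_mul_lid)
    then have "P y ** ((transpose (P y) ** \<Phi> 1 ** P x) ** Q) ** transpose (P x) =
        P y ** (Q ** (transpose (P y) ** \<Phi> 1 ** P x)) ** transpose (P x)" by simp
    moreover have "P y ** ((transpose (P y) ** \<Phi> 1 ** P x) ** Q) ** transpose (P x) =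
        (P y ** transpose (P y)) ** \<Phi> 1 ** F x"
      unfolding F_def by (simp add: matrix_mul_assoc)
    moreover have "P y ** (Q ** (transpose (P y) ** \<Phi> 1 ** P x)) ** transpose (P x) =
        F y ** \<Phi> 1 ** (P x ** transpose (P x))"
      unfolding F_def by (simp add: matrix_mul_assoc)
    ultimately show ?thesis by (simp add: P xy matrix_mul_lid matrix_mul_rid)
  qed
  \<comment> \<open>The candidate for the derivative of \<open>F\<close>.\<close>
  define L where "L x u = F x ** M x u - M x u ** F x" for x u
  have der: "((\<lambda>s. F (linepath x y s)) has_vector_derivative L (linepath x y s) (y - x)) (at s within {0..1})"
    if xy: "x \<in> B" "y \<in> B" and s: "s \<in> {0..1}" for x y s
  proof -
    obtain \<Phi> where \<Phi>: "transport_matrix x y \<Phi>" using transport_matrix_exists[OF segU[OF xy]] by blast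
    have F: "\<Phi> s ** F x ** transpose (\<Phi> s) = F (linepath x y s)" if s: "s \<in> {0..1}" for s
    proof -
      have "\<Phi> s ** F x = F (linepath x y s) ** \<Phi> s"
        using step[OF xy(1) lB[OF xy s] transport_matrix_initial_segment[OF segU[OF xy] \<Phi> s]] by simp
      then have "\<Phi> s ** F x ** transpose (\<Phi> s) = F (linepath x y s) ** (\<Phi> s ** transpose (\<Phi> s))"
        by (simp add: matrix_mul_assoc)
      then show ?thesis by (simp add: transport_matrix_orthogonal[OF \<Phi> s] matrix_mul_rid)
    qed
    let ?M = "M (linepath x y s) (y - x)"
    have "((\<lambda>s. \<Phi> s ** F x ** transpose (\<Phi> s)) has_vector_derivative
        \<Phi> s ** F x ** (transpose (\<Phi> s) ** ?M) + - (?M ** \<Phi> s) ** F x ** transpose (\<Phi> s)) (at s within {0..1})"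
      by (rule bounded_bilinear.has_vector_derivative[OF bounded_bilinear_matrix_mult
            bounded_linear.has_vector_derivative[OF matrix_mult.bounded_linear_left transport_matrixD(2)[OF \<Phi> s]]
            transport_matrix_conj_derivative[OF \<Phi> s]])
    moreover have "\<Phi> s ** F x ** (transpose (\<Phi> s) ** ?M) + - (?M ** \<Phi> s) ** F x ** transpose (\<Phi> s) =
        (\<Phi> s ** F x ** transpose (\<Phi> s)) ** ?M - ?M ** (\<Phi> s ** F x ** transpose (\<Phi> s))"
      by (simp add: matrix_mult.minus_left matrix_mul_assoc)
    ultimately have D: "((\<lambda>s. \<Phi> s ** F x ** transpose (\<Phi> s)) has_vector_derivative L (linepath x y s) (y - x)) (at s within {0..1})"
      unfolding L_def F[OF s] by simp
    show ?thesis
      by (rule has_vector_derivative_transform[OF s F[symmetric] D])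
  qed
  have linL: "linear (L x)" if "x \<in> B" for x
  proof -
    have lM: "linear (M x)" using linear_M that B(3) by blast
    show ?thesis
      unfolding L_def
      by (rule linearI) (simp_all add: linear_add[OF lM] linear_scale[OF lM] matrix_mult.add_left matrix_mult.add_right
          matrix_mult.scaleR_left matrix_mult.scaleR_right scaleR_right_diff_distrib)
  qed
  have contM: "continuous_on T (\<lambda>x. M x u)" if "T \<subseteq> \<phi> ` U" for T u
    by (rule continuous_on_subset[OF smooth_on_continuous_on[OF M_smooth] that])
  \<comment> \<open>Continuity of \<open>F\<close> has to come first: the matrices \<open>P x\<close> were
    chosen point by point, but they are orthogonal, so \<open>F\<close> and its
    derivatives along segments are bounded.\<close>
  have "\<exists>K. \<forall>x\<in>B. \<forall>u. norm (L x u) \<le> K * norm u"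
  proof -
    have "bounded ((\<lambda>x. \<Sum>b\<in>Basis. norm (M x b)) ` cball x0 r)"
      by (intro compact_imp_bounded compact_continuous_image continuous_on_sum continuous_on_norm contM r compact_cball)
    then obtain k where "\<forall>z\<in>(\<lambda>x. \<Sum>b\<in>Basis. norm (M x b)) ` cball x0 r. norm z \<le> k"
      unfolding bounded_iff by (elim exE)
    note k = bspec[OF this imageI, unfolded real_norm_def]
    have "\<exists>m>0. \<forall>(a :: real ^ 'n ^ 'n) (b :: real ^ 'n ^ 'n). norm (a ** b) \<le> norm a * norm b * m"
      by (rule matrix_mult.pos_bounded)
    then obtain m where "m > 0 \<and> (\<forall>(a :: real ^ 'n ^ 'n) (b :: real ^ 'n ^ 'n). norm (a ** b) \<le> norm a * norm b * m)" ..
    then have m: "m > 0" "\<And>(a :: real ^ 'n ^ 'n) (b :: real ^ 'n ^ 'n). norm (a ** b) \<le> norm a * norm b * m"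
      by simp_all
    let ?n = "real CARD('n)"
    define f where "f = ?n * norm Q * m * ?n * m"
    have F: "norm (F x) \<le> f" if "x \<in> B" for x
    proof -
      have p: "norm (P x) \<le> ?n" "norm (transpose (P x)) \<le> ?n"
        using P[OF that] by (auto intro!: orthogonal_norm_bound simp: transpose_transpose)
      have "norm (P x ** Q) \<le> norm (P x) * norm Q * m" by (rule m(2))
      also have "\<dots> \<le> ?n * norm Q * m" using p(1) m(1) by (intro mult_right_mono) auto
      finally have "norm (P x ** Q) * norm (transpose (P x)) * m \<le> (?n * norm Q * m) * ?n * m"
        using p(2) m(1) by (intro mult_right_mono mult_mono) auto
      then show ?thesis unfolding f_def F_def using m(2)[of "P x ** Q" "transpose (P x)"] by linarith
    qed
    have "norm (L x u) \<le> (2 * f * m * k) * norm u" if x: "x \<in> B" for x u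
    proof -
      have xU: "x \<in> \<phi> ` U" "x \<in> cball x0 r" using x B(3) by (auto simp: B_def)
      have "norm (M x u) \<le> (\<Sum>b\<in>Basis. norm (M x b)) * norm u"
        by (rule norm_linear_le[OF linear_M[OF xU(1)]])
      also have "\<dots> \<le> k * norm u" using k[OF xU(2)] by (intro mult_right_mono) auto
      finally have nM: "norm (M x u) \<le> k * norm u" .
      have "norm (F x) * norm (M x u) \<le> f * (k * norm u)"
        using F[OF x] nM order_trans[OF norm_ge_zero F[OF x]] by (intro mult_mono) auto
      then have le: "norm (F x) * norm (M x u) * m \<le> f * (k * norm u) * m"
        using m(1) by (intro mult_right_mono) auto
      have "norm (L x u) \<le> norm (F x ** M x u) + norm (M x u ** F x)"
        unfolding L_def by (rule norm_triangle_ineq4)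
      then have "norm (L x u) \<le> f * (k * norm u) * m + f * (k * norm u) * m"
        using le m(2)[of "F x" "M x u"] m(2)[of "M x u" "F x", unfolded mult.commute[of "norm (M x u)"]]
        by linarith
      then show ?thesis by (simp add: algebra_simps)
    qed
    then show ?thesis by blast
  qed
  then obtain K where K: "\<And>x u. x \<in> B \<Longrightarrow> norm (L x u) \<le> K * norm u" by blast
  have lip: "norm (F y - F x) \<le> K * norm (y - x)" if "x \<in> B" "y \<in> B" for x y
    by (rule segment_derivative_bound[where F = F and L = L, OF der[OF that]]) (simp_all add: K lB that)
  have "continuous_on B F"
  proof (rule continuous_onI)
    fix x e assume x: "x \<in> B" and e: "(e::real) > 0"
    show "\<exists>d>0. \<forall>y\<in>B. dist y x < d \<longrightarrow> dist (F y) (F x) \<le> e"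
    proof (intro exI[of _ "e / (\<bar>K\<bar> + 1)"] conjI ballI impI)
      fix y assume y: "y \<in> B" and "dist y x < e / (\<bar>K\<bar> + 1)"
      then have d: "(\<bar>K\<bar> + 1) * norm (y - x) \<le> e"
        by (simp add: dist_norm field_simps)
      have "K * norm (y - x) \<le> (\<bar>K\<bar> + 1) * norm (y - x)" by (intro mult_right_mono) auto
      then show "dist (F y) (F x) \<le> e" using lip[OF x y] d by (simp add: dist_norm)
    qed (use e in simp)
  qed
  note contF = this
  have contL: "continuous_on B (\<lambda>x. L x u)" for u
    unfolding L_def by (intro continuous_on_diff bounded_bilinear.continuous_on[OF bounded_bilinear_matrix_mult] contF contM B(3))
  have dF: "(F has_derivative L x) (at x)" if "x \<in> B" for x
    by (rule has_derivative_if_along_segments[where F = F and L = L, OF B(1,2) _ linL contL that]) (rule der)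
  \<comment> \<open>The differential system expresses the derivative of \<open>F\<close> by
    \<open>F\<close> itself, so \<open>F\<close> gains one order of differentiability at a
    time.\<close>
  have "Ck_on k B F" for k
  proof (induction k)
    case 0
    then show ?case using contF by simp
  next
    case (Suc k)
    have Mk: "Ck_on k B (\<lambda>x. M x u)" for u
      using smooth_on_subset[OF M_smooth B(3)] unfolding smooth_on_def by blast
    show ?case
    proof (rule Ck_on_SucI[OF B(1) dF])
      show "Ck_on k B (\<lambda>x. L x u)" for u
        using Ck_on_add[OF B(1) Ck_on_bilinear[OF B(1) bounded_bilinear_matrix_mult Suc Mk[of u]]
            Ck_on_linear[OF B(1) bounded_linear_minus[OF bounded_linear_ident]
              Ck_on_bilinear[OF B(1) bounded_bilinear_matrix_mult Mk[of u] Suc]]]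
        unfolding L_def by simp
    qed
  qed
  then have smF: "smooth_on B F" unfolding smooth_on_def by blast
  \<comment> \<open>The derivative of \<open>F\<close> along the field \<open>X a\<close> is \<open>ad a
    (F x)\<close>. Fields act on real functions only, so \<open>F\<close> is tested with
    linear forms \<open>l\<close>.\<close>
  define ad where "ad a Z = Z ** NM a - NM a ** Z" for a and Z :: "real ^ 'n ^ 'n"
  have blad: "bounded_linear (ad a)" for a
    unfolding linear_conv_bounded_linear[symmetric] ad_def
    by (rule linearI) (simp_all add: matrix_mult.add_left matrix_mult.add_right matrix_mult.scaleR_left matrix_mult.scaleR_right scaleR_right_diff_distrib)
  have Xf: "X a (pt x) ((\<lambda>x. l (F x)) \<circ> \<phi>) = l (ad a (F x))"
    and smf: "smooth_at A (pt x) ((\<lambda>x. l (F x)) \<circ> \<phi>)"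
    if l: "bounded_linear l" and x: "x \<in> B" for a x and l :: "real ^ 'n ^ 'n \<Rightarrow> real"
  proof -
    have xU: "x \<in> \<phi> ` U" using x B(3) by blast
    have sm: "smooth_on B (\<lambda>x. l (F x))" by (rule smooth_on_linear[OF B(1) l smF])
    have phix: "\<phi> (pt x) \<in> B" using phi_pt[OF xU] x by simp
    show "smooth_at A (pt x) ((\<lambda>x. l (F x)) \<circ> \<phi>)"
      by (rule smooth_at_chart[OF C B(1,3) pt_in[OF xU] phix sm])
    have "((\<lambda>x. l (F x)) has_derivative (\<lambda>u. l (L x u))) (at x)"
      by (rule bounded_linear.has_derivative[OF l dF[OF x]])
    from frechet_derivative_eq[OF this]
    have "X a (pt x) ((\<lambda>x. l (F x)) \<circ> \<phi>) = l (L x (E a x))"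
      unfolding X_coord_pt[OF xU] coord_vec_on_chart[OF C B(1,3) pt_in[OF xU] phix sm] phi_pt[OF xU] by simp
    then show "X a (pt x) ((\<lambda>x. l (F x)) \<circ> \<phi>) = l (ad a (F x))"
      by (simp add: L_def ad_def \<theta>_E[OF xU])
  qed
  have key: "l (ad (br v w) (F x0)) = l (ad w (ad v (F x0))) - l (ad v (ad w (F x0)))"
    if l: "bounded_linear l" for l :: "real ^ 'n ^ 'n \<Rightarrow> real"
  proof -
    let ?f = "(\<lambda>x. l (F x)) \<circ> \<phi>"
    have x0: "x0 \<in> \<phi> ` U" using B by blast
    have iter: "X a (pt x0) (\<lambda>q. X b q ?f) = l (ad b (ad a (F x0)))" for a b
    proof -
      have lb: "bounded_linear (\<lambda>Z. l (ad b Z))" by (rule bounded_linear_compose[OF l blad])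
      have sm: "smooth_on B (\<lambda>x. l (ad b (F x)))" by (rule smooth_on_linear[OF B(1) lb smF])
      have "((\<lambda>x. l (ad b (F x))) has_derivative (\<lambda>u. l (ad b (L x0 u)))) (at x0)"
        by (rule bounded_linear.has_derivative[OF lb dF[OF B(4)]])
      then have "(((\<lambda>q. X b q ?f) \<circ> pt) has_derivative (\<lambda>u. l (ad b (L x0 u)))) (at x0)"
        by (rule has_derivative_transform_within_open[OF _ B(1,4)])
          (simp only: o_apply[of "\<lambda>q. X b q ?f"] Xf[OF l])
      from frechet_derivative_eq[OF this] smooth_at_X[OF smf[OF l B(4)], of b]
      have "X a (pt x0) (\<lambda>q. X b q ?f) = l (ad b (L x0 (E a x0)))"
        unfolding X_coord_pt[OF x0, of a] coord_vec_apply phi_pt[OF x0] by simp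
      then show ?thesis by (simp add: L_def ad_def[of a] \<theta>_E[OF x0])
    qed
    have "l (ad (br v w) (F x0)) = X (br v w) (pt x0) ?f" by (rule Xf[OF l B(4), symmetric])
    also have "\<dots> = X v (pt x0) (\<lambda>q. X w q ?f) - X w (pt x0) (\<lambda>q. X v q ?f)"
      unfolding X_bracket vf_bracket_def using smf[OF l B(4)] by simp
    finally show ?thesis unfolding iter .
  qed
  have "ad (br v w) (F x0) = ad w (ad v (F x0)) - ad v (ad w (F x0))"
  proof (rule vector_eq_rdot[THEN iffD1], rule allI)
    show "ad (br v w) (F x0) \<bullet> Z = (ad w (ad v (F x0)) - ad v (ad w (F x0))) \<bullet> Z" for Z
      using key[OF bounded_linear_inner_left, of Z] by (simp add: inner_diff_left)
  qed
  then have "F x0 ** curv v w = curv v w ** F x0"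
    unfolding ad_def koszul_curvature_def by (simp add: matrix_mult.diff_left matrix_mult.diff_right matrix_mult.add_left matrix_mult.add_right matrix_mul_assoc algebra_simps)
  \<comment> \<open>The transport along the constant segment at \<open>x0\<close> is the identity.\<close>
  moreover have "F x0 = Q"
  proof -
    have "\<Psi> x0 1 = \<Psi> x0 0"
    proof (rule vector_derivative_zero_constant)
      show "(\<Psi> x0 has_vector_derivative 0) (at s within {0..1})" if "s \<in> {0..1}" for s
      proof -
        have "linear (M (linepath x0 x0 s))" using linear_M lB[OF B(4) B(4) that] B(3) by blast
        from linear_0[OF this] show ?thesis
          using transport_matrixD(2)[OF \<Psi>[OF B(4)] that] by (simp add: matrix_mult.zero_left)
      qed
    qed simp
    then show ?thesis unfolding F_def P_def using transport_matrixD(1)[OF \<Psi>[OF B(4)]]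
      by (simp add: transpose_mat matrix_mul_lid matrix_mul_rid)
  qed
  ultimately show ?thesis by simp
qed

end

text \<open>
  The frame at \<open>p\<close> identifies the tangent space isometrically, up to scale, with Euclidean space.
  There the invariant subspace is encoded by its orthogonal projection \<open>Q\<close>.
\<close>

lemma (in left_frame) invariant_subspace_projection:
  assumes W: "tangent_subspace W" "W \<subseteq> tangent_space A p"
    and inv: "\<And>h. h \<in> restricted_holonomy A g p \<Longrightarrow> h ` W \<subseteq> W"
  shows "\<exists>Q. transpose Q = Q \<and> Q ** Q = Q \<and> (\<forall>v w. Q ** curv v w = curv v w ** Q) \<and>
    W = (\<lambda>v. X (Q *v v) p) ` UNIV"
proof -
  obtain U \<phi> where ch: "(U, \<phi>) \<in> A" "p \<in> U" using chart_cover[of p] by blast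
  interpret frame_chart A g X br t U \<phi> by (rule frame_chartI[OF ch(1)])
  define S where "S = {v. X v p \<in> W}"
  have X0: "X 0 p = (\<lambda>f. 0)" using X_lin[of 0 0 0 0 p] by (simp add: lincomb_def)
  have "subspace S"
  proof (rule subspaceI)
    show "0 \<in> S" using W(1) X0 unfolding S_def tangent_subspace_def by simp
    have lc: "a *\<^sub>R v + b *\<^sub>R w \<in> S" if "v \<in> S" "w \<in> S" for a b v w
      using W(1) that X_lin[of a v b w p] unfolding S_def tangent_subspace_def by simp
    show "v + w \<in> S" if "v \<in> S" "w \<in> S" for v w using lc[OF that, of 1 1] by simp
    show "c *\<^sub>R v \<in> S" if "v \<in> S" for c v using lc[OF that that, of c 0] by simp
  qed
  from orthogonal_projection_matrix[OF this] obtain Q :: "real ^ 'n ^ 'n"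
    where Q: "transpose Q = Q" "Q ** Q = Q" "\<And>v. v \<in> S \<longleftrightarrow> Q *v v = v" by blast
  let ?x0 = "\<phi> p"
  have pt0: "pt ?x0 = p" by (rule pt_phi[OF ch(2)])
  have "?x0 \<in> \<phi> ` U" using ch(2) by simp
  then obtain r where r: "r > 0" "cball ?x0 r \<subseteq> \<phi> ` U" using openV open_contains_cball by metis
  have BU: "ball ?x0 r \<subseteq> \<phi> ` U" using r(2) ball_subset_cball by (rule order_trans[rotated])
  have "Q ** curv v w = curv v w ** Q" for v w
  proof (rule curvature_commutes_if_loops_commute[OF r(2,1)])
    fix x y \<Phi>1 \<Phi>2 \<Phi>3
    assume xy: "x \<in> ball ?x0 r" "y \<in> ball ?x0 r" and s: "transport_matrix ?x0 x \<Phi>1" "transport_matrix x y \<Phi>2" "transport_matrix y ?x0 \<Phi>3"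
    obtain h where h: "h \<in> restricted_holonomy A g p"
      "\<And>v. h (X v p) = X (\<Phi>3 1 *v (\<Phi>2 1 *v (\<Phi>1 1 *v v))) p"
      using triangle_holonomy[OF convex_ball BU _ xy s] r(1) unfolding pt0 by auto
    let ?H = "\<Phi>3 1 ** \<Phi>2 1 ** \<Phi>1 1"
    have o: "transpose (\<Phi>1 1) ** \<Phi>1 1 = mat 1" "transpose (\<Phi>2 1) ** \<Phi>2 1 = mat 1" "transpose (\<Phi>3 1) ** \<Phi>3 1 = mat 1"
      using s[THEN transport_matrix_orthogonal(1), of 1] by simp_all
    show "?H ** Q = Q ** ?H"
    proof (rule isometry_commutes_with_projection[OF Q(1,2)])
      have "transpose ?H ** ?H = transpose (\<Phi>1 1) ** (transpose (\<Phi>2 1) ** (transpose (\<Phi>3 1) ** \<Phi>3 1) ** \<Phi>2 1) ** \<Phi>1 1"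
        by (simp add: matrix_transpose_mul matrix_mul_assoc)
      then show "transpose ?H ** ?H = mat 1" by (simp add: o matrix_mul_rid)
      fix v assume "Q *v v = v"
      then have "X v p \<in> W" using Q(3) unfolding S_def by blast
      then have "h (X v p) \<in> W" using inv[OF h(1)] by blast
      then have "?H *v v \<in> S" unfolding S_def h(2) by (simp add: matrix_vector_mul_assoc[symmetric])
      then show "Q *v (?H *v v) = ?H *v v" unfolding Q(3) .
    qed
  qed
  moreover have "W = (\<lambda>v. X (Q *v v) p) ` UNIV"
  proof
    show "(\<lambda>v. X (Q *v v) p) ` UNIV \<subseteq> W"
    proof clarify
      fix v
      have "Q *v v \<in> S" unfolding Q(3) by (simp add: matrix_vector_mul_assoc Q(2))
      then show "X (Q *v v) p \<in> W" unfolding S_def by simp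
    qed
    show "W \<subseteq> (\<lambda>v. X (Q *v v) p) ` UNIV"
    proof
      fix z assume z: "z \<in> W"
      then obtain u where u: "z = coord_vec A (U, \<phi>) p u" using W(2) tangent_space_eq[OF ch] by blast
      then have zX: "z = X (\<theta> ?x0 u) p" using X_coord[OF ch(2), of "\<theta> ?x0 u"] E_\<theta>[of ?x0 u] ch(2) by simp
      then have "\<theta> ?x0 u \<in> S" using z unfolding S_def by simp
      then have "Q *v \<theta> ?x0 u = \<theta> ?x0 u" unfolding Q(3) .
      then show "z \<in> (\<lambda>v. X (Q *v v) p) ` UNIV" using zX by (metis rangeI)
    qed
  qed
  ultimately show ?thesis using Q by blast
qed


section \<open>The three families of Lie algebras\<close>

lemma (in left_frame) tangent_space_frame: "tangent_space A p = range (\<lambda>v. X v p)"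
proof
  obtain U \<phi> where ch: "(U, \<phi>) \<in> A" "p \<in> U" using chart_cover[of p] by blast
  interpret frame_chart A g X br t U \<phi> by (rule frame_chartI[OF ch(1)])
  show "tangent_space A p \<subseteq> range (\<lambda>v. X v p)"
  proof
    fix z assume "z \<in> tangent_space A p"
    then obtain u where u: "z = coord_vec A (U, \<phi>) p u" using tangent_space_eq[OF ch] by blast
    then have "z = X (\<theta> (\<phi> p) u) p"
      using X_coord[OF ch(2), of "\<theta> (\<phi> p) u"] E_\<theta>[of "\<phi> p" u] ch(2) by simp
    then show "z \<in> range (\<lambda>v. X v p)" by (rule range_eqI)
  qed
  show "range (\<lambda>v. X v p) \<subseteq> tangent_space A p"
    using X_field unfolding smooth_vector_field_def by blast
qed

text \<open>
  An invariant subspace gives a projection that is scalar, hence \<open>0\<close> or \<open>1\<close>.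
\<close>

lemma (in left_frame) irreducible_if_symmetric_commutant_scalar:
  assumes scalar: "\<And>Q. transpose Q = Q \<Longrightarrow> (\<And>v w. Q ** curv v w = curv v w ** Q) \<Longrightarrow> \<exists>c. Q = mat c"
  shows "irreducible_riemannian A g"
  unfolding irreducible_riemannian_def acts_irreducibly_def
proof (intro allI conjI impI)
  fix p
  have X0: "X 0 p = (\<lambda>f. 0)" using X_lin[of 0 0 0 0 p] by (simp add: lincomb_def)
  have "X (axis undefined 1) p \<noteq> X 0 p" unfolding X_inject by (simp add: axis_eq_0_iff)
  moreover have "X (axis undefined 1) p \<in> tangent_space A p" unfolding tangent_space_frame by (rule rangeI)
  ultimately show "tangent_space A p \<noteq> {\<lambda>f. 0}" unfolding X0 by blast
  fix W assume W: "tangent_subspace W \<and> W \<subseteq> tangent_space A p \<and> (\<forall>h\<in>restricted_holonomy A g p. h ` W \<subseteq> W)"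
  then obtain Q where Q: "transpose Q = Q" "Q ** Q = Q" "\<forall>v w. Q ** curv v w = curv v w ** Q"
      "W = range (\<lambda>v. X (Q *v v) p)"
    using invariant_subspace_projection[of W p] by auto
  then obtain c where c: "Q = mat c" using scalar[of Q] by blast
  have Qv: "mat c *v v = c *\<^sub>R v" for v :: "real ^ 'n"
    by (simp add: vec_eq_iff matrix_vector_mult_def mat_def if_distrib[of "\<lambda>z. z * _"] cong: if_cong)
  have cc: "c = 0 \<or> c = 1"
  proof -
    let ?e = "axis undefined 1 :: real ^ 'n"
    have "Q *v (Q *v ?e) = Q *v ?e" by (simp add: matrix_vector_mul_assoc Q(2))
    then have "(c * c - c) *\<^sub>R ?e = 0" unfolding c Qv by (simp add: scaleR_left_diff_distrib)
    then show ?thesis by (simp add: axis_eq_0_iff)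
  qed
  then show "W = {\<lambda>f. 0} \<or> W = tangent_space A p"
    unfolding Q(4) c Qv tangent_space_frame using X0 by auto
qed

lemma koszul_matrix_entry:
  assumes "bilinear br"
  shows "koszul_matrix br w $ i $ j =
    (br w (axis j 1) $ i - br (axis j 1) (axis i 1) \<bullet> w + br (axis i 1) w $ j) / 2"
proof -
  have "koszul_matrix br w $ i $ j = koszul br w (axis j 1) \<bullet> axis i 1"
    by (simp add: koszul_matrix_def matrix_def inner_axis)
  then show ?thesis unfolding koszul_inner[OF assms] by (simp add: inner_axis)
qed

text \<open>
  The basis vectors \<open>e\<^sub>1, e\<^sub>2, e\<^sub>3\<close> span a Heisenberg algebra, and \<open>ad e\<^sub>4\<close> acts on \<open>e\<^sub>1, e\<^sub>2\<close> by the matrix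
  with diagonal \<open>p, s\<close> and off-diagonal entries \<open>q, -q\<close>, and on \<open>e\<^sub>3\<close> by \<open>r\<close>. With suitable parameters
  this is the bracket of each of the three families.
\<close>

definition heisenberg_extension :: "real \<Rightarrow> real \<Rightarrow> real \<Rightarrow> real \<Rightarrow> (real ^ 4 \<Rightarrow> real ^ 4 \<Rightarrow> real ^ 4) \<Rightarrow> bool" where
  "heisenberg_extension p q s r br \<longleftrightarrow> (\<forall>x y.
     br x y $ 1 = p * (x $ 4 * y $ 1 - x $ 1 * y $ 4) + q * (x $ 4 * y $ 2 - x $ 2 * y $ 4) \<and>
     br x y $ 2 = - q * (x $ 4 * y $ 1 - x $ 1 * y $ 4) + s * (x $ 4 * y $ 2 - x $ 2 * y $ 4) \<and>
     br x y $ 3 = x $ 1 * y $ 2 - x $ 2 * y $ 1 + r * (x $ 4 * y $ 3 - x $ 3 * y $ 4) \<and>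
     br x y $ 4 = 0)"

lemma d4_heisenberg_extension:
  "heisenberg_extension (1/2) 0 (1/2) 1 d4_half"
  "heisenberg_extension 1 0 (-1/2) (1/2) d4_two"
  "heisenberg_extension (1/2) (1/\<delta>) (1/2) 1 (d4_prime \<delta>)"
  unfolding heisenberg_extension_def d4_half_def d4_two_def d4_prime_def
  by (simp_all add: bracket_simps algebra_simps)

definition rotation_generator :: "4 \<Rightarrow> 4 \<Rightarrow> real ^ 4 ^ 4" where
  "rotation_generator i j = (\<chi> a b. if a = i \<and> b = j then 1 else if a = j \<and> b = i then - 1 else 0)"

lemmas entry_simps = inner_vec_def sum_4 heisenberg_extension_def axis_def distinct_4 distinct_4[symmetric]
  matrix_matrix_mult_def rotation_generator_def forall_4 vec_eq_iff

text \<open>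
  Neither matrix depends on \<open>q\<close>: for \<open>p = s\<close> the rotation part of \<open>ad e\<^sub>4\<close> extends to a skew derivation
  of the whole algebra. It enters the connection only through \<open>N e\<^sub>4\<close>, and there its commutator with
  \<open>N w\<close> cancels against its contribution to \<open>N [e\<^sub>4, w]\<close>.
\<close>

lemma curvature_half_type:
  assumes "bilinear br" "heisenberg_extension (1/2) q (1/2) 1 br"
  shows "koszul_curvature br (axis 2 1) (axis 1 1) =
      rotation_generator 1 2 - (1/2) *\<^sub>R rotation_generator 3 4"
    and "koszul_curvature br (axis 3 1) (axis 1 1) =
      (1/4) *\<^sub>R (rotation_generator 1 3 - rotation_generator 2 4)"
  using assms(2)
  by (simp_all add: koszul_curvature_def koszul_matrix_entry[OF assms(1)] entry_simps)

lemma curvature_two_type: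
  assumes "bilinear br" "heisenberg_extension 1 0 (-1/2) (1/2) br"
  shows "koszul_curvature br (axis 2 1) (axis 1 1) =
      (1/4) *\<^sub>R (rotation_generator 1 2 - rotation_generator 3 4)"
    and "koszul_curvature br (axis 4 1) (axis 1 1) =
      rotation_generator 1 4 + (1/2) *\<^sub>R rotation_generator 2 3"
  using assms(2)
  by (simp_all add: koszul_curvature_def koszul_matrix_entry[OF assms(1)] entry_simps)

text \<open>
  The first matrix rotates the planes \<open>e\<^sub>1, e\<^sub>2\<close> and \<open>e\<^sub>3, e\<^sub>4\<close> with different speeds. A symmetric matrix
  that commutes with it is therefore scalar on each plane, and the second matrix exchanges the
  planes, which makes the two scalars equal.
\<close>

lemma symmetric_commutant_half_type:
  assumes "transpose Q = Q"
    and K: "Q ** (rotation_generator 1 2 - (1/2) *\<^sub>R rotation_generator 3 4) =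
      (rotation_generator 1 2 - (1/2) *\<^sub>R rotation_generator 3 4) ** Q"
    and L: "Q ** ((1/4) *\<^sub>R (rotation_generator 1 3 - rotation_generator 2 4)) =
      ((1/4) *\<^sub>R (rotation_generator 1 3 - rotation_generator 2 4)) ** Q"
  shows "Q = mat (Q $ 1 $ 1)"
proof -
  have s: "Q $ j $ i = Q $ i $ j" for i j
    using arg_cong[OF assms(1), of "\<lambda>Z. Z $ i $ j"] by (simp add: transpose_def)
  note sym = s[of 2 1] s[of 3 1] s[of 4 1] s[of 3 2] s[of 4 2] s[of 4 3]
  note k = arg_cong[OF K, of "\<lambda>Z. Z $ i $ j" for i j]
  have "Q $ 1 $ 2 = 0" "Q $ 3 $ 4 = 0" "Q $ 2 $ 2 = Q $ 1 $ 1" "Q $ 4 $ 4 = Q $ 3 $ 3"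
    using k[of 1 1] k[of 3 3] k[of 1 2] k[of 3 4] by (simp_all add: entry_simps sym)
  moreover have "2 * Q $ 2 $ 3 = Q $ 1 $ 4" "2 * Q $ 1 $ 4 = Q $ 2 $ 3"
      "2 * Q $ 2 $ 4 = - Q $ 1 $ 3" "2 * Q $ 1 $ 3 = - Q $ 2 $ 4"
    using k[of 1 3] k[of 2 4] k[of 1 4] k[of 2 3] by (simp_all add: entry_simps sym)
  moreover have "Q $ 3 $ 3 = Q $ 1 $ 1"
    using arg_cong[OF L, of "\<lambda>Z. Z $ 1 $ 3"] by (simp add: entry_simps sym)
  ultimately show ?thesis
    by (simp add: vec_eq_iff forall_4 mat_def distinct_4 distinct_4[symmetric] sym)
qed

text \<open>
  As before, now with the planes \<open>e\<^sub>1, e\<^sub>4\<close> and \<open>e\<^sub>2, e\<^sub>3\<close>, rotated with different speeds by the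
  second matrix and exchanged by the first one.
\<close>

lemma symmetric_commutant_two_type:
  assumes "transpose Q = Q"
    and L: "Q ** ((1/4) *\<^sub>R (rotation_generator 1 2 - rotation_generator 3 4)) =
      ((1/4) *\<^sub>R (rotation_generator 1 2 - rotation_generator 3 4)) ** Q"
    and K: "Q ** (rotation_generator 1 4 + (1/2) *\<^sub>R rotation_generator 2 3) =
      (rotation_generator 1 4 + (1/2) *\<^sub>R rotation_generator 2 3) ** Q"
  shows "Q = mat (Q $ 1 $ 1)"
proof -
  have s: "Q $ j $ i = Q $ i $ j" for i j
    using arg_cong[OF assms(1), of "\<lambda>Z. Z $ i $ j"] by (simp add: transpose_def)
  note sym = s[of 2 1] s[of 3 1] s[of 4 1] s[of 3 2] s[of 4 2] s[of 4 3]
  note k = arg_cong[OF K, of "\<lambda>Z. Z $ i $ j" for i j]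
  have "Q $ 1 $ 4 = 0" "Q $ 2 $ 3 = 0" "Q $ 4 $ 4 = Q $ 1 $ 1" "Q $ 3 $ 3 = Q $ 2 $ 2"
    using k[of 1 1] k[of 2 2] k[of 1 4] k[of 2 3] by (simp_all add: entry_simps sym)
  moreover have "2 * Q $ 2 $ 4 = - Q $ 1 $ 3" "2 * Q $ 1 $ 3 = - Q $ 2 $ 4"
      "2 * Q $ 3 $ 4 = Q $ 1 $ 2" "2 * Q $ 1 $ 2 = Q $ 3 $ 4"
    using k[of 1 2] k[of 4 3] k[of 1 3] k[of 4 2] by (simp_all add: entry_simps sym)
  moreover have "Q $ 2 $ 2 = Q $ 1 $ 1"
    using arg_cong[OF L, of "\<lambda>Z. Z $ 1 $ 2"] by (simp add: entry_simps sym)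
  ultimately show ?thesis
    by (simp add: vec_eq_iff forall_4 mat_def distinct_4 distinct_4[symmetric] sym)
qed

lemma bracket_of_table_anti: "bracket_of_table B x y = - bracket_of_table B y x"
  unfolding bracket_of_table_def sum_negf[symmetric] scaleR_minus_left[symmetric] by (simp add: algebra_simps)

text \<open>
  Left translation by \<open>p\<close> carries the values of left invariant fields at the identity to those at \<open>p\<close>
  and preserves the metric, so the inner products of the fields are constant.
\<close>

lemma associated_lie_group_left_frame:
  fixes A :: "('m::topological_space, real ^ 4) chart set"
  assumes assoc: "associated_lie_group br (ip_scaled t) A G g" and "t > 0"
    and "bilinear br" "\<And>v w. br v w = - br w v"
  shows "\<exists>X. left_frame A g X br t"
proof -
  have grp: "smooth_atlas A" "group G" "carrier G = UNIV" and lim: "left_invariant_metric A G g"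
    using assoc unfolding associated_lie_group_def lie_group_def by simp_all
  obtain X where X: "lie_algebra_iso A G br X"
      "\<And>x y. g \<one>\<^bsub>G\<^esub> (X x \<one>\<^bsub>G\<^esub>) (X y \<one>\<^bsub>G\<^esub>) = ip_scaled t x y"
    using assoc unfolding associated_lie_group_def by blast
  have inv: "X v \<in> left_invariant_fields A G" for v
    using X(1) unfolding lie_algebra_iso_def bij_betw_def by blast
  have field: "smooth_vector_field A (X v)"
    and push: "pushforward A (\<lambda>q. a \<otimes>\<^bsub>G\<^esub> q) p (X v p) = X v (a \<otimes>\<^bsub>G\<^esub> p)" for v a p
    using inv[of v] unfolding left_invariant_fields_def by auto
  have one: "p \<otimes>\<^bsub>G\<^esub> \<one>\<^bsub>G\<^esub> = p" for p
    using monoid.r_one[OF group.is_monoid[OF grp(2)]] grp(3) by simp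
  have tang: "X v p \<in> tangent_space A p" for v p
    using field unfolding smooth_vector_field_def by blast
  have "g (p \<otimes>\<^bsub>G\<^esub> \<one>\<^bsub>G\<^esub>) (X v (p \<otimes>\<^bsub>G\<^esub> \<one>\<^bsub>G\<^esub>)) (X w (p \<otimes>\<^bsub>G\<^esub> \<one>\<^bsub>G\<^esub>)) = ip_scaled t v w" for p v w
    using lim tang unfolding left_invariant_metric_def X(2)[symmetric] push[symmetric] by blast
  then have orth: "g p (X v p) (X w p) = t * (v \<bullet> w)" for p v w
    unfolding one ip_scaled_def .
  have "left_frame A g X br t"
  proof
    show "smooth_atlas A" by (rule grp(1))
    show "riemannian_metric A g" using lim unfolding left_invariant_metric_def by simp
    show "X (a *\<^sub>R v + b *\<^sub>R w) p = lincomb a (X v p) b (X w p)"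
      and "X (br v w) = vf_bracket A (X v) (X w)" for a v b w p
      using X(1) unfolding lie_algebra_iso_def by blast+
  qed (rule assms field orth)+
  then show ?thesis by blast
qed

theorem proposition4p1:
  fixes br :: "real ^ 4 \<Rightarrow> real ^ 4 \<Rightarrow> real ^ 4"
    and t :: real
    and A :: "('m::{t2_space, second_countable_topology}, real ^ 4) chart set"
    and G :: "'m monoid"
    and g :: "'m metric"
  assumes "t > 0"
    and "br = d4_half \<or> br = d4_two \<or> (\<exists>\<delta>>0. br = d4_prime \<delta>)"
    and "associated_lie_group br (ip_scaled t) A G g"
  shows "irreducible_riemannian A g"
proof -
  have br: "bilinear br" "br v w = - br w v" for v w
    using assms(2) bilinear_bracket_of_table bracket_of_table_anti
    unfolding d4_half_def d4_two_def d4_prime_def by (auto simp del: minus_equation_iff)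
  obtain X where "left_frame A g X br t"
    using associated_lie_group_left_frame[OF assms(3,1) br] by blast
  then interpret left_frame A g X br t .
  have type: "(\<exists>q. heisenberg_extension (1/2) q (1/2) 1 br) \<or> heisenberg_extension 1 0 (-1/2) (1/2) br"
    using assms(2) d4_heisenberg_extension by blast
  show ?thesis
  proof (rule irreducible_if_symmetric_commutant_scalar)
    fix Q assume Q: "transpose Q = Q" "\<And>v w. Q ** curv v w = curv v w ** Q"
    from type show "\<exists>c. Q = mat c"
    proof (elim disjE exE)
      fix q assume h: "heisenberg_extension (1/2) q (1/2) 1 br"
      show ?thesis
        using symmetric_commutant_half_type[OF Q(1)] Q(2)[of "axis 2 1" "axis 1 1"] Q(2)[of "axis 3 1" "axis 1 1"]
        unfolding curvature_half_type[OF br(1) h] by blast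
    next
      assume h: "heisenberg_extension 1 0 (-1/2) (1/2) br"
      show ?thesis
        using symmetric_commutant_two_type[OF Q(1)] Q(2)[of "axis 2 1" "axis 1 1"] Q(2)[of "axis 4 1" "axis 1 1"]
        unfolding curvature_two_type[OF br(1) h] by blast
    qed
  qed
qed

end
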